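(* The following decision problem is NP-hard: given a (not necessarily bipartite) graph $G=(V,E)$ in which every node has a strict preference order over its neighbours, decide whether $G$ admits a dominant matching. Moreover, the problem remains NP-hard when restricted to instances $G$ that admit a stable matching.
   Context: A matching is a set of pairwise disjoint edges; $M(u)$ denotes the partner of $u$ in $M$. An unmatched node is considered to prefer any neighbour to being unmatched. A node $u$ prefers matching $M$ to matching $N$ if either $u$ is matched in $M$ and unmatched in $N$, or $u$ is matched in both and prefers $M(u)$ to $N(u)$. Let $\phi(M,N)$ be the number of nodes preferring $M$ to $N$ and $\Delta(M,N)=\phi(M,N)-\phi(N,M)$. A matching $M$ is popular if $\Delta(M,N)\ge 0$ for every matching $N$. A popular matching $M$ is dominant if $\Delta(M,N)>0$ for every matching $N$ with $|N|>|M|$. A matching $M$ is stable if there is no edge $(u,v)\notin M$ such that both $u$ and $v$ prefer each other to their respective situations in $M$. *)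

theory Defs
  imports "HOL-Computational_Algebra.Polynomial"
begin

section \<open>Polynomial time and NP-hardness\<close>

text \<open>
  Deterministic multi-tape Turing machines. States are the numbers below
  \<open>nstates\<close> and tape symbols the numbers below \<open>nsyms\<close>; symbol 0 is the blank, and the
  tapes are infinite in both directions. State 0 is the initial state, state 1 the accepting
  and state 2 the rejecting halting state. Given a state and the list of scanned symbols,
  \<open>delta\<close> yields the next state and for every tape the symbol to write and the head move.
\<close>

datatype move = Move_Left | Stay | Move_Right

record turing_machine =
  ntapes :: nat
  nstates :: nat
  nsyms :: nat
  delta :: "nat \<Rightarrow> nat list \<Rightarrow> nat \<times> (nat \<times> move) list"

text \<open>Symbols 1 and 2 represent the two bits, symbol 3 is a separator.\<close>

definition wf_turing_machine :: "turing_machine \<Rightarrow> bool" where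
  "wf_turing_machine M \<longleftrightarrow>
     ntapes M \<ge> 1 \<and> nstates M \<ge> 3 \<and> nsyms M \<ge> 4 \<and>
     (\<forall>q < nstates M. \<forall>ss. length ss = ntapes M \<and> set ss \<subseteq> {..<nsyms M} \<longrightarrow>
        fst (delta M q ss) < nstates M \<and>
        length (snd (delta M q ss)) = ntapes M \<and>
        fst ` set (snd (delta M q ss)) \<subseteq> {..<nsyms M})"

type_synonym tape = "int \<Rightarrow> nat"

text \<open>A configuration: the state and, for every tape, its content and its head position.\<close>

type_synonym config = "nat \<times> (tape \<times> int) list"

fun offset :: "move \<Rightarrow> int" where
  "offset Move_Left = -1"
| "offset Stay = 0"
| "offset Move_Right = 1"

fun act :: "tape \<times> int \<Rightarrow> nat \<times> move \<Rightarrow> tape \<times> int" where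
  "act (t, h) (s, d) = (t(h := s), h + offset d)"

definition step :: "turing_machine \<Rightarrow> config \<Rightarrow> config" where
  "step M c =
     (if fst c \<in> {1, 2} then c
      else let (q, as) = delta M (fst c) (map (\<lambda>(t, h). t h) (snd c))
           in (q, map2 act (snd c) as))"

definition tape_of :: "nat list \<Rightarrow> tape" where
  "tape_of w = (\<lambda>i. if 0 \<le> i \<and> nat i < length w then w ! nat i else 0)"

definition init_config :: "turing_machine \<Rightarrow> nat list \<Rightarrow> config" where
  "init_config M w = (0, (tape_of w, 0) # replicate (ntapes M - 1) (tape_of [], 0))"

text \<open>Halting configurations are fixed points of \<^const>\<open>step\<close>, so \<open>run M t w\<close> is the final
  configuration if \<open>M\<close> halts on input \<open>w\<close> within \<open>t\<close> steps.\<close>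

definition run :: "turing_machine \<Rightarrow> nat \<Rightarrow> nat list \<Rightarrow> config" where
  "run M t w = (step M ^^ t) (init_config M w)"

definition bits :: "bool list \<Rightarrow> nat list" where
  "bits x = map (\<lambda>b. if b then 2 else 1) x"

text \<open>The input is on tape 0; the output is the exact content of tape 1 after halting.\<close>

definition polytime_computable :: "(bool list \<Rightarrow> bool list) \<Rightarrow> bool" where
  "polytime_computable f \<longleftrightarrow>
     (\<exists>M (p :: nat poly). wf_turing_machine M \<and> ntapes M \<ge> 2 \<and>
        (\<forall>x. let c = run M (poly p (length x)) (bits x)
             in fst c = 1 \<and> fst (snd c ! 1) = tape_of (bits (f x))))"

definition polytime_decidable_rel :: "(bool list \<times> bool list) set \<Rightarrow> bool" where
  "polytime_decidable_rel R \<longleftrightarrow>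
     (\<exists>M (p :: nat poly). wf_turing_machine M \<and>
        (\<forall>x w. fst (run M (poly p (length x + length w)) (bits x @ [3] @ bits w)) =
               (if (x, w) \<in> R then 1 else 2)))"

definition NP :: "bool list set set" where
  "NP = {L. \<exists>R (p :: nat poly). polytime_decidable_rel R \<and>
              (\<forall>x. x \<in> L \<longleftrightarrow> (\<exists>w. length w \<le> poly p (length x) \<and> (x, w) \<in> R))}"

text \<open>
  NP-hardness, under polynomial-time many-one reductions, of the problem of deciding \<open>Q i\<close>
  for a given instance \<open>i \<in> I\<close>, where instances are presented as bit strings via \<open>enc\<close>.
  Reductions have to produce encodings of members of \<open>I\<close> only; choosing a smaller \<open>I\<close>
  thus expresses hardness of the problem restricted to these instances.
\<close>

definition NP_hard :: "('i \<Rightarrow> bool list) \<Rightarrow> 'i set \<Rightarrow> ('i \<Rightarrow> bool) \<Rightarrow> bool" where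
  "NP_hard enc I Q \<longleftrightarrow>
     (\<forall>L \<in> NP. \<exists>f. polytime_computable f \<and>
        (\<forall>x. \<exists>i \<in> I. f x = enc i \<and> (x \<in> L \<longleftrightarrow> Q i)))"


section \<open>Graphs with strict preferences\<close>

text \<open>\<open>(v, w) \<in> pref G u\<close> means that \<open>u\<close> prefers \<open>v\<close> to \<open>w\<close>.\<close>

record 'a pref_graph =
  nodes :: "'a set"
  edges :: "'a set set"
  pref :: "'a \<Rightarrow> ('a \<times> 'a) set"

definition neighbours :: "('a, 'z) pref_graph_scheme \<Rightarrow> 'a \<Rightarrow> 'a set" where
  "neighbours G u = {v. {u, v} \<in> edges G}"

definition wf_pref_graph :: "('a, 'z) pref_graph_scheme \<Rightarrow> bool" where
  "wf_pref_graph G \<longleftrightarrow>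
     finite (nodes G) \<and>
     (\<forall>e \<in> edges G. \<exists>u \<in> nodes G. \<exists>v \<in> nodes G. u \<noteq> v \<and> e = {u, v}) \<and>
     (\<forall>u. pref G u \<subseteq> neighbours G u \<times> neighbours G u \<and>
          strict_linear_order_on (neighbours G u) (pref G u))"

definition matching :: "('a, 'z) pref_graph_scheme \<Rightarrow> 'a set set \<Rightarrow> bool" where
  "matching G M \<longleftrightarrow> M \<subseteq> edges G \<and> (\<forall>e \<in> M. \<forall>e' \<in> M. e \<noteq> e' \<longrightarrow> e \<inter> e' = {})"

definition matched :: "'a set set \<Rightarrow> 'a \<Rightarrow> bool" where
  "matched M u \<longleftrightarrow> u \<in> \<Union>M"

definition partner :: "'a set set \<Rightarrow> 'a \<Rightarrow> 'a" where
  "partner M u = (THE v. {u, v} \<in> M)"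

definition prefers_matching ::
    "('a, 'z) pref_graph_scheme \<Rightarrow> 'a \<Rightarrow> 'a set set \<Rightarrow> 'a set set \<Rightarrow> bool" where
  "prefers_matching G u M N \<longleftrightarrow>
     (matched M u \<and> \<not> matched N u) \<or>
     (matched M u \<and> matched N u \<and> (partner M u, partner N u) \<in> pref G u)"

definition votes :: "('a, 'z) pref_graph_scheme \<Rightarrow> 'a set set \<Rightarrow> 'a set set \<Rightarrow> nat" where
  "votes G M N = card {u \<in> nodes G. prefers_matching G u M N}"

definition vote_diff :: "('a, 'z) pref_graph_scheme \<Rightarrow> 'a set set \<Rightarrow> 'a set set \<Rightarrow> int" where
  "vote_diff G M N = int (votes G M N) - int (votes G N M)"

definition popular :: "('a, 'z) pref_graph_scheme \<Rightarrow> 'a set set \<Rightarrow> bool" where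
  "popular G M \<longleftrightarrow> matching G M \<and> (\<forall>N. matching G N \<longrightarrow> vote_diff G M N \<ge> 0)"

definition dominant :: "('a, 'z) pref_graph_scheme \<Rightarrow> 'a set set \<Rightarrow> bool" where
  "dominant G M \<longleftrightarrow>
     popular G M \<and> (\<forall>N. matching G N \<and> card N > card M \<longrightarrow> vote_diff G M N > 0)"

definition prefers_to_situation ::
    "('a, 'z) pref_graph_scheme \<Rightarrow> 'a set set \<Rightarrow> 'a \<Rightarrow> 'a \<Rightarrow> bool" where
  "prefers_to_situation G M u v \<longleftrightarrow> \<not> matched M u \<or> (v, partner M u) \<in> pref G u"

definition stable_matching :: "('a, 'z) pref_graph_scheme \<Rightarrow> 'a set set \<Rightarrow> bool" where
  "stable_matching G M \<longleftrightarrow>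
     matching G M \<and>
     \<not> (\<exists>u v. {u, v} \<in> edges G - M \<and>
              prefers_to_situation G M u v \<and> prefers_to_situation G M v u)"


section \<open>Presentation of instances as bit strings\<close>

text \<open>
  An instance with node set \<open>{..<n}\<close> is given by \<open>n\<close> preference lists:
  \<open>ps ! u\<close> lists the neighbours of \<open>u\<close>, the most preferred one first.
\<close>

definition pref_lists :: "nat list list set" where
  "pref_lists =
     {ps. \<forall>u < length ps. distinct (ps ! u) \<and>
            (\<forall>v \<in> set (ps ! u). v < length ps \<and> v \<noteq> u \<and> u \<in> set (ps ! v))}"

definition graph_of :: "nat list list \<Rightarrow> nat pref_graph" where
  "graph_of ps =
     \<lparr>nodes = {..<length ps},
      edges = {{u, v} | u v. u < length ps \<and> v \<in> set (ps ! u)},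
      pref = (\<lambda>u. {(ps ! u ! i, ps ! u ! j) | i j.
                     u < length ps \<and> i < j \<and> j < length (ps ! u)})\<rparr>"

text \<open>
  Node \<open>v\<close> is written as \<open>v + 1\<close> ones followed by a zero, and each preference list is
  terminated by a further zero. As node names are smaller than the number of nodes, this
  unary notation is polynomially related to binary notation.
\<close>

definition encode_node :: "nat \<Rightarrow> bool list" where
  "encode_node v = replicate (Suc v) True @ [False]"

definition encode_list :: "nat list \<Rightarrow> bool list" where
  "encode_list xs = concat (map encode_node xs) @ [False]"

definition encode :: "nat list list \<Rightarrow> bool list" where
  "encode ps = concat (map encode_list ps)"

lemma encode_node_inj:
  assumes "encode_node v @ r = encode_node w @ s"
  shows "v = w \<and> r = s"
  using assms
proof (induction v arbitrary: w)
  case 0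
  then show ?case by (cases w) (auto simp: encode_node_def)
next
  case (Suc v)
  then show ?case by (cases w) (auto simp: encode_node_def)
qed

lemma encode_list_inj:
  assumes "encode_list xs @ r = encode_list ys @ s"
  shows "xs = ys \<and> r = s"
  using assms
proof (induction xs arbitrary: ys)
  case Nil
  then show ?case by (cases ys) (auto simp: encode_list_def encode_node_def)
next
  case (Cons x xs)
  show ?case
  proof (cases ys)
    case Nil
    then show ?thesis using Cons.prems by (auto simp: encode_list_def encode_node_def)
  next
    case (Cons y ys')
    have "encode_node x @ (encode_list xs @ r) = encode_node y @ (encode_list ys' @ s)"
      using Cons.prems Cons by (simp add: encode_list_def)
    from encode_node_inj[OF this] Cons.IH[of ys'] Cons show ?thesis by simp
  qed
qed

lemma inj_encode: "inj encode"
proof (rule injI)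
  fix ps qs
  show "encode ps = encode qs \<Longrightarrow> ps = qs"
  proof (induction ps arbitrary: qs)
    case Nil
    then show ?case by (cases qs) (auto simp: encode_def encode_list_def)
  next
    case (Cons p ps)
    show ?case
    proof (cases qs)
      case Nil
      then show ?thesis using Cons.prems by (auto simp: encode_def encode_list_def)
    next
      case (Cons q qs')
      have "encode_list p @ encode ps = encode_list q @ encode qs'"
        using Cons.prems Cons by (simp add: encode_def)
      from encode_list_inj[OF this] Cons.IH[of qs'] Cons show ?thesis by simp
    qed
  qed
qed

lemma neighbours_graph_of:
  assumes "ps \<in> pref_lists"
  shows "neighbours (graph_of ps) u = (if u < length ps then set (ps ! u) else {})"
proof -
  have sym: "v < length ps \<and> w \<in> set (ps ! v)" if "w < length ps" "v \<in> set (ps ! w)" for v w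
    using assms that unfolding pref_lists_def by blast
  have "{u, v} \<in> edges (graph_of ps) \<longleftrightarrow> u < length ps \<and> v \<in> set (ps ! u)" for v
    unfolding graph_of_def by (auto simp: doubleton_eq_iff dest: sym)
  then show ?thesis by (auto simp: neighbours_def)
qed

lemma wf_graph_of:
  assumes ps: "ps \<in> pref_lists"
  shows "wf_pref_graph (graph_of ps)"
proof -
  have "strict_linear_order_on (neighbours (graph_of ps) u) (pref (graph_of ps) u)" for u
  proof (cases "u < length ps")
    case True
    then have d: "distinct (ps ! u)" using ps by (auto simp: pref_lists_def)
    have r: "pref (graph_of ps) u =
        {(ps ! u ! i, ps ! u ! j) | i j. i < j \<and> j < length (ps ! u)}"
      using True by (auto simp: graph_of_def)
    have n: "neighbours (graph_of ps) u = set (ps ! u)"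
      using neighbours_graph_of[OF ps] True by simp
    have "trans (pref (graph_of ps) u)"
    proof (rule transI)
      fix x y z assume "(x, y) \<in> pref (graph_of ps) u" "(y, z) \<in> pref (graph_of ps) u"
      then obtain i j k l where
        "x = ps ! u ! i" "y = ps ! u ! j" "i < j" "j < length (ps ! u)"
        "y = ps ! u ! k" "z = ps ! u ! l" "k < l" "l < length (ps ! u)"
        unfolding r by blast
      moreover from this d have "j = k" by (simp add: nth_eq_iff_index_eq)
      ultimately show "(x, z) \<in> pref (graph_of ps) u" unfolding r by force
    qed
    moreover have "irrefl (pref (graph_of ps) u)"
      unfolding r irrefl_def using d by (auto simp: nth_eq_iff_index_eq)
    moreover have "total_on (set (ps ! u)) (pref (graph_of ps) u)"
    proof (rule total_onI)
      fix x y assume "x \<in> set (ps ! u)" "y \<in> set (ps ! u)" "x \<noteq> y"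
      then obtain i j where ij: "x = ps ! u ! i" "i < length (ps ! u)"
          "y = ps ! u ! j" "j < length (ps ! u)" "i \<noteq> j"
        unfolding in_set_conv_nth by metis
      then show "(x, y) \<in> pref (graph_of ps) u \<or> (y, x) \<in> pref (graph_of ps) u"
        unfolding r by (cases "i < j") force+
    qed
    ultimately show ?thesis using n by (simp add: strict_linear_order_on_def)
  next
    case False
    then have "pref (graph_of ps) u = {}" "neighbours (graph_of ps) u = {}"
      using neighbours_graph_of[OF ps] by (auto simp: graph_of_def)
    then show ?thesis
      by (simp add: strict_linear_order_on_def irrefl_def total_on_def trans_def)
  qed
  moreover have "pref (graph_of ps) u \<subseteq>
      neighbours (graph_of ps) u \<times> neighbours (graph_of ps) u" for u
    unfolding neighbours_graph_of[OF ps] by (auto simp: graph_of_def)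
  moreover have "\<forall>e \<in> edges (graph_of ps). \<exists>u \<in> nodes (graph_of ps).
      \<exists>v \<in> nodes (graph_of ps). u \<noteq> v \<and> e = {u, v}"
  proof
    fix e assume "e \<in> edges (graph_of ps)"
    then obtain u v where uv: "e = {u, v}" "u < length ps" "v \<in> set (ps ! u)"
      by (auto simp: graph_of_def)
    then have "v < length ps" "u \<noteq> v" using ps unfolding pref_lists_def by blast+
    then have "u \<in> nodes (graph_of ps) \<and> v \<in> nodes (graph_of ps) \<and> u \<noteq> v \<and> e = {u, v}"
      using uv(1,2) by (simp add: graph_of_def)
    then show "\<exists>u \<in> nodes (graph_of ps). \<exists>v \<in> nodes (graph_of ps). u \<noteq> v \<and> e = {u, v}"
      by blast
  qed
  moreover have "finite (nodes (graph_of ps))" by (simp add: graph_of_def)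
  ultimately show ?thesis unfolding wf_pref_graph_def by blast
qed

lemma strict_linear_order_on_list:
  assumes "finite A" "strict_linear_order_on A r"
  shows "\<exists>xs. distinct xs \<and> set xs = A \<and> sorted_wrt (\<lambda>x y. (x, y) \<in> r) xs"
  using assms
proof (induction "card A" arbitrary: A)
  case 0
  then show ?case by simp
next
  case (Suc n)
  have *: "trans r" "irrefl r" "total_on A r"
    using Suc.prems by (auto simp: strict_linear_order_on_def)
  have "wf (r \<inter> A \<times> A)"
  proof (rule finite_acyclic_wf)
    show "finite (r \<inter> A \<times> A)" using Suc.prems(1) by blast
    show "acyclic (r \<inter> A \<times> A)"
      using *(1,2) acyclic_irrefl acyclic_subset[of r "r \<inter> A \<times> A"] trancl_id
      by (metis Int_lower1)
  qed
  moreover obtain a where "a \<in> A" using Suc.hyps(2) by fastforce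
  ultimately obtain m where m: "m \<in> A" "\<And>y. y \<in> A \<Longrightarrow> (y, m) \<notin> r"
    by (rule wfE_min[of _ a A]) blast
  have "strict_linear_order_on (A - {m}) r"
    using * by (auto simp: strict_linear_order_on_def total_on_def)
  then obtain xs where xs: "distinct xs" "set xs = A - {m}"
      "sorted_wrt (\<lambda>x y. (x, y) \<in> r) xs"
    using Suc.hyps(1)[of "A - {m}"] Suc.hyps(2)[symmetric] Suc.prems(1) m(1)
    by (auto simp: card_Diff_singleton)
  have "(m, y) \<in> r" if "y \<in> A - {m}" for y
    using that m *(3) by (auto simp: total_on_def)
  with xs m(1) have "distinct (m # xs) \<and> set (m # xs) = A \<and>
      sorted_wrt (\<lambda>x y. (x, y) \<in> r) (m # xs)" by auto
  then show ?case by blast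
qed

text \<open>Every graph with strict preferences on an initial segment of the naturals has a
  presentation by preference lists.\<close>

lemma ex_pref_lists:
  fixes G :: "nat pref_graph"
  assumes wf: "wf_pref_graph G" and n: "nodes G = {..<n}"
  shows "\<exists>ps \<in> pref_lists. graph_of ps = G"
proof -
  have edge: "u < n \<and> v < n \<and> u \<noteq> v" if "{u, v} \<in> edges G" for u v
    using that wf n by (fastforce simp: wf_pref_graph_def doubleton_eq_iff)
  have fin: "finite (neighbours G u)" for u
    by (rule finite_subset[of _ "{..<n}"]) (auto simp: neighbours_def dest: edge)
  have slo: "strict_linear_order_on (neighbours G u) (pref G u)" for u
    using wf by (simp add: wf_pref_graph_def)
  have "\<exists>xs. distinct xs \<and> set xs = neighbours G u \<and>
      sorted_wrt (\<lambda>x y. (x, y) \<in> pref G u) xs" for u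
    by (rule strict_linear_order_on_list[OF fin slo])
  then obtain l where l: "\<And>u. distinct (l u)" "\<And>u. set (l u) = neighbours G u"
      "\<And>u. sorted_wrt (\<lambda>x y. (x, y) \<in> pref G u) (l u)"
    by metis
  define ps where "ps = map l [0..<n]"
  have ps: "length ps = n" "\<And>u. u < n \<Longrightarrow> ps ! u = l u" by (simp_all add: ps_def)
  have l_iff: "v \<in> set (l u) \<longleftrightarrow> {u, v} \<in> edges G" for u v
    using l(2) by (simp add: neighbours_def)
  have "v < n \<and> v \<noteq> u \<and> u \<in> set (l v)" if "v \<in> set (l u)" for u v
    using that edge[of u v] unfolding l_iff by (simp add: insert_commute)
  then have lists: "ps \<in> pref_lists"
    using l(1) unfolding pref_lists_def by (simp add: ps)
  have nb: "neighbours (graph_of ps) u = neighbours G u" for u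
    unfolding neighbours_graph_of[OF lists] using ps l(2)[of u] edge[of u]
    by (auto simp: neighbours_def)
  have wf': "wf_pref_graph (graph_of ps)" by (rule wf_graph_of[OF lists])
  have pair: "\<exists>u v. e = {u, v}" if "wf_pref_graph H" "e \<in> edges H"
    for e and H :: "nat pref_graph"
    using that unfolding wf_pref_graph_def by metis
  have nb_edges: "{u, v} \<in> edges (graph_of ps) \<longleftrightarrow> {u, v} \<in> edges G" for u v
    using nb[of u] by (auto simp: neighbours_def)
  have "edges (graph_of ps) = edges G"
    using pair[OF wf] pair[OF wf'] nb_edges by (metis subsetI subset_antisym)
  moreover have "pref (graph_of ps) u = pref G u" for u
  proof -
    have sub: "pref (graph_of ps) u \<subseteq> pref G u"
      using l(3)[of u] by (auto simp: graph_of_def ps sorted_wrt_iff_nth_less)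
    have a: "total_on (neighbours G u) (pref (graph_of ps) u)"
      using wf' nb by (auto simp: wf_pref_graph_def strict_linear_order_on_def)
    have b: "pref G u \<subseteq> neighbours G u \<times> neighbours G u" "irrefl (pref G u)" "trans (pref G u)"
      using wf by (auto simp: wf_pref_graph_def strict_linear_order_on_def)
    have "(x, y) \<in> pref (graph_of ps) u" if xy: "(x, y) \<in> pref G u" for x y
    proof (rule ccontr)
      assume "(x, y) \<notin> pref (graph_of ps) u"
      moreover have "x \<in> neighbours G u" "y \<in> neighbours G u" "x \<noteq> y"
        using b(1,2) xy by (auto simp: irrefl_def)
      ultimately have "(y, x) \<in> pref G u"
        using a sub unfolding total_on_def by blast
      then show False using transD[OF b(3)] b(2) xy unfolding irrefl_def by blast
    qed
    then show ?thesis using sub by auto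
  qed
  moreover have "nodes (graph_of ps) = nodes G" by (simp add: graph_of_def ps n)
  ultimately have "graph_of ps = G"
    by (intro pref_graph.equality) auto
  with lists show ?thesis by blast
qed

end

theory Submission
  imports Defs
begin

text \<open>
  An accepting run of the verifier of an NP problem on \<open>x\<close> and some witness is a space-time diagram,
  that is, a labelling of the positions of a grid whose correctness can be checked on single
  positions and on pairs of adjacent positions. A graph with preferences is built from the
  forbidden labels and pairs of labels such that a dominant matching corresponds to a correct labelling.

  In a dominant matching of this graph exactly the node \<open>RT\<close> is unmatched, \<open>YY\<close> is matched to
  \<open>PP\<close>, and every gate has two possible states. If the X-gates of a position choose no symbol,
  an alternating path from \<open>UU\<close> over \<open>PP\<close> through all of them ends in \<open>RT\<close>, and switching along it
  wins the vote. If two conflicting symbols are chosen, such a path passes through the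
  Z-gate of the one and the Y-gate of the other, which have to be in the same state as their X-gates.
  Conversely, a correct labelling leaves no such path, and weights on the nodes that sum up to 0
  certify dominance. Matching all gates along a-b and k-e and \<open>YY\<close> to \<open>Y'\<close> always gives a stable matching.

  The list representation of the graph is regular enough to be printed by a program with finitely many
  counters, which are bounded by a polynomial in the length of \<open>x\<close>; a Turing machine represents
  the counters by the positions of its heads.
\<close>

section \<open>Matchings as involutions\<close>

text \<open>Inside a gate the preferences are cyclic: of its two partners there, \<open>a\<close>
  prefers \<open>b\<close>, \<open>b\<close> prefers \<open>k\<close>, \<open>k\<close> prefers
  \<open>e\<close> and \<open>e\<close> prefers \<open>a\<close>. So the two states tie, and the
  ranks of the outside neighbours in the lists of \<open>a\<close> and \<open>b\<close> decide which
  state a path can cross. Rematching \<open>YY\<close> to \<open>Y'\<close> gains two votes and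
  abandons only \<open>UU\<close>; this wins as soon as all further pairs on a path from
  \<open>PP\<close> to \<open>RT\<close> have vote sum 0. \<open>XX\<close> and \<open>X'\<close>
  form a second route from \<open>UU\<close> to \<open>PP\<close>, which excludes matching
  \<open>PP\<close> to \<open>CC\<close> while \<open>UU\<close> is alone. Dominance, as opposed to
  popularity, is needed only against matchings with \<open>UU\<close> and \<open>PP\<close> both
  unmatched, such as the stable one: augmenting along
  \<open>UU\<close>-\<open>Y'\<close>-\<open>YY\<close>-\<open>PP\<close> is a tie. In the other
  direction the number of nodes is odd, so a matching that misses only \<open>RT\<close> has maximum
  size and popularity suffices. On the machine side, a terminating deterministic run with
  polynomially bounded counters is automatically polynomially long, so programs need bounds on
  register values but no time analysis.\<close>

lemma matching_eqD:
  "matching G M \<Longrightarrow> e \<in> M \<Longrightarrow> e' \<in> M \<Longrightarrow> a \<in> e \<Longrightarrow> a \<in> e' \<Longrightarrow> e = e'"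
  unfolding matching_def by (metis IntI emptyE)

primrec idx :: "'a list \<Rightarrow> 'a \<Rightarrow> nat" where
  "idx [] a = 0"
| "idx (x # xs) a = (if x = a then 0 else Suc (idx xs a))"

lemma idx_append: "idx (xs @ ys) a = (if a \<in> set xs then idx xs a else length xs + idx ys a)"
  by (induction xs) auto

lemma idx_less_length: "idx xs a < length xs \<longleftrightarrow> a \<in> set xs"
  by (induction xs) auto

lemma idx_notin: "a \<notin> set xs \<Longrightarrow> idx xs a = length xs"
  by (induction xs) auto

lemma idx_le_length: "idx xs a \<le> length xs"
  by (induction xs) auto

lemma nth_idx: "a \<in> set xs \<Longrightarrow> xs ! idx xs a = a"
  by (induction xs) auto

lemma idx_nth: "distinct xs \<Longrightarrow> i < length xs \<Longrightarrow> idx xs (xs ! i) = i"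
  by (metis idx_less_length nth_eq_iff_index_eq nth_idx nth_mem)

definition vote :: "'a list \<Rightarrow> 'a \<Rightarrow> 'a \<Rightarrow> int" where
  "vote xs a b = (if idx xs a < idx xs b then 1 else if idx xs b < idx xs a then -1 else 0)"

lemma vote_same [simp]: "vote xs a a = 0"
  by (simp add: vote_def)

lemma vote_swap: "vote xs b a = - vote xs a b"
  by (simp add: vote_def)

lemma vote_bounds: "- 1 \<le> vote xs a b" "vote xs a b \<le> 1"
  by (simp_all add: vote_def)

primrec partner_in :: "('v \<times> 'v) list \<Rightarrow> 'v \<Rightarrow> 'v" where
  "partner_in [] v = v"
| "partner_in (e # es) v = (if v = fst e then snd e else if v = snd e then fst e else partner_in es v)"

definition ends :: "('v \<times> 'v) list \<Rightarrow> 'v list" where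
  "ends es = concat (map (\<lambda>(a, b). [a, b]) es)"

lemma ends_simps [simp]:
  "ends [] = []" "ends ((a, b) # es) = a # b # ends es" "ends (es @ es') = ends es @ ends es'"
  by (simp_all add: ends_def)

lemma in_ends: "(a, b) \<in> set es \<Longrightarrow> a \<in> set (ends es) \<and> b \<in> set (ends es)"
  by (force simp: ends_def)

lemma partner_in:
  "distinct (ends es) \<Longrightarrow> (a, b) \<in> set es \<Longrightarrow> partner_in es a = b \<and> partner_in es b = a"
  by (induction es) (auto dest: in_ends)

lemma ends_cases:
  assumes "v \<in> set (ends es)"
  obtains w where "(v, w) \<in> set es \<or> (w, v) \<in> set es"
  using assms by (auto simp: ends_def)

lemma sum_ends:
  "sum_list (map g (ends es)) = (\<Sum>(a, b) \<leftarrow> es. g a + g b)" for g :: "'v \<Rightarrow> int"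
  by (induction es) auto

text \<open>Every node \<open>v\<close> ranks the members of \<open>L v\<close> in order, followed by being unmatched. A matching
  is represented by the involution that sends each node to its partner and fixes the unmatched
  nodes; \<^const>\<open>idx\<close> then ranks \<open>v\<close> itself last.\<close>

locale preferences =
  fixes V :: "'v set" and L :: "'v \<Rightarrow> 'v list"
  assumes finite_nodes: "finite V"
    and distinct_list: "v \<in> V \<Longrightarrow> distinct (L v)"
    and list_sym: "v \<in> V \<Longrightarrow> w \<in> set (L v) \<Longrightarrow> w \<in> V \<and> w \<noteq> v \<and> v \<in> set (L w)"
begin

definition imatching :: "('v \<Rightarrow> 'v) \<Rightarrow> bool" where
  "imatching m \<longleftrightarrow> (\<forall>v \<in> V. m v \<in> insert v (set (L v)) \<and> m (m v) = v)"

definition covered :: "('v \<Rightarrow> 'v) \<Rightarrow> 'v set" where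
  "covered m = {v \<in> V. m v \<noteq> v}"

definition ivote :: "('v \<Rightarrow> 'v) \<Rightarrow> ('v \<Rightarrow> 'v) \<Rightarrow> int" where
  "ivote m m' = (\<Sum>v \<in> V. vote (L v) (m v) (m' v))"

definition ipopular :: "('v \<Rightarrow> 'v) \<Rightarrow> bool" where
  "ipopular m \<longleftrightarrow> imatching m \<and> (\<forall>m'. imatching m' \<longrightarrow> ivote m m' \<ge> 0)"

definition idominant :: "('v \<Rightarrow> 'v) \<Rightarrow> bool" where
  "idominant m \<longleftrightarrow> ipopular m \<and>
     (\<forall>m'. imatching m' \<and> card (covered m') > card (covered m) \<longrightarrow> ivote m m' > 0)"

text \<open>On an edge of \<open>m\<close> both votes are 0, and on any other edge each of them is 1
  or -1, so a sum of at most 0 says exactly that the two ends do not both gain.\<close>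

definition istable :: "('v \<Rightarrow> 'v) \<Rightarrow> bool" where
  "istable m \<longleftrightarrow> imatching m \<and>
     (\<forall>v \<in> V. \<forall>w \<in> set (L v). vote (L v) w (m v) + vote (L w) v (m w) \<le> 0)"

lemma imatching_in: "imatching m \<Longrightarrow> v \<in> V \<Longrightarrow> m v \<in> V"
  unfolding imatching_def using list_sym by (metis insert_iff)

lemma imatching_inv: "imatching m \<Longrightarrow> v \<in> V \<Longrightarrow> m (m v) = v"
  unfolding imatching_def by blast

lemma imatching_list: "imatching m \<Longrightarrow> v \<in> V \<Longrightarrow> m v \<noteq> v \<Longrightarrow> m v \<in> set (L v)"
  unfolding imatching_def by blast

lemma imatching_bij: "imatching m \<Longrightarrow> bij_betw m V V"
  by (rule bij_betw_byWitness[where f' = m]) (auto simp: imatching_in imatching_inv)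

lemma sum_imatching: "imatching m \<Longrightarrow> (\<Sum>v \<in> V. f (m v)) = (\<Sum>v \<in> V. f v)"
  using sum.reindex_bij_betw[OF imatching_bij] by blast

lemma ivote_swap: "ivote m' m = - ivote m m'"
  unfolding ivote_def by (subst vote_swap) (simp add: sum_negf)

text \<open>A node weighting that bounds the votes along every edge certifies popularity, because summing
  it over the edges of any other matching counts every node once.\<close>

lemma ivote_le_weight:
  fixes \<alpha> :: "'v \<Rightarrow> int"
  assumes m: "imatching m"
    and edge: "\<And>v w. v \<in> V \<Longrightarrow> w \<in> set (L v) \<Longrightarrow> vote (L v) w (m v) + vote (L w) v (m w) \<le> \<alpha> v + \<alpha> w"
    and self: "\<And>v. v \<in> V \<Longrightarrow> vote (L v) v (m v) \<le> \<alpha> v"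
    and m': "imatching m'"
  shows "ivote m' m \<le> (\<Sum>v \<in> V. \<alpha> v)"
proof -
  let ?f = "\<lambda>v. vote (L v) (m' v) (m v)"
  \<comment> \<open>Re-indexing by the bijection \<open>m'\<close> counts every edge of
    \<open>m'\<close> from both of its ends.\<close>
  have "2 * ivote m' m = (\<Sum>v \<in> V. ?f v) + (\<Sum>v \<in> V. ?f (m' v))"
    unfolding ivote_def using sum_imatching[OF m', of ?f] by simp
  also have "\<dots> = (\<Sum>v \<in> V. ?f v + ?f (m' v))" by (simp add: sum.distrib)
  also have "\<dots> \<le> (\<Sum>v \<in> V. \<alpha> v + \<alpha> (m' v))"
  proof (rule sum_mono)
    fix v assume v: "v \<in> V"
    show "?f v + ?f (m' v) \<le> \<alpha> v + \<alpha> (m' v)"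
      using edge[OF v, of "m' v"] self[OF v] imatching_list[OF m' v] imatching_inv[OF m' v]
      by (cases "m' v = v") auto
  qed
  also have "\<dots> = 2 * (\<Sum>v \<in> V. \<alpha> v)"
    using sum_imatching[OF m', of \<alpha>] by (simp add: sum.distrib)
  finally show ?thesis by simp
qed

text \<open>By \<open>bal\<close> the weights cancel along the edges of \<open>m\<close> and vanish
  on its unmatched nodes, so the total that bounds every opposing vote is 0.\<close>

lemma ipopular_weight:
  fixes \<alpha> :: "'v \<Rightarrow> int"
  assumes m: "imatching m"
    and edge: "\<And>v w. v \<in> V \<Longrightarrow> w \<in> set (L v) \<Longrightarrow> vote (L v) w (m v) + vote (L w) v (m w) \<le> \<alpha> v + \<alpha> w"
    and self: "\<And>v. v \<in> V \<Longrightarrow> vote (L v) v (m v) \<le> \<alpha> v"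
    and bal: "\<And>v. v \<in> V \<Longrightarrow> \<alpha> v + \<alpha> (m v) = 0"
  shows "ipopular m"
proof -
  have "2 * (\<Sum>v \<in> V. \<alpha> v) = (\<Sum>v \<in> V. \<alpha> v + \<alpha> (m v))"
    using sum_imatching[OF m, of \<alpha>] by (simp add: sum.distrib)
  also have "\<dots> = 0" using bal by simp
  finally have "(\<Sum>v \<in> V. \<alpha> v) = 0" by simp
  then have "ivote m m' \<ge> 0" if "imatching m'" for m'
    using ivote_le_weight[OF m edge self that] ivote_swap[of m' m] by simp
  then show ?thesis using m by (simp add: ipopular_def)
qed

text \<open>A stable matching never loses, so against a popular one the vote is a tie, edge by edge.\<close>

lemma covered_stable_subset:
  assumes s: "istable s" and m: "ipopular m"
  shows "covered s \<subseteq> covered m"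
proof -
  have s': "imatching s" and m': "imatching m"
    using s m unfolding istable_def ipopular_def by auto
  let ?f = "\<lambda>v. vote (L v) (m v) (s v)"
  \<comment> \<open>A node that \<open>s\<close> covers and \<open>m\<close> does not makes its term
    negative; as no term is positive, a single such node would make \<open>m\<close> lose.\<close>
  have le: "?f v + ?f (m v) \<le> (if m v = v \<and> s v \<noteq> v then -1 else 0)" if v: "v \<in> V" for v
  proof (cases "m v = v")
    case False
    then have "m v \<in> set (L v)" using imatching_list[OF m' v] by simp
    then show ?thesis using s v False imatching_inv[OF m' v] unfolding istable_def by fastforce
  next
    case True
    have "v \<notin> set (L v)" using list_sym v by blast
    then have "idx (L v) v = length (L v)" by (simp add: idx_notin)
    moreover have "s v \<noteq> v \<Longrightarrow> idx (L v) (s v) < length (L v)"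
      using imatching_list[OF s' v] idx_less_length by metis
    ultimately show ?thesis using True by (cases "s v = v") (simp_all add: vote_def)
  qed
  have "0 \<le> 2 * ivote m s"
    using m s' unfolding ipopular_def by simp
  also have "\<dots> = (\<Sum>v \<in> V. ?f v) + (\<Sum>v \<in> V. ?f (m v))"
    unfolding ivote_def using sum_imatching[OF m', of ?f] by simp
  also have "\<dots> = (\<Sum>v \<in> V. ?f v + ?f (m v))" by (simp add: sum.distrib)
  finally have nonneg: "0 \<le> (\<Sum>v \<in> V. ?f v + ?f (m v))" .
  have "m v \<noteq> v" if v: "v \<in> V" and "s v \<noteq> v" for v
  proof
    assume "m v = v"
    then have "(\<Sum>v \<in> V. ?f v + ?f (m v)) < (\<Sum>v \<in> V. 0)"
      using le[OF v] v \<open>s v \<noteq> v\<close> finite_nodes order_trans[OF le]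
      by (intro sum_strict_mono_ex1) (auto simp del: add_le_same_cancel1 intro!: bexI[of _ v])
    then show False using nonneg by simp
  qed
  then show ?thesis by (auto simp: covered_def)
qed

lemma even_card_covered:
  assumes m: "imatching m"
  shows "even (card (covered m))"
proof -
  have "finite V" by (rule finite_nodes)
  then obtain f :: "'v \<Rightarrow> nat" where f: "inj_on f V"
    using finite_imp_inj_to_nat_seg by metis
  \<comment> \<open>An injection into the naturals orients every edge, and \<open>m\<close>
    exchanges lower and upper ends.\<close>
  let ?A = "{v \<in> V. f v < f (m v)}" and ?B = "{v \<in> V. f v > f (m v)}"
  have "bij_betw m ?A ?B"
    by (rule bij_betw_byWitness[where f' = m])
      (auto simp: imatching_in[OF m] imatching_inv[OF m])
  then have "card ?A = card ?B" by (rule bij_betw_same_card)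
  moreover have "f v \<noteq> f (m v)" if "v \<in> V" "m v \<noteq> v" for v
    using f imatching_in[OF m] that by (metis inj_on_def)
  then have "covered m = ?A \<union> ?B"
    by (fastforce simp: covered_def)
  moreover have "card (?A \<union> ?B) = card ?A + card ?B"
    using finite_nodes by (intro card_Un_disjoint) auto
  ultimately show ?thesis by simp
qed

text \<open>Rematching the nodes of \<open>S\<close> among themselves by \<open>f\<close> leaves only their old partners outside
  of \<open>S\<close> behind.\<close>

lemma rematch:
  assumes m: "imatching m" and S: "S \<subseteq> V"
    and f: "\<And>v. v \<in> S \<Longrightarrow> f v \<in> S \<and> f v \<in> set (L v) \<and> f (f v) = v"
  defines "m' \<equiv> \<lambda>v. if v \<in> S then f v else if m v \<in> S then v else m v"
  shows "imatching m'"
    and "ivote m' m \<ge> (\<Sum>v \<in> S. vote (L v) (f v) (m v)) - int (card (m ` S - S))"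
    and "m ` S \<subseteq> S \<Longrightarrow> covered m' = covered m \<union> S"
proof -
  show "imatching m'"
    unfolding imatching_def
  proof (intro ballI conjI)
    fix v assume v: "v \<in> V"
    show "m' v \<in> insert v (set (L v))"
      using m v f unfolding m'_def imatching_def by auto
    show "m' (m' v) = v"
      using m v f S unfolding m'_def imatching_def by auto
  qed
  have fin: "finite S" using S finite_nodes finite_subset by blast
  have D: "m ` S - S \<subseteq> V - S" using S imatching_in[OF m] by blast
  have "(\<Sum>v \<in> V. vote (L v) (m' v) (m v)) =
      (\<Sum>v \<in> S. vote (L v) (m' v) (m v)) + (\<Sum>v \<in> V - S. vote (L v) (m' v) (m v))"
    using sum.subset_diff[OF S finite_nodes, of "\<lambda>v. vote (L v) (m' v) (m v)"] by simp
  moreover have "(\<Sum>v \<in> S. vote (L v) (m' v) (m v)) = (\<Sum>v \<in> S. vote (L v) (f v) (m v))"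
    by (rule sum.cong) (auto simp: m'_def)
  moreover have "(\<Sum>v \<in> V - S. vote (L v) (m' v) (m v)) \<ge> - int (card (m ` S - S))"
  proof -
    have "(\<Sum>v \<in> V - S. vote (L v) (m' v) (m v)) \<ge> (\<Sum>v \<in> V - S. if v \<in> m ` S - S then -1 else 0)"
    proof (rule sum_mono)
      fix v assume v: "v \<in> V - S"
      show "(if v \<in> m ` S - S then -1 else 0) \<le> vote (L v) (m' v) (m v)"
      proof (cases "m v \<in> S")
        case True
        then have "v \<in> m ` S - S" using v imatching_inv[OF m, of v] by force
        then show ?thesis using vote_bounds by simp
      next
        case False
        then have "v \<notin> m ` S - S" using S imatching_inv[OF m] by auto
        then show ?thesis using False v by (simp add: m'_def)
      qed
    qed
    also have "(\<Sum>v \<in> V - S. if v \<in> m ` S - S then -1 else (0::int)) = (\<Sum>v \<in> m ` S - S. -1)"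
      using D finite_nodes by (subst sum.inter_restrict[symmetric]) (auto simp: Int_absorb1)
    finally show ?thesis by simp
  qed
  ultimately show "ivote m' m \<ge> (\<Sum>v \<in> S. vote (L v) (f v) (m v)) - int (card (m ` S - S))"
    unfolding ivote_def by linarith
  show "covered m' = covered m \<union> S" if "m ` S \<subseteq> S"
  proof -
    have "m v \<notin> S" if "v \<in> V - S" for v
      using that \<open>m ` S \<subseteq> S\<close> imatching_inv[OF m, of v] by fastforce
    moreover have "f v \<noteq> v" if "v \<in> S" for v
      using f[OF that] list_sym[of v "f v"] S that by auto
    ultimately show ?thesis using S unfolding covered_def m'_def by auto
  qed
qed

lemma popular_rematch:
  assumes "ipopular m" "S \<subseteq> V"
    and "\<And>v. v \<in> S \<Longrightarrow> f v \<in> S \<and> f v \<in> set (L v) \<and> f (f v) = v"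
  shows "(\<Sum>v \<in> S. vote (L v) (f v) (m v)) \<le> int (card (m ` S - S))"
proof -
  let ?m' = "\<lambda>v. if v \<in> S then f v else if m v \<in> S then v else m v"
  have m: "imatching m" using assms(1) by (simp add: ipopular_def)
  then have "ivote m ?m' \<ge> 0"
    using assms(1) rematch(1)[OF m assms(2,3)] unfolding ipopular_def by blast
  then show ?thesis
    using rematch(2)[OF m assms(2,3)] ivote_swap[of ?m' m] by linarith
qed

lemma dominant_rematch:
  assumes "idominant m" "S \<subseteq> V"
    and "\<And>v. v \<in> S \<Longrightarrow> f v \<in> S \<and> f v \<in> set (L v) \<and> f (f v) = v"
    and "m ` S \<subseteq> S" "u \<in> S" "m u = u"
  shows "(\<Sum>v \<in> S. vote (L v) (f v) (m v)) < 0"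
proof -
  have m: "imatching m" using assms(1) by (simp add: idominant_def ipopular_def)
  let ?m' = "\<lambda>v. if v \<in> S then f v else if m v \<in> S then v else m v"
  have "finite (covered ?m')" using finite_nodes by (auto simp: covered_def)
  moreover have "covered m \<subset> covered ?m'"
    using rematch(3)[OF m assms(2,3,4)] assms(5,6) by (auto simp: covered_def)
  ultimately have "card (covered m) < card (covered ?m')" by (intro psubset_card_mono) auto
  then have "ivote m ?m' > 0"
    using assms(1) rematch(1)[OF m assms(2,3)] unfolding idominant_def by blast
  moreover have "card (m ` S - S) = 0" using assms(4) by (simp add: Diff_eq_empty_iff[THEN iffD2])
  moreover have "(\<Sum>v \<in> S. vote (L v) (f v) (m v)) - int (card (m ` S - S)) \<le> ivote ?m' m"
    using rematch(2)[OF m assms(2,3)] .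
  ultimately show ?thesis using ivote_swap[of ?m' m] by simp
qed

text \<open>The form in which all deviations are tested: \<open>es\<close> lists the new edges. If
  \<open>x\<close> is the only old partner left outside, it costs at most one vote, so a popular
  matching allows a gain of at most 1. If none is left outside and an unmatched node gets covered,
  the new matching is larger, so a dominant one has to win strictly.\<close>

lemma rematch_pairs:
  assumes m: "imatching m" and d: "distinct (ends es)"
    and es: "list_all (\<lambda>(a, b). a \<in> V \<and> b \<in> set (L a)) es"
  defines "gain \<equiv> \<Sum>(a, b) \<leftarrow> es. vote (L a) b (m a) + vote (L b) a (m b)"
  shows "ipopular m \<Longrightarrow> m ` set (ends es) \<subseteq> insert x (set (ends es)) \<Longrightarrow> gain \<le> 1"
    and "idominant m \<Longrightarrow> m ` set (ends es) \<subseteq> set (ends es) \<Longrightarrow> u \<in> set (ends es) \<Longrightarrow> m u = u \<Longrightarrow> gain < 0"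
proof -
  let ?S = "set (ends es)" and ?f = "partner_in es"
  have e: "a \<in> V \<and> b \<in> set (L a)" if "(a, b) \<in> set es" for a b
    using es that by (auto simp: list_all_iff)
  have S: "?S \<subseteq> V" using e list_sym by (fastforce elim!: ends_cases)
  have f: "?f v \<in> ?S \<and> ?f v \<in> set (L v) \<and> ?f (?f v) = v" if v: "v \<in> ?S" for v
  proof -
    from v obtain w where "(v, w) \<in> set es \<or> (w, v) \<in> set es" by (rule ends_cases)
    then show ?thesis
      using partner_in[OF d, of v w] partner_in[OF d, of w v] e[of v w] e[of w v] list_sym[of w v]
        in_ends[of v w es] in_ends[of w v es] by auto
  qed
  have gain: "(\<Sum>v \<in> ?S. vote (L v) (?f v) (m v)) = gain"
  proof -
    have "(\<Sum>v \<in> ?S. vote (L v) (?f v) (m v)) = sum_list (map (\<lambda>v. vote (L v) (?f v) (m v)) (ends es))"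
      using d by (simp add: sum_list_distinct_conv_sum_set)
    also have "\<dots> = gain"
      unfolding sum_ends gain_def using partner_in[OF d]
      by (intro arg_cong[where f = sum_list] map_cong) auto
    finally show ?thesis .
  qed
  show "gain \<le> 1" if "ipopular m" "m ` ?S \<subseteq> insert x ?S"
  proof -
    have "card (m ` ?S - ?S) \<le> card {x}" using that(2) by (intro card_mono) auto
    then show ?thesis using popular_rematch[OF that(1) S f] gain by simp
  qed
  show "gain < 0" if "idominant m" "m ` ?S \<subseteq> ?S" "u \<in> ?S" "m u = u"
    using dominant_rematch[OF that(1) S f that(2-4)] gain by simp
qed

end

section \<open>Preference lists of numbered nodes\<close>

locale numbered_preferences = preferences V L for V :: "'v set" and L +
  fixes ps :: "nat list list" and num :: "'v \<Rightarrow> nat"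
  assumes num: "bij_betw num V {..<length ps}"
    and nth_num: "v \<in> V \<Longrightarrow> ps ! num v = map num (L v)"
begin

abbreviation "G \<equiv> graph_of ps"

lemma inj_num: "inj_on num V"
  using num by (rule bij_betw_imp_inj_on)

lemma num_less: "v \<in> V \<Longrightarrow> num v < length ps"
  using num by (auto simp: bij_betw_def)

lemma num_cases: "u < length ps \<Longrightarrow> (\<And>v. v \<in> V \<Longrightarrow> u = num v \<Longrightarrow> P) \<Longrightarrow> P"
  using num by (auto simp: bij_betw_def)

lemma list_nodes: "v \<in> V \<Longrightarrow> set (L v) \<subseteq> V"
  using list_sym by blast

lemma num_eq: "v \<in> V \<Longrightarrow> w \<in> V \<Longrightarrow> num v = num w \<longleftrightarrow> v = w"
  using inj_num by (auto simp: inj_on_def)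

lemma ps_in: "ps \<in> pref_lists"
  unfolding pref_lists_def
proof (intro CollectI allI impI conjI ballI)
  fix u assume "u < length ps"
  then obtain v where v: "v \<in> V" "u = num v" by (rule num_cases)
  have sub: "insert v (set (L v)) \<subseteq> V" using v list_nodes by simp
  show "distinct (ps ! u)"
    using v distinct_list[of v] list_nodes[of v] inj_num
    by (simp add: nth_num distinct_map inj_on_subset)
  fix x assume "x \<in> set (ps ! u)"
  then obtain w where w: "w \<in> set (L v)" "x = num w" using v by (auto simp: nth_num)
  have *: "w \<in> V" "w \<noteq> v" "v \<in> set (L w)" using list_sym v w by blast+
  show "x < length ps" "x \<noteq> u" "u \<in> set (ps ! x)"
    using * v w by (auto simp: num_less num_eq nth_num)
qed

lemma edge_iff: "v \<in> V \<Longrightarrow> w \<in> V \<Longrightarrow> {num v, num w} \<in> edges G \<longleftrightarrow> w \<in> set (L v)"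
proof -
  assume v: "v \<in> V" and w: "w \<in> V"
  have "{num v, num w} \<in> edges G \<longleftrightarrow> num w \<in> num ` set (L v)"
    using neighbours_graph_of[OF ps_in, of "num v"] v
    by (auto simp: neighbours_def num_less nth_num)
  then show ?thesis using inj_num list_nodes[OF v] w by (simp add: inj_on_image_mem_iff)
qed

lemma edge_cases:
  assumes "e \<in> edges G"
  obtains v w where "v \<in> V" "w \<in> set (L v)" "e = {num v, num w}"
proof -
  from assms obtain u x where "u < length ps" "x \<in> set (ps ! u)" "e = {u, x}"
    by (auto simp: graph_of_def)
  then show ?thesis using that by (auto simp: nth_num elim!: num_cases)
qed

lemma pref_iff:
  assumes "v \<in> V" "a \<in> set (L v)" "b \<in> set (L v)"
  shows "(num a, num b) \<in> pref G (num v) \<longleftrightarrow> idx (L v) a < idx (L v) b"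
proof
  have d: "distinct (L v)" using assms distinct_list by simp
  have sub: "set (L v) \<subseteq> V" using assms list_nodes by simp
  show "idx (L v) a < idx (L v) b" if "(num a, num b) \<in> pref G (num v)"
  proof -
    from that obtain i j where ij: "num a = map num (L v) ! i" "num b = map num (L v) ! j" "i < j"
        "j < length (L v)"
      using assms by (auto simp: graph_of_def nth_num)
    then have "num a = num (L v ! i)" "num b = num (L v ! j)" by auto
    then have "a = L v ! i" "b = L v ! j" using ij assms sub num_eq nth_mem
      by (metis (no_types) less_trans subsetD)+
    then show ?thesis using ij d by (simp add: idx_nth)
  qed
  show "(num a, num b) \<in> pref G (num v)" if "idx (L v) a < idx (L v) b"
  proof -
    have "idx (L v) b < length (L v)" using assms by (simp add: idx_less_length)
    then have "num a = ps ! num v ! idx (L v) a \<and> num b = ps ! num v ! idx (L v) b \<and>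
        num v < length ps \<and> idx (L v) a < idx (L v) b \<and> idx (L v) b < length (ps ! num v)"
      using assms that by (simp add: nth_num num_less nth_idx)
    then show ?thesis unfolding graph_of_def by auto
  qed
qed

section \<open>Translation between edge sets of the numbered graph and involutions\<close>

definition mate :: "nat set set \<Rightarrow> 'v \<Rightarrow> 'v" where
  "mate M v = (if \<exists>w \<in> V. {num v, num w} \<in> M then SOME w. w \<in> V \<and> {num v, num w} \<in> M else v)"

definition edges_of :: "('v \<Rightarrow> 'v) \<Rightarrow> nat set set" where
  "edges_of m = {{num v, num (m v)} | v. v \<in> V \<and> m v \<noteq> v}"

lemma mate_eq:
  assumes M: "matching G M" and v: "v \<in> V" "w \<in> V" "{num v, num w} \<in> M"
  shows "mate M v = w" "partner M (num v) = num w" "matched M (num v)"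
proof -
  have u: "x = num w" if "{num v, x} \<in> M" for x
  proof -
    have "{num v, x} = {num v, num w}"
      by (rule matching_eqD[OF M that v(3), of "num v"]) simp_all
    then show ?thesis by (auto simp: doubleton_eq_iff)
  qed
  let ?P = "\<lambda>w. w \<in> V \<and> {num v, num w} \<in> M"
  have P: "?P w" using v by simp
  then have "mate M v = Eps ?P" unfolding mate_def by (intro if_P bexI[of _ w]) simp_all
  then have "mate M v \<in> V \<and> {num v, num (mate M v)} \<in> M" using someI[of ?P, OF P] by (simp only:)
  then show "mate M v = w" using u[of "num (mate M v)"] num_eq[of "mate M v" w] v(2) by simp
  show "partner M (num v) = num w" unfolding partner_def using u v(3) by (rule_tac the_equality)
  show "matched M (num v)" unfolding matched_def by (rule UnionI[OF v(3)]) simp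
qed

lemma matched_cases:
  assumes M: "matching G M" and v: "v \<in> V" "matched M (num v)"
  obtains w where "w \<in> set (L v)" "{num v, num w} \<in> M"
proof -
  from v obtain e where e: "e \<in> M" "num v \<in> e" unfolding matched_def by blast
  with M have "e \<in> edges G" unfolding matching_def by blast
  then obtain a b where ab: "a \<in> V" "b \<in> set (L a)" "e = {num a, num b}" by (rule edge_cases)
  then have *: "b \<in> V" "a \<in> set (L b)" using list_sym by blast+
  from e(2) ab(1,3) *(1) v(1) have "v = a \<or> v = b" by (auto simp: num_eq)
  then show ?thesis
  proof
    assume "v = a" then show ?thesis using that[of b] ab(2) e(1) unfolding ab(3) by blast
  next
    assume b: "v = b"
    then have "e = {num v, num a}" using ab(3) by auto
    then show ?thesis using that[of a] *(2) b e(1) by blast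
  qed
qed

lemma mate_unmatched: "\<not> matched M (num v) \<Longrightarrow> mate M v = v"
  unfolding mate_def matched_def by auto

lemma mate_matched:
  assumes M: "matching G M" and v: "v \<in> V" "matched M (num v)"
  shows "mate M v \<in> set (L v)" "{num v, num (mate M v)} \<in> M" "partner M (num v) = num (mate M v)"
proof -
  obtain w where w: "w \<in> set (L v)" "{num v, num w} \<in> M" using M v by (rule matched_cases)
  then have "w \<in> V" using list_nodes v by blast
  from mate_eq[OF M v(1) this w(2)] w
  show "mate M v \<in> set (L v)" "{num v, num (mate M v)} \<in> M" "partner M (num v) = num (mate M v)"
    by simp_all
qed

lemma mate_in_list:
  assumes "matching G M" "v \<in> V"
  shows "matched M (num v) \<longleftrightarrow> mate M v \<in> set (L v)"
  using mate_matched(1)[OF assms] mate_unmatched[of M v] list_sym[OF assms(2), of v] by metis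

lemma imatching_mate:
  assumes M: "matching G M"
  shows "imatching (mate M)"
  unfolding imatching_def
proof (intro ballI conjI)
  fix v assume v: "v \<in> V"
  show "mate M v \<in> insert v (set (L v))"
    using mate_matched[OF M v] mate_unmatched[of M v] by blast
  show "mate M (mate M v) = v"
  proof (cases "matched M (num v)")
    case True
    moreover have "{num (mate M v), num v} = {num v, num (mate M v)}" by auto
    ultimately have "mate M v \<in> V" "{num (mate M v), num v} \<in> M"
      using mate_matched(1,2)[OF M v] list_nodes[OF v] by auto
    then show ?thesis using mate_eq(1)[OF M _ v] by blast
  qed (simp add: mate_unmatched)
qed

text \<open>An unmatched node is its own mate and is ranked behind its whole list, so both cases of
  \<open>prefers_matching\<close> become one comparison of ranks.\<close>

lemma prefers_mate:
  assumes M: "matching G M" and N: "matching G N" and v: "v \<in> V"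
  shows "prefers_matching G (num v) M N \<longleftrightarrow> idx (L v) (mate M v) < idx (L v) (mate N v)"
proof -
  have v': "v \<notin> set (L v)" using list_sym v by blast
  have i: "idx (L v) (mate M v) < length (L v) \<longleftrightarrow> matched M (num v)" if "matching G M" for M
    using that v by (simp add: idx_less_length mate_in_list)
  show ?thesis
  proof (cases "matched M (num v) \<and> matched N (num v)")
    case True
    then show ?thesis
      using pref_iff[OF v mate_matched(1)[OF M v] mate_matched(1)[OF N v]]
        mate_matched(3)[OF M v] mate_matched(3)[OF N v]
      by (simp add: prefers_matching_def)
  next
    case False
    moreover have "idx (L v) (mate N v) = length (L v)" if "\<not> matched N (num v)" for N
      using that v' mate_unmatched by (simp add: idx_notin)
    moreover have "\<not> length (L v) < idx (L v) a" for a using idx_le_length[of "L v" a] by simp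
    ultimately show ?thesis
      using i[OF M] i[OF N] unfolding prefers_matching_def by metis
  qed
qed

lemma vote_diff_mate:
  assumes M: "matching G M" and N: "matching G N"
  shows "vote_diff G M N = ivote (mate M) (mate N)"
proof -
  have votes: "int (votes G M N) = (\<Sum>v \<in> V. if idx (L v) (mate M v) < idx (L v) (mate N v) then 1 else 0)"
    if M: "matching G M" and N: "matching G N" for M N
  proof -
    have "nodes G = num ` V" using num by (simp add: graph_of_def bij_betw_def)
    then have "{u \<in> nodes G. prefers_matching G u M N} = num ` {v \<in> V. prefers_matching G (num v) M N}"
      by auto
    also have "{v \<in> V. prefers_matching G (num v) M N} =
        {v \<in> V. idx (L v) (mate M v) < idx (L v) (mate N v)}"
      using prefers_mate[OF M N] by auto
    finally have "{u \<in> nodes G. prefers_matching G u M N} =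
        num ` {v \<in> V. idx (L v) (mate M v) < idx (L v) (mate N v)}" .
    then have "votes G M N = card {v \<in> V. idx (L v) (mate M v) < idx (L v) (mate N v)}"
      unfolding votes_def using inj_num by (simp add: card_image inj_on_subset)
    then show ?thesis using finite_nodes by (simp add: sum.If_cases Int_def)
  qed
  show ?thesis
    unfolding vote_diff_def votes[OF M N] votes[OF N M] ivote_def sum_subtractf[symmetric]
    by (rule sum.cong) (auto simp: vote_def)
qed

text \<open>The edges are disjoint pairs, so comparing numbers of covered nodes is the same as
  comparing sizes of matchings.\<close>

lemma card_mate:
  assumes M: "matching G M"
  shows "card (covered (mate M)) = 2 * card M"
proof -
  have two: "card e = 2" "finite e" if "e \<in> M" for e
  proof -
    have "e \<in> edges G" using M that by (auto simp: matching_def)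
    then obtain v w where "v \<in> V" "w \<in> set (L v)" "e = {num v, num w}" by (rule edge_cases)
    moreover from this have "num v \<noteq> num w" using list_sym[of v w] num_eq[of v w] by auto
    ultimately show "card e = 2" "finite e" by simp_all
  qed
  have "\<Union>M = num ` covered (mate M)"
  proof (intro set_eqI iffI)
    fix u assume u: "u \<in> \<Union>M"
    then obtain e where "u \<in> e" "e \<in> edges G" using M by (auto simp: matching_def)
    moreover from this(2) obtain a b where ab: "a \<in> V" "b \<in> set (L a)" "e = {num a, num b}"
      by (rule edge_cases)
    moreover have "b \<in> V" using list_nodes[OF ab(1)] ab(2) by auto
    ultimately obtain v where v: "v \<in> V" "u = num v" by auto
    then have "mate M v \<in> set (L v)"
      using u mate_matched(1)[OF M v(1)] by (simp add: matched_def)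
    then have "mate M v \<noteq> v" using list_sym[OF v(1)] by auto
    then show "u \<in> num ` covered (mate M)" using v by (simp add: covered_def)
  next
    fix u assume "u \<in> num ` covered (mate M)"
    then obtain v where "u = num v" "mate M v \<noteq> v" by (auto simp: covered_def)
    then show "u \<in> \<Union>M" using mate_unmatched[of M v] by (simp only: matched_def) metis
  qed
  then have "card (\<Union>M) = card (covered (mate M))"
    using inj_num by (simp add: card_image inj_on_subset covered_def)
  moreover have "card (\<Union>M) = sum card M"
    using M two by (intro card_Union_disjoint) (auto simp: matching_def pairwise_def disjnt_def)
  moreover have "sum card M = 2 * card M"
    using two by simp
  ultimately show ?thesis by simp
qed

lemma matching_edges_of:
  assumes m: "imatching m"
  shows "matching G (edges_of m)" and "v \<in> V \<Longrightarrow> mate (edges_of m) v = m v"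
proof -
  have mV: "m v \<in> V" if "v \<in> V" for v using imatching_in[OF m that] .
  show M: "matching G (edges_of m)"
    unfolding matching_def
  proof (intro conjI ballI impI subsetI)
    fix e assume "e \<in> edges_of m"
    then show "e \<in> edges G"
      using mV imatching_list[OF m] by (auto simp: edges_of_def edge_iff)
  next
    fix e e' assume "e \<in> edges_of m" "e' \<in> edges_of m" "e \<noteq> e'"
    then obtain v w where *: "e = {num v, num (m v)}" "e' = {num w, num (m w)}" "v \<in> V" "w \<in> V"
      by (auto simp: edges_of_def)
    have inv: "m (m v) = v" "m (m w) = w" using * imatching_inv[OF m] by auto
    have "v \<noteq> w" using \<open>e \<noteq> e'\<close> * by auto
    moreover have "v \<noteq> m w" using \<open>e \<noteq> e'\<close> * inv by auto
    moreover have "m v \<noteq> w" using \<open>e \<noteq> e'\<close> * inv by auto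
    moreover have "m v \<noteq> m w" using \<open>v \<noteq> w\<close> inv by metis
    ultimately have "v \<noteq> w" "v \<noteq> m w" "m v \<noteq> w" "m v \<noteq> m w" by simp_all
    then show "e \<inter> e' = {}" using * mV by (simp add: num_eq)
  qed
  assume v: "v \<in> V"
  show "mate (edges_of m) v = m v"
  proof (cases "m v = v")
    case False
    then have "{num v, num (m v)} \<in> edges_of m" using v by (auto simp: edges_of_def)
    then show ?thesis using mate_eq(1)[OF M v mV[OF v]] by blast
  next
    case True
    have "num v \<notin> e" if "e \<in> edges_of m" for e
    proof
      assume "num v \<in> e"
      with that obtain w where "w \<in> V" "m w \<noteq> w" "v = w \<or> v = m w"
        using v mV by (auto simp: edges_of_def num_eq)
      then show False using True imatching_inv[OF m] by metis
    qed
    then show ?thesis using True mate_unmatched unfolding matched_def by auto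
  qed
qed

lemma ivote_cong:
  assumes "\<And>v. v \<in> V \<Longrightarrow> m v = m' v" "\<And>v. v \<in> V \<Longrightarrow> n v = n' v"
  shows "ivote m n = ivote m' n'"
  unfolding ivote_def using assms by (intro sum.cong) auto

lemma covered_cong: "(\<And>v. v \<in> V \<Longrightarrow> m v = m' v) \<Longrightarrow> covered m = covered m'"
  unfolding covered_def by auto

lemma idominant_mate:
  assumes "dominant G M"
  shows "idominant (mate M)"
proof -
  have M: "matching G M" using assms by (simp add: dominant_def popular_def)
  have N: "ivote (mate M) m' = vote_diff G M (edges_of m') \<and> card (covered m') = 2 * card (edges_of m')"
    if "imatching m'" for m'
    using vote_diff_mate[OF M matching_edges_of(1)[OF that]] card_mate[OF matching_edges_of(1)[OF that]]
      ivote_cong[of "mate M" "mate M" m' "mate (edges_of m')"] covered_cong[of m' "mate (edges_of m')"]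
      matching_edges_of(2)[OF that] by simp
  have P: "vote_diff G M N \<ge> 0" "card N > card M \<Longrightarrow> vote_diff G M N > 0" if "matching G N" for N
    using assms that by (auto simp: dominant_def popular_def)
  show ?thesis
    unfolding idominant_def ipopular_def
  proof (intro conjI allI impI; (elim conjE)?)
    fix m' assume m': "imatching m'"
    show "ivote (mate M) m' \<ge> 0" using N[OF m'] P(1)[OF matching_edges_of(1)[OF m']] by simp
    assume "card (covered m') > card (covered (mate M))"
    then show "ivote (mate M) m' > 0"
      using N[OF m'] P(2)[OF matching_edges_of(1)[OF m']] card_mate[OF M] by linarith
  qed (rule imatching_mate[OF M])
qed

lemma dominant_edges_of:
  assumes "idominant m"
  shows "dominant G (edges_of m)"
proof -
  have m: "imatching m" using assms by (simp add: idominant_def ipopular_def)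
  have M: "matching G (edges_of m)" by (rule matching_edges_of(1)[OF m])
  have c: "card (covered m) = 2 * card (edges_of m)"
    using card_mate[OF M] covered_cong[of m "mate (edges_of m)"] matching_edges_of(2)[OF m] by simp
  have N: "vote_diff G (edges_of m) N = ivote m (mate N)" if "matching G N" for N
    using vote_diff_mate[OF M that] ivote_cong[of "mate (edges_of m)" m "mate N" "mate N"]
      matching_edges_of(2)[OF m] by simp
  have P: "ivote m m' \<ge> 0" "card (covered m') > card (covered m) \<Longrightarrow> ivote m m' > 0"
    if "imatching m'" for m'
    using assms that by (auto simp: idominant_def ipopular_def)
  show ?thesis
    unfolding dominant_def popular_def
  proof (intro conjI allI impI; (elim conjE)?)
    fix N assume M': "matching G N"
    show "vote_diff G (edges_of m) N \<ge> 0" using N[OF M'] P(1)[OF imatching_mate[OF M']] by simp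
    assume "card N > card (edges_of m)"
    then show "vote_diff G (edges_of m) N > 0"
      using N[OF M'] P(2)[OF imatching_mate[OF M']] card_mate[OF M'] c by linarith
  qed (rule M)
qed

lemma stable_edges_of:
  assumes "istable m"
  shows "stable_matching G (edges_of m)"
proof -
  have m: "imatching m" using assms by (simp add: istable_def)
  have M: "matching G (edges_of m)" by (rule matching_edges_of(1)[OF m])
  have pr: "idx (L v) w < idx (L v) (m v)"
    if v: "v \<in> V" and w: "w \<in> set (L v)" and "prefers_to_situation G (edges_of m) (num v) (num w)" for v w
  proof (cases "matched (edges_of m) (num v)")
    case True
    then have "(num w, num (m v)) \<in> pref G (num v)" "m v \<in> set (L v)"
      using that mate_matched[OF M v] matching_edges_of(2)[OF m v] by (auto simp: prefers_to_situation_def)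
    then show ?thesis using pref_iff[OF v w] by simp
  next
    case False
    then have "m v = v" "v \<notin> set (L v)"
      using mate_unmatched matching_edges_of(2)[OF m v] list_sym[OF v] by metis+
    then show ?thesis using w idx_less_length by (metis idx_notin)
  qed
  have False
    if e: "{u, x} \<in> edges G" and "prefers_to_situation G (edges_of m) u x"
      "prefers_to_situation G (edges_of m) x u" for u x
  proof -
    from e obtain v w where vw: "v \<in> V" "w \<in> set (L v)" "{u, x} = {num v, num w}" by (rule edge_cases)
    have "prefers_to_situation G (edges_of m) (num v) (num w) \<and>
        prefers_to_situation G (edges_of m) (num w) (num v)"
      using that vw(3) by (auto simp: doubleton_eq_iff)
    moreover have "w \<in> V" "v \<in> set (L w)" using list_sym vw by blast+
    ultimately have "vote (L v) w (m v) + vote (L w) v (m w) = 2"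
      using pr[OF vw(1,2)] pr[of w v] by (simp add: vote_def)
    then show False using assms vw unfolding istable_def by fastforce
  qed
  then show ?thesis using M unfolding stable_matching_def by blast
qed

end

section \<open>The gadget graph\<close>

lemma vote_unmatched: "w \<in> set xs \<Longrightarrow> v \<notin> set xs \<Longrightarrow> vote xs w v = 1"
  by (simp add: vote_def idx_notin idx_less_length)

lemma vote_Cons: "vote (x # xs) a b =
   (if a = x then if b = x then 0 else 1 else if b = x then -1 else vote xs a b)"
  by (auto simp: vote_def)

lemma vote_snoc: "z \<notin> set xs \<Longrightarrow> w \<in> set xs \<Longrightarrow> vote (xs @ [z]) w z = 1"
  by (simp add: vote_def idx_append idx_less_length)

text \<open>
  The gates of position \<open>i\<close> and symbol \<open>s\<close> are the three 4-cycles a-b-k-e named X, Z and Y. A gate is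
  matched either along a-b and k-e or along a-e and b-k; the first state of the X-gate means that
  position \<open>i\<close> carries \<open>s\<close>. The X-gates of a position are chained from \<open>DD\<close> to \<open>RT\<close>, and a conflict of
  \<open>(i, s)\<close> with \<open>(j, t)\<close> is an edge from \<open>ZB i s\<close> to \<open>YA j t\<close>.
\<close>

datatype node = Glob nat | Gt nat nat nat

abbreviation "RT \<equiv> Glob 0"
abbreviation "UU \<equiv> Glob 1"
abbreviation "Y' \<equiv> Glob 2"
abbreviation "YY \<equiv> Glob 3"
abbreviation "PP \<equiv> Glob 4"
abbreviation "XX \<equiv> Glob 5"
abbreviation "X' \<equiv> Glob 6"
abbreviation "CC \<equiv> Glob 7"
abbreviation "DD \<equiv> Glob 8"
abbreviation "C2 \<equiv> Glob 9"
abbreviation "D2 \<equiv> Glob 10"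
abbreviation "XA i s \<equiv> Gt i s 0"
abbreviation "XB i s \<equiv> Gt i s 1"
abbreviation "XK i s \<equiv> Gt i s 2"
abbreviation "XE i s \<equiv> Gt i s 3"
abbreviation "ZA i s \<equiv> Gt i s 4"
abbreviation "ZB i s \<equiv> Gt i s 5"
abbreviation "ZK i s \<equiv> Gt i s 6"
abbreviation "ZE i s \<equiv> Gt i s 7"
abbreviation "YA i s \<equiv> Gt i s 8"
abbreviation "YB i s \<equiv> Gt i s 9"
abbreviation "YK i s \<equiv> Gt i s 10"
abbreviation "YE i s \<equiv> Gt i s 11"

locale gadget =
  fixes N K :: nat and out inn :: "nat \<Rightarrow> nat \<Rightarrow> (nat \<times> nat) list"
  assumes K_pos: "0 < K"
    and distinct_out: "i < N \<Longrightarrow> s < K \<Longrightarrow> distinct (out i s)"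
    and distinct_inn: "i < N \<Longrightarrow> s < K \<Longrightarrow> distinct (inn i s)"
    and out_inn: "i < N \<Longrightarrow> s < K \<Longrightarrow> (j, t) \<in> set (out i s) \<Longrightarrow> j < N \<and> t < K \<and> (i, s) \<in> set (inn j t)"
    and inn_out: "i < N \<Longrightarrow> s < K \<Longrightarrow> (j, t) \<in> set (inn i s) \<Longrightarrow> j < N \<and> t < K \<and> (i, s) \<in> set (out j t)"
begin

definition glists :: "node list list" where
  "glists =
    [[YY, D2] @ concat (map (\<lambda>i. map (\<lambda>s. XA i s) [0..<K] @ [XB i (K - 1)]) [0..<N]),
     [Y', X'], [YY, UU], [Y', PP, RT], [XX, CC, YY], [X', PP], [XX, UU], [DD, PP],
     CC # concat (map (\<lambda>i. XA i 0 # map (\<lambda>s. ZA i s) [0..<K]) [0..<N]),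
     D2 # concat (map (\<lambda>i. map (\<lambda>s. YB i s) [0..<K]) [0..<N]),
     [C2, RT]]"

text \<open>The rows are a, b, k, e of the X-, the Z- and the Y-gate. \<open>XA\<close> ranks its
  predecessor in the chain between its two gate partners, so being entered from there is a gain only
  in the state a-e. \<open>XB\<close> ranks \<open>ZA\<close> and \<open>YA\<close>,
  \<open>ZB\<close> its conflicts, and \<open>YB\<close> the node \<open>C2\<close> between the gate
  partners, so leaving there is a gain only in the state a-b. This asymmetry makes the chain
  passable when no symbol is chosen and a conflict edge passable when both symbols are.\<close>

definition gates :: "nat \<Rightarrow> nat \<Rightarrow> node list list" where
  "gates i s =
    [[XB i s, if s = 0 then DD else XB i (s - 1), XE i s, RT],
     [XK i s, ZA i s, YA i s, XA i s, if Suc s < K then XA i (Suc s) else RT],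
     [XE i s, XB i s], [XA i s, XK i s],
     [DD, ZB i s, XB i s, ZE i s],
     [ZK i s] @ map (\<lambda>(j, t). YA j t) (out i s) @ [ZA i s],
     [ZE i s, ZB i s], [ZA i s, ZK i s],
     [YB i s, XB i s, YE i s] @ map (\<lambda>(j, t). ZB j t) (inn i s),
     [YK i s, C2, YA i s],
     [YE i s, YB i s], [YA i s, YK i s]]"

fun L :: "node \<Rightarrow> node list" where
  "L (Glob j) = glists ! j"
| "L (Gt i s g) = gates i s ! g"

definition V :: "node set" where
  "V = Glob ` {..<11} \<union> {Gt i s g | i s g. i < N \<and> s < K \<and> g < 12}"

lemma L_glob:
  "L RT = [YY, D2] @ concat (map (\<lambda>i. map (\<lambda>s. XA i s) [0..<K] @ [XB i (K - 1)]) [0..<N])"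
  "L UU = [Y', X']" "L Y' = [YY, UU]" "L YY = [Y', PP, RT]" "L PP = [XX, CC, YY]"
  "L XX = [X', PP]" "L X' = [XX, UU]" "L CC = [DD, PP]"
  "L DD = CC # concat (map (\<lambda>i. XA i 0 # map (\<lambda>s. ZA i s) [0..<K]) [0..<N])"
  "L C2 = D2 # concat (map (\<lambda>i. map (\<lambda>s. YB i s) [0..<K]) [0..<N])"
  "L D2 = [C2, RT]"
  by (simp_all add: glists_def)

lemma L_gate:
  "L (XA i s) = [XB i s, if s = 0 then DD else XB i (s - 1), XE i s, RT]"
  "L (XB i s) = [XK i s, ZA i s, YA i s, XA i s, if Suc s < K then XA i (Suc s) else RT]"
  "L (XK i s) = [XE i s, XB i s]" "L (XE i s) = [XA i s, XK i s]"
  "L (ZA i s) = [DD, ZB i s, XB i s, ZE i s]"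
  "L (ZB i s) = [ZK i s] @ map (\<lambda>(j, t). YA j t) (out i s) @ [ZA i s]"
  "L (ZK i s) = [ZE i s, ZB i s]" "L (ZE i s) = [ZA i s, ZK i s]"
  "L (YA i s) = [YB i s, XB i s, YE i s] @ map (\<lambda>(j, t). ZB j t) (inn i s)"
  "L (YB i s) = [YK i s, C2, YA i s]"
  "L (YK i s) = [YE i s, YB i s]" "L (YE i s) = [YA i s, YK i s]"
  by (simp_all add: gates_def)

declare L.simps [simp del]

text \<open>The lists that simplification can unfold completely. The two extra copies cater for
  \<open>1\<close> being rewritten to \<open>Suc 0\<close> in the names \<open>UU\<close> and
  \<open>XB\<close>.\<close>

lemmas L_small = L_glob(2-8,11) L_gate(1-5,7,8,10-12) L_glob(2)[unfolded One_nat_def] L_gate(2)[unfolded One_nat_def]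

lemma set_L_wide:
  "v \<in> set (L RT) \<longleftrightarrow> v = YY \<or> v = D2 \<or> (\<exists>i < N. (\<exists>s < K. v = XA i s) \<or> v = XB i (K - 1))"
  "v \<in> set (L DD) \<longleftrightarrow> v = CC \<or> (\<exists>i < N. v = XA i 0 \<or> (\<exists>s < K. v = ZA i s))"
  "v \<in> set (L C2) \<longleftrightarrow> v = D2 \<or> (\<exists>i < N. \<exists>s < K. v = YB i s)"
  "v \<in> set (L (ZB i s)) \<longleftrightarrow> v = ZK i s \<or> v = ZA i s \<or> (\<exists>j t. (j, t) \<in> set (out i s) \<and> v = YA j t)"
  "v \<in> set (L (YA i s)) \<longleftrightarrow> v = YB i s \<or> v = XB i s \<or> v = YE i s \<or> (\<exists>j t. (j, t) \<in> set (inn i s) \<and> v = ZB j t)"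
  by (auto simp: L_glob L_gate image_iff)

text \<open>For the nodes whose lists grow with the instance, it suffices to compare a neighbour
  with the few possible partners: itself for \<open>RT\<close>, \<open>CC\<close> for
  \<open>DD\<close>, \<open>D2\<close> for \<open>C2\<close>, and the gate partners for
  \<open>ZB\<close> and \<open>YA\<close>.\<close>

lemma vote_L_wide:
  "w \<in> set (L RT) \<Longrightarrow> vote (L RT) w RT = 1"
  "vote (L DD) w CC = (if w = CC then 0 else - 1)"
  "vote (L C2) w D2 = (if w = D2 then 0 else - 1)"
  "vote (L (ZB i s)) w (ZK i s) = (if w = ZK i s then 0 else - 1)"
  "w \<in> set (L (ZB i s)) \<Longrightarrow> vote (L (ZB i s)) w (ZA i s) = (if w = ZA i s then 0 else 1)"
  "vote (L (YA i s)) w (YB i s) = (if w = YB i s then 0 else - 1)"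
  "vote (L (YA i s)) w (YE i s) = (if w = YE i s then 0 else if w = YB i s \<or> w = XB i s then 1 else - 1)"
proof -
  show "vote (L RT) w RT = 1" if "w \<in> set (L RT)"
    using that by (rule vote_unmatched) (auto simp: set_L_wide)
  show "vote (L (ZB i s)) w (ZA i s) = (if w = ZA i s then 0 else 1)" if "w \<in> set (L (ZB i s))"
  proof -
    let ?xs = "ZK i s # map (\<lambda>(j, t). YA j t) (out i s)"
    have eq: "L (ZB i s) = ?xs @ [ZA i s]" by (simp add: L_gate)
    show ?thesis
    proof (cases "w = ZA i s")
      case False
      then have "w \<in> set ?xs" using that unfolding eq by simp
      moreover have "ZA i s \<notin> set ?xs" by auto
      ultimately have "vote (?xs @ [ZA i s]) w (ZA i s) = 1" by (intro vote_snoc)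
      then show ?thesis using False unfolding eq by simp
    qed simp
  qed
qed (simp_all add: L_glob L_gate vote_Cons)

lemma V_simps [simp]:
  "Glob j \<in> V \<longleftrightarrow> j < 11" "Gt i s g \<in> V \<longleftrightarrow> i < N \<and> s < K \<and> g < 12"
  by (auto simp: V_def)

lemma less_11: "j < (11::nat) \<Longrightarrow> j \<in> {0,1,2,3,4,5,6,7,8,9,10}" by simp arith
lemma less_12: "j < (12::nat) \<Longrightarrow> j \<in> {0,1,2,3,4,5,6,7,8,9,10,11}" by simp arith

lemma V_ball:
  assumes "P RT" "P UU" "P Y'" "P YY" "P PP" "P XX" "P X'" "P CC" "P DD" "P C2" "P D2"
    and "\<And>i s. i < N \<Longrightarrow> s < K \<Longrightarrow> P (XA i s) \<and> P (XB i s) \<and> P (XK i s) \<and> P (XE i s)"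
    and "\<And>i s. i < N \<Longrightarrow> s < K \<Longrightarrow> P (ZA i s) \<and> P (ZB i s) \<and> P (ZK i s) \<and> P (ZE i s)"
    and "\<And>i s. i < N \<Longrightarrow> s < K \<Longrightarrow> P (YA i s) \<and> P (YB i s) \<and> P (YK i s) \<and> P (YE i s)"
    and v: "v \<in> V"
  shows "P v"
proof (cases v)
  case (Glob j)
  then show ?thesis using v less_11[of j] assms(1-11) by auto
next
  case (Gt i s g)
  then show ?thesis using v less_12[of g] assms(12-14) by auto
qed

lemma finite_V: "finite V"
proof -
  have "{Gt i s g | i s g. i < N \<and> s < K \<and> g < 12} = (\<lambda>(i, s, g). Gt i s g) ` ({..<N} \<times> {..<K} \<times> {..<12})"
    by force
  then show ?thesis by (simp add: V_def)
qed

lemma distinct_concat_Gt: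
  assumes "\<And>i. i < n \<Longrightarrow> distinct (f i)" "\<And>i v. v \<in> set (f i) \<Longrightarrow> \<exists>s g. v = Gt i s g"
  shows "distinct (concat (map f [0..<n]))"
  using assms
proof (induction n)
  case (Suc n)
  have "\<exists>i s g. i < n \<and> v = Gt i s g" if "v \<in> set (concat (map f [0..<n]))" for v
  proof -
    from that obtain i where "i < n" "v \<in> set (f i)" by auto
    with Suc.prems(2) show ?thesis by metis
  qed
  moreover have "\<exists>s g. v = Gt n s g" if "v \<in> set (f n)" for v
    using Suc.prems(2) that by metis
  ultimately have "set (concat (map f [0..<n])) \<inter> set (f n) = {}"
    by (metis disjoint_iff less_irrefl node.inject(2))
  then show ?case using Suc.IH Suc.prems by simp
qed simp

sublocale preferences V L
proof
  show "finite V" by (rule finite_V)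
  show "distinct (L v)" if "v \<in> V" for v
    using that
  proof (rule V_ball[rotated -1])
    show "distinct (L RT)"
      by (auto simp: L_glob distinct_map inj_on_def intro!: distinct_concat_Gt)
    show "distinct (L DD)"
      by (auto simp: L_glob distinct_map inj_on_def intro!: distinct_concat_Gt)
    show "distinct (L C2)"
      by (auto simp: L_glob distinct_map inj_on_def intro!: distinct_concat_Gt)
  qed (auto simp: L_small L_gate(6,9) distinct_map inj_on_def distinct_out distinct_inn)
  show "w \<in> V \<and> w \<noteq> v \<and> v \<in> set (L w)" if "v \<in> V" "w \<in> set (L v)" for v w
  proof -
    have "\<forall>w \<in> set (L v). w \<in> V \<and> w \<noteq> v \<and> v \<in> set (L w)"
      using that(1)
    proof (rule V_ball[rotated -1], goal_cases)
      case (13 i s)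
      then show ?case using out_inn[OF 13] by (auto simp: L_small set_L_wide)
    next
      case (14 i s)
      then show ?case using inn_out[OF 14] by (auto simp: L_small set_L_wide)
    qed (use K_pos in \<open>auto simp: L_small set_L_wide less_Suc_eq\<close>)
    then show ?thesis using that(2) by blast
  qed
qed

text \<open>Vote sums and weight sums are symmetric in the two ends, so each edge has to be
  inspected in one orientation only; the sparse families \<open>first\<close>, \<open>succ\<close>,
  \<open>last\<close> and \<open>conf\<close> are kept apart because they alone leave a gate at
  places that depend on the symbol.\<close>

lemma edge_cases:
  assumes sym: "\<And>v w. P v w \<Longrightarrow> P w v"
    and glob: "P YY Y'" "P UU Y'" "P YY PP" "P YY RT" "P UU X'" "P XX X'" "P XX PP" "P PP CC" "P CC DD"
      "P C2 D2" "P D2 RT"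
    and X: "\<And>i s. i < N \<Longrightarrow> s < K \<Longrightarrow>
      P (XA i s) (XB i s) \<and> P (XA i s) (XE i s) \<and> P (XK i s) (XB i s) \<and> P (XK i s) (XE i s) \<and>
      P (XA i s) RT \<and> P (XB i s) (ZA i s) \<and> P (XB i s) (YA i s)"
    and Z: "\<And>i s. i < N \<Longrightarrow> s < K \<Longrightarrow>
      P (ZA i s) (ZB i s) \<and> P (ZA i s) (ZE i s) \<and> P (ZK i s) (ZB i s) \<and> P (ZK i s) (ZE i s) \<and> P DD (ZA i s)"
    and Y: "\<And>i s. i < N \<Longrightarrow> s < K \<Longrightarrow>
      P (YA i s) (YB i s) \<and> P (YA i s) (YE i s) \<and> P (YK i s) (YB i s) \<and> P (YK i s) (YE i s) \<and> P (YB i s) C2"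
    and first: "\<And>i. i < N \<Longrightarrow> P DD (XA i 0)" and last: "\<And>i. i < N \<Longrightarrow> P (XB i (K - 1)) RT"
    and succ: "\<And>i s. i < N \<Longrightarrow> Suc s < K \<Longrightarrow> P (XB i s) (XA i (Suc s))"
    and conf: "\<And>i s j t. i < N \<Longrightarrow> s < K \<Longrightarrow> j < N \<Longrightarrow> t < K \<Longrightarrow> (j, t) \<in> set (out i s) \<Longrightarrow> P (ZB i s) (YA j t)"
    and v: "v \<in> V" and w: "w \<in> set (L v)"
  shows "P v w"
proof -
  note glob' = glob glob[THEN sym]
  have "\<forall>w \<in> set (L v). P v w"
    using v
  proof (rule V_ball[rotated -1], goal_cases)
    case (12 i s)
    have "P (XA i s) (if s = 0 then DD else XB i (s - 1))"
      using first[THEN sym, OF 12(1)] succ[THEN sym, OF 12(1), of "s - 1"] 12(2) by (cases s) simp_all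
    moreover have "P (XB i s) (if Suc s < K then XA i (Suc s) else RT)"
    proof (cases "Suc s < K")
      case False
      then have "s = K - 1" using 12(2) by simp
      then show ?thesis using last[OF 12(1)] False by simp
    qed (use succ[OF 12(1)] in simp)
    ultimately show ?case
      using X[OF 12] sym by (simp add: L_small)
  next
    case (13 i s)
    then show ?case
      using Z[OF 13] X[OF 13] sym conf[OF 13] out_inn[OF 13] by (simp add: L_small) (auto simp: set_L_wide)
  next
    case (14 i s)
    then show ?case
      using Y[OF 14] X[OF 14] sym conf[OF _ _ 14] inn_out[OF 14] by (simp add: L_small) (auto simp: set_L_wide)
  next
    case 1
    have "P RT (XA i s)" if "i < N" "s < K" for i s using X[OF that] sym by blast
    then show ?case using glob'(15,22) last[THEN sym] by (auto simp: set_L_wide)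
  next
    case 9
    have "P DD (ZA i s)" if "i < N" "s < K" for i s using Z[OF that] by blast
    then show ?case using glob'(20) first by (auto simp: set_L_wide)
  next
    case 10
    have "P C2 (YB i s)" if "i < N" "s < K" for i s using Y[OF that] sym by blast
    then show ?case using glob'(10) by (auto simp: set_L_wide)
  qed (use glob' in \<open>simp_all add: L_small\<close>)
  then show ?thesis using w by blast
qed

text \<open>Entry \<open>g\<close> is the offset of the partner of \<open>g\<close> among the twelve
  gate nodes: \<open>state_A\<close> pairs a-b and k-e, and \<open>state_B\<close> pairs a-e and
  b-k, in all three cycles at once.\<close>

definition state_A :: "nat list" where
  "state_A = [1, 0, 3, 2, 5, 4, 7, 6, 9, 8, 11, 10]"

definition state_B :: "nat list" where
  "state_B = [3, 2, 1, 0, 7, 6, 5, 4, 11, 10, 9, 8]"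

fun gmatch :: "node list \<Rightarrow> (nat \<Rightarrow> nat \<Rightarrow> bool) \<Rightarrow> node \<Rightarrow> node" where
  "gmatch gs tr (Glob j) = gs ! j"
| "gmatch gs tr (Gt i s g) = Gt i s ((if tr i s then state_A else state_B) ! g)"

definition "stab = gmatch [RT, UU, YY, Y', PP, X', XX, DD, CC, D2, C2] (\<lambda>_ _. True)"

text \<open>On the global nodes this is \<open>stab\<close> augmented along
  \<open>UU\<close>-\<open>Y'\<close>-\<open>YY\<close>-\<open>PP\<close>, which leaves only
  \<open>RT\<close> alone.\<close>

definition "domi tr = gmatch [RT, Y', UU, PP, YY, X', XX, DD, CC, D2, C2] tr"

lemma imatching_stab: "imatching stab"
  unfolding imatching_def
proof (rule ballI)
  fix v assume "v \<in> V"
  then show "stab v \<in> insert v (set (L v)) \<and> stab (stab v) = v"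
    by (rule V_ball[rotated -1]) (auto simp: L_small set_L_wide stab_def state_A_def)
qed

lemma imatching_domi: "imatching (domi tr)"
  unfolding imatching_def
proof (rule ballI)
  fix v assume "v \<in> V"
  then show "domi tr v \<in> insert v (set (L v)) \<and> domi tr (domi tr v) = v"
    by (rule V_ball[rotated -1]) (auto simp: L_small set_L_wide domi_def state_A_def state_B_def)
qed

lemma istable_stab: "istable stab"
  unfolding istable_def
proof (intro conjI ballI)
  show "imatching stab" by (rule imatching_stab)
  fix v w assume v: "v \<in> V" and w: "w \<in> set (L v)"
  show "vote (L v) w (stab v) + vote (L w) v (stab w) \<le> 0"
    using v w
    by (rule edge_cases[rotated -2])
      (simp_all add: set_L_wide L_small vote_L_wide vote_Cons stab_def state_A_def)
qed

end

context gadget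
begin

lemma odd_card_V: "odd (card V)"
proof -
  have "{Gt i s g | i s g. i < N \<and> s < K \<and> g < 12} = (\<lambda>(i, s, g). Gt i s g) ` ({..<N} \<times> {..<K} \<times> {..<12})"
    by force
  moreover have "inj_on (\<lambda>(i, s, g). Gt i s g) ({..<N} \<times> {..<K} \<times> {..<12})"
    by (auto simp: inj_on_def)
  ultimately have "card {Gt i s g | i s g. i < N \<and> s < K \<and> g < 12} = N * (K * 12)"
    by (simp add: card_image)
  moreover have "card (Glob ` {..<11}) = 11" by (subst card_image) (auto simp: inj_on_def)
  moreover have "card V = card (Glob ` {..<11}) + card {Gt i s g | i s g. i < N \<and> s < K \<and> g < 12}"
    using finite_V unfolding V_def by (intro card_Un_disjoint) auto
  ultimately show ?thesis by simp
qed

text \<open>The weights of the nodes that the source \<open>PP\<close> reaches by alternating paths are forced;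
  all other gates have weight \<open>0\<close>.\<close>

fun weight :: "(nat \<Rightarrow> nat) \<Rightarrow> node \<Rightarrow> int" where
  "weight \<tau> (Glob j) = [0, -1, 1, 1, -1, 1, -1, 1, -1, 0, 0] ! j"
| "weight \<tau> (Gt i s g) =
     (let r = [1, -1, 1, -1, 1, -1, 1, -1, 1, -1, 1, -1] ! g
      in if g < 4 \<and> \<tau> i \<le> s \<or> 8 \<le> g \<and> s = \<tau> i then 0 else r)"

text \<open>Nonzero weights spread from \<open>PP\<close> over \<open>CC\<close> and
  \<open>DD\<close> into every Z-gate and along each X-chain up to the chosen gate, which blocks
  them since its \<open>XA\<close> already has its first choice. They must not reach
  \<open>C2\<close>, \<open>D2\<close> and \<open>RT\<close>, because an unmatched node is forced to
  weight 0; hence the Y-gates of chosen symbols have weight 0. Popularity then gives dominance: only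
  \<open>RT\<close> is missed and \<open>card V\<close> is odd.\<close>

lemma idominant_domi:
  assumes \<tau>: "\<And>i. i < N \<Longrightarrow> \<tau> i < K"
    and free: "\<And>i j. i < N \<Longrightarrow> j < N \<Longrightarrow> (j, \<tau> j) \<notin> set (out i (\<tau> i))"
  shows "idominant (domi (\<lambda>i s. s = \<tau> i))"
proof -
  let ?m = "domi (\<lambda>i s. s = \<tau> i)" and ?w = "weight \<tau>"
  have pop: "ipopular ?m"
  proof (rule ipopular_weight[where \<alpha> = ?w])
    show "imatching ?m" by (rule imatching_domi)
    show "vote (L v) w (?m v) + vote (L w) v (?m w) \<le> ?w v + ?w w" if "v \<in> V" "w \<in> set (L v)" for v w
      using that
    proof (rule edge_cases[rotated -2], goal_cases)
      \<comment> \<open>The end of the chain at \<open>RT\<close>: the vote sum is 0, so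
        \<open>XB i (K - 1)\<close> must have weight 0, which is the bound
        \<open>\<tau> i \<le> K - 1\<close>.\<close>
      case (17 i)
      then show ?case using \<tau>[of i]
        by (auto simp: set_L_wide L_small vote_L_wide vote_Cons domi_def state_A_def state_B_def)
    next
      \<comment> \<open>A conflict edge: the weight sum is -1 if \<open>t = \<tau> j\<close>, while
        the vote sum is 0 if also \<open>s = \<tau> i\<close> and -2 otherwise. The first is the
        case that \<open>free\<close> excludes.\<close>
      case (19 i s j t)
      then show ?case using free[of i j]
        by (auto simp: set_L_wide L_small vote_L_wide vote_Cons domi_def state_A_def state_B_def)
    qed (auto simp: set_L_wide L_small vote_L_wide vote_Cons domi_def state_A_def state_B_def)
    show "vote (L v) v (?m v) \<le> ?w v" if "v \<in> V" for v
    proof (cases "v = RT")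
      case True
      then show ?thesis by (simp add: domi_def)
    next
      case False
      from that have "v \<noteq> RT \<longrightarrow> ?w v \<ge> -1 \<and> ?m v \<noteq> v"
        by (rule V_ball[rotated -1]) (auto simp: domi_def state_A_def state_B_def)
      moreover have "v \<notin> set (L v)" using list_sym that by blast
      moreover have "?m v \<in> insert v (set (L v))"
        using imatching_domi that unfolding imatching_def by blast
      ultimately show ?thesis
        using False vote_unmatched[of "?m v" "L v" v] vote_swap[of "L v" v "?m v"] by auto
    qed
    show "?w v + ?w (?m v) = 0" if "v \<in> V" for v
      using that by (rule V_ball[rotated -1]) (auto simp: domi_def state_A_def state_B_def)
  qed
  have "covered ?m = V - {RT}"
  proof -
    have "?m v = v \<longleftrightarrow> v = RT" if "v \<in> V" for v
      using that by (rule V_ball[rotated -1]) (auto simp: domi_def state_A_def state_B_def)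
    then show ?thesis by (auto simp: covered_def)
  qed
  then have c: "Suc (card (covered ?m)) = card V"
    using card.remove[OF finite_V, of RT] by simp
  have "\<not> card (covered m') > card (covered ?m)" if m': "imatching m'" for m'
  proof -
    have "card (covered m') \<le> card V" using finite_V by (intro card_mono) (auto simp: covered_def)
    moreover have "card (covered m') \<noteq> card V" using even_card_covered[OF m'] odd_card_V by auto
    ultimately show ?thesis using c by simp
  qed
  then show ?thesis using pop unfolding idominant_def by blast
qed

section \<open>Partners forced in an arbitrary dominant matching\<close>

context
  fixes m
  assumes dom: "idominant m"
begin

lemma pop: "ipopular m"
  using dom by (simp add: idominant_def)

lemma imatching_m: "imatching m"
  using pop by (simp add: ipopular_def)

lemmas inv = imatching_inv[OF imatching_m]

text \<open>\<open>stab\<close> is stable and leaves just \<open>RT\<close>, \<open>UU\<close> and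
  \<open>PP\<close> alone, and a popular matching covers everything that a stable one
  covers.\<close>

lemma m_in:
  assumes "v \<in> V" "v \<notin> {RT, UU, PP}"
  shows "m v \<in> set (L v)"
proof -
  have "v \<notin> {RT, UU, PP} \<longrightarrow> stab v \<noteq> v"
    using assms(1) by (rule V_ball[rotated -1]) (auto simp: stab_def state_A_def)
  then have "m v \<noteq> v"
    using covered_stable_subset[OF istable_stab pop] assms by (auto simp: covered_def)
  then show ?thesis using imatching_list[OF imatching_m assms(1)] by simp
qed

lemma some_unmatched: "m RT = RT \<or> m UU = UU \<or> m PP = PP"
proof (rule ccontr)
  assume *: "\<not> ?thesis"
  have "m v \<noteq> v" if "v \<in> V" for v
    using * m_in[OF that] list_sym[OF that, of v] by (cases "v \<in> {RT, UU, PP}") auto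
  then have "covered m = V" by (auto simp: covered_def)
  then show False using even_card_covered[OF imatching_m] odd_card_V by simp
qed

lemma not_beaten:
  assumes "distinct (ends es)" "list_all (\<lambda>(a, b). a \<in> V \<and> b \<in> set (L a)) es"
    and "m ` set (ends es) \<subseteq> insert x (set (ends es))"
  shows "(\<Sum>(a, b) \<leftarrow> es. vote (L a) b (m a) + vote (L b) a (m b)) \<le> 1"
  using rematch_pairs(1)[OF imatching_m assms(1,2) pop assms(3)] by blast

text \<open>Every alternative on the few source nodes admits a rematching that wins or, in one case,
  ties with a larger matching.\<close>

lemma m_source: "m RT = RT" "m UU = Y'" "m Y' = UU" "m YY = PP" "m PP = YY"
proof -
  have y': "m Y' = YY \<or> m Y' = UU" and x': "m X' = XX \<or> m X' = UU"
    and y: "m YY = Y' \<or> m YY = PP \<or> m YY = RT" and x: "m XX = X' \<or> m XX = PP"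
    and c: "m CC = DD \<or> m CC = PP"
    using m_in[of Y'] m_in[of X'] m_in[of YY] m_in[of XX] m_in[of CC] by (simp_all add: L_small)
  have p: "m PP \<in> {PP, XX, CC, YY}" and u: "m UU \<in> {UU, Y', X'}"
    using imatching_list[OF imatching_m, of PP] imatching_list[OF imatching_m, of UU]
    by (auto simp: L_small)
  have i: "m (m Y') = Y'" "m (m X') = X'" "m (m YY) = YY" "m (m XX) = XX" "m (m CC) = CC"
      "m (m PP) = PP" "m (m UU) = UU"
    by (rule inv, simp)+
  have "\<not> (m Y' = YY \<and> m X' = XX)"
  proof
    assume *: "m Y' = YY \<and> m X' = XX"
    then have m: "m YY = Y'" "m XX = X'" "m UU = UU" using i u by auto
    then consider "m PP = PP" | "m PP = CC" using p i by auto
    then show False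
    proof cases
      case 1
      \<comment> \<open>The votes tie (\<open>UU\<close> and \<open>PP\<close> gain,
        \<open>Y'\<close> and \<open>YY\<close> lose), but the matching grows. This is the only
        place that uses more than popularity.\<close>
      then show False
        using rematch_pairs(2)[OF imatching_m, of "[(UU, Y'), (YY, PP)]" UU] dom m *
        by (auto simp: L_small vote_Cons vote_unmatched)
    next
      case 2
      then have "m CC = PP" using i by auto
      moreover from this have "m DD \<noteq> CC" using inv[of DD] by auto
      then have "vote (L DD) CC (m DD) = 1"
        using vote_swap[of "L DD" "m DD" CC] vote_L_wide(2)[of "m DD"] by simp
      \<comment> \<open>\<open>UU\<close>, \<open>PP\<close>, \<open>CC\<close> and
        \<open>DD\<close> gain, \<open>X'\<close> and \<open>XX\<close> lose: a surplus of 2 against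
        the one abandoned node \<open>m DD\<close>.\<close>
      ultimately show False
        using not_beaten[of "[(UU, X'), (XX, PP), (CC, DD)]" "m DD"] m * 2
        by (auto simp: L_small vote_Cons vote_unmatched)
    qed
  qed
  moreover have "\<not> m X' = UU"
  proof
    assume *: "m X' = UU"
    then have m: "m UU = X'" "m XX = PP" "m PP = XX" "m Y' = YY" "m YY = Y'" using i x x' y' by auto
    then have "m RT = RT" using some_unmatched by auto
    \<comment> \<open>\<open>RT\<close>, \<open>UU\<close>, \<open>X'\<close> and \<open>XX\<close>
      gain, \<open>YY\<close> and \<open>Y'\<close> lose, and only \<open>PP\<close> is
      abandoned.\<close>
    then show False
      using not_beaten[of "[(RT, YY), (Y', UU), (X', XX)]" PP] m *
      by (auto simp: L_small set_L_wide vote_L_wide vote_Cons)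
  qed
  ultimately have *: "m Y' = UU" "m X' = XX" "m UU = Y'" using x' y' i by auto
  have "m YY \<noteq> RT"
  proof
    assume y: "m YY = RT"
    then have "m RT = YY" using i by auto
    then have "m PP = PP" using some_unmatched * by auto
    \<comment> \<open>Both \<open>YY\<close> and the unmatched \<open>PP\<close> gain by joining,
      and only \<open>RT\<close> is abandoned.\<close>
    then show False
      using not_beaten[of "[(YY, PP)]" RT] y by (auto simp: L_small vote_Cons)
  qed
  then show yp: "m YY = PP" using y * i by auto
  then show "m PP = YY" using i by auto
  then show "m RT = RT" using some_unmatched * by auto
  show "m Y' = UU" "m UU = Y'" using * by auto
qed

lemma m_connect: "m CC = DD" "m DD = CC" "m D2 = C2" "m C2 = D2"
proof -
  show c: "m CC = DD" using m_in[of CC] inv[of CC] m_source by (auto simp: L_small)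
  show d: "m D2 = C2" using m_in[of D2] inv[of D2] m_source by (auto simp: L_small)
  show "m DD = CC" "m C2 = D2" using inv[of CC] inv[of D2] c d by simp_all
qed

text \<open>The only neighbour of \<open>YB\<close> outside its gate is \<open>C2\<close>, which is
  taken; \<open>YK\<close> and \<open>YE\<close> have no outside neighbours, so the gate is
  closed.\<close>

lemma m_Y:
  assumes ij: "i < N" "s < K"
  shows "m (YA i s) = YB i s \<or> m (YA i s) = YE i s" "m (YB i s) = YA i s \<or> m (YB i s) = YK i s"
proof -
  have m: "m (YB i s) \<in> {YK i s, YA i s}" "m (YK i s) \<in> {YE i s, YB i s}" "m (YE i s) \<in> {YA i s, YK i s}"
    using m_in[of "YB i s"] m_in[of "YK i s"] m_in[of "YE i s"] inv[of "YB i s"] m_connect ij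
    by (auto simp: L_small)
  then show "m (YB i s) = YA i s \<or> m (YB i s) = YK i s" by auto
  then show "m (YA i s) = YB i s \<or> m (YA i s) = YE i s"
    using m ij inv[of "YB i s"] inv[of "YK i s"] inv[of "YE i s"] by auto
qed

text \<open>The outside neighbours of \<open>ZB\<close> are nodes \<open>YA\<close>, which are
  already known to be matched inside their own gates.\<close>

lemma m_Z:
  assumes ij: "i < N" "s < K"
  shows "m (ZA i s) = ZB i s \<or> m (ZA i s) = ZE i s" "m (ZB i s) = ZA i s \<or> m (ZB i s) = ZK i s"
proof -
  have "m (ZB i s) \<noteq> YA j t" if "(j, t) \<in> set (out i s)" for j t
    using m_Y[of j t] out_inn[OF ij that] inv[of "ZB i s"] ij by auto
  then have m: "m (ZB i s) \<in> {ZK i s, ZA i s}" "m (ZK i s) \<in> {ZE i s, ZB i s}" "m (ZE i s) \<in> {ZA i s, ZK i s}"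
    using m_in[of "ZB i s"] m_in[of "ZK i s"] m_in[of "ZE i s"] ij
    by (auto simp: L_small set_L_wide)
  then show "m (ZB i s) = ZA i s \<or> m (ZB i s) = ZK i s" by auto
  then show "m (ZA i s) = ZB i s \<or> m (ZA i s) = ZE i s"
    using m ij inv[of "ZB i s"] inv[of "ZK i s"] inv[of "ZE i s"] by auto
qed

text \<open>Induction along the chain: \<open>XA\<close> could leave its gate only to
  \<open>RT\<close>, which is unmatched, or to its predecessor, which is \<open>DD\<close> or a
  \<open>XB\<close> whose gate is already closed.\<close>

lemma m_X:
  assumes i: "i < N"
  shows "s < K \<Longrightarrow> m (XA i s) = XB i s \<and> m (XB i s) = XA i s \<or>
    m (XA i s) = XE i s \<and> m (XE i s) = XA i s \<and> m (XK i s) = XB i s \<and> m (XB i s) = XK i s"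
proof (induction s)
  case (0)
  have "m (XA i 0) \<in> {XB i 0, XE i 0}" "m (XK i 0) \<in> {XE i 0, XB i 0}" "m (XE i 0) \<in> {XA i 0, XK i 0}"
    using m_in[of "XA i 0"] m_in[of "XK i 0"] m_in[of "XE i 0"] inv[of "XA i 0"] m_connect m_source i 0
    by (auto simp: L_small)
  then show ?case using i 0 inv[of "XA i 0"] inv[of "XK i 0"] inv[of "XE i 0"] by auto
next
  case (Suc s)
  have "m (XA i (Suc s)) \<noteq> XB i s"
    using Suc inv[of "XA i (Suc s)"] i by auto
  then have "m (XA i (Suc s)) \<in> {XB i (Suc s), XE i (Suc s)}" "m (XK i (Suc s)) \<in> {XE i (Suc s), XB i (Suc s)}"
      "m (XE i (Suc s)) \<in> {XA i (Suc s), XK i (Suc s)}"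
    using m_in[of "XA i (Suc s)"] m_in[of "XK i (Suc s)"] m_in[of "XE i (Suc s)"] inv[of "XA i (Suc s)"]
      m_source i Suc.prems
    by (auto simp: L_small)
  then show ?case
    using i Suc.prems inv[of "XA i (Suc s)"] inv[of "XK i (Suc s)"] inv[of "XE i (Suc s)"] by auto
qed

definition true_at :: "nat \<Rightarrow> nat \<Rightarrow> bool" where
  "true_at i s \<longleftrightarrow> m (XA i s) = XB i s"

text \<open>Otherwise \<open>RT\<close>, \<open>XB\<close> and \<open>ZA\<close> gain by the new
  pairs, \<open>XA\<close> loses, and only \<open>ZE\<close> is abandoned.\<close>

lemma true_Z:
  assumes ij: "i < N" "s < K" and t: "true_at i s"
  shows "m (ZA i s) = ZB i s"
proof (rule ccontr)
  assume "\<not> ?thesis"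
  then have z: "m (ZA i s) = ZE i s" using m_Z[OF ij] by simp
  have "m (XA i s) = XB i s" "m (XB i s) = XA i s" using t m_X[OF ij] by (auto simp: true_at_def)
  then show False
    using not_beaten[of "[(RT, XA i s), (XB i s, ZA i s)]" "ZE i s"] z ij m_source(1)
    by (auto simp: L_small set_L_wide vote_L_wide vote_Cons)
qed

text \<open>The same deviation with \<open>YA\<close> in the role of \<open>ZA\<close>; it wins
  because \<open>YA\<close> prefers \<open>XB\<close> to \<open>YE\<close>.\<close>

lemma true_Y:
  assumes ij: "i < N" "s < K" and t: "true_at i s"
  shows "m (YA i s) = YB i s"
proof (rule ccontr)
  assume "\<not> ?thesis"
  then have z: "m (YA i s) = YE i s" using m_Y[OF ij] by simp
  have "m (XA i s) = XB i s" "m (XB i s) = XA i s" using t m_X[OF ij] by (auto simp: true_at_def)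
  then show False
    using not_beaten[of "[(RT, XA i s), (XB i s, YA i s)]" "YE i s"] z ij m_source(1)
    by (auto simp: L_small set_L_wide vote_L_wide vote_Cons)
qed

text \<open>With both gates in the state a-b, the alternating path \<open>PP\<close>,
  \<open>DD\<close>, Z-gate, Y-gate, \<open>C2\<close>, \<open>RT\<close> consists of pairs with
  vote sum 0, so the two votes of \<open>YY\<close> and \<open>Y'\<close> remain against the single
  loss of \<open>UU\<close>.\<close>

lemma no_conflict:
  assumes ij: "i < N" "s < K" and t: "true_at i s" and jt: "(j, t) \<in> set (out i s)" and t': "true_at j t"
  shows False
proof -
  have jt': "j < N" "t < K" using out_inn[OF ij jt] by auto
  have z: "m (ZA i s) = ZB i s" "m (YA j t) = YB j t" using true_Z true_Y ij jt' t t' by auto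
  then have z': "m (ZB i s) = ZA i s" "m (YB j t) = YA j t"
    using inv[of "ZA i s"] inv[of "YA j t"] ij jt' by simp_all
  then show False
    using not_beaten[of "[(YY, Y'), (PP, CC), (DD, ZA i s), (ZB i s, YA j t), (YB j t, C2), (D2, RT)]" UU]
      z m_source m_connect ij jt jt' out_inn[OF ij jt]
    by (auto simp: L_small set_L_wide vote_L_wide vote_Cons)
qed

text \<open>If all X-gates of the position are in the state a-e, each new pair along the chain has
  one winner and one loser, so again \<open>YY\<close> and \<open>Y'\<close> outvote
  \<open>UU\<close>.\<close>

lemma some_true:
  assumes i: "i < N"
  shows "\<exists>s < K. true_at i s"
proof (rule ccontr)
  note One_nat_def [simp del]
  assume "\<not> ?thesis"
  then have B: "m (XA i s) = XE i s" "m (XE i s) = XA i s" "m (XK i s) = XB i s" "m (XB i s) = XK i s"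
    if "s < K" for s
    using m_X[OF i that] that unfolding true_at_def by blast+
  obtain k where k: "K = Suc k" using K_pos by (cases K) auto
  let ?es = "[(YY, Y'), (PP, CC), (DD, XA i 0)] @ map (\<lambda>s. (XE i s, XK i s)) [0..<K] @
    map (\<lambda>s. (XB i s, XA i (Suc s))) [0..<k] @ [(XB i k, RT)]"
  have ends_XX: "distinct (ends (map (\<lambda>s. (XE i s, XK i s)) [0..<n]))"
      "set (ends (map (\<lambda>s. (XE i s, XK i s)) [0..<n])) = XE i ` {..<n} \<union> XK i ` {..<n}"
      "distinct (ends (map (\<lambda>s. (XB i s, XA i (Suc s))) [0..<n]))"
      "set (ends (map (\<lambda>s. (XB i s, XA i (Suc s))) [0..<n])) = XB i ` {..<n} \<union> (\<lambda>s. XA i (Suc s)) ` {..<n}" for n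
    by (induction n) (auto simp: lessThan_Suc)
  have d: "distinct (ends ?es)" by (auto simp: ends_XX)
  have A: "{XA i 0} \<union> (\<lambda>s. XA i (Suc s)) ` {..<k} = XA i ` {..<K}"
    unfolding k lessThan_Suc_eq_insert_0 by auto
  have B': "insert (XB i k) (XB i ` {..<k}) = XB i ` {..<K}" unfolding k lessThan_Suc by auto
  have S: "set (ends ?es) = {YY, Y', PP, CC, DD, RT} \<union> XA i ` {..<K} \<union> XB i ` {..<K} \<union> XE i ` {..<K} \<union> XK i ` {..<K}"
    unfolding A[symmetric] B'[symmetric] by (auto simp: ends_XX)
  have sub: "m ` set (ends ?es) \<subseteq> insert UU (set (ends ?es))"
    unfolding S using B m_source m_connect by auto
  have k': "k < K" "\<not> Suc k < K" "\<And>s. s < k \<Longrightarrow> s < K \<and> Suc s < K" "K - 1 = k" using k by auto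
  have e: "list_all (\<lambda>(a, b). a \<in> V \<and> b \<in> set (L a)) ?es"
    using i K_pos k' by (auto simp: L_small set_L_wide list_all_iff)
  have v1: "(\<Sum>(a, b) \<leftarrow> map (\<lambda>s. (XE i s, XK i s)) [0..<n]. vote (L a) b (m a) + vote (L b) a (m b)) = 0"
    if "n \<le> K" for n
    using that by (induction n) (auto simp: B L_small vote_Cons)
  have v2: "(\<Sum>(a, b) \<leftarrow> map (\<lambda>s. (XB i s, XA i (Suc s))) [0..<n]. vote (L a) b (m a) + vote (L b) a (m b)) = 0"
    if "n < K" for n
    using that by (induction n) (auto simp: B L_small vote_Cons)
  show False
    using not_beaten[OF d e sub] v1[of K] v2[of k] B[of 0] B[of k] m_source m_connect k' K_pos i
    by (auto simp: L_small set_L_wide vote_L_wide vote_Cons)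
qed

end

theorem idominant_iff:
  "(\<exists>m. idominant m) \<longleftrightarrow>
   (\<exists>\<tau>. (\<forall>i < N. \<tau> i < K) \<and> (\<forall>i < N. \<forall>j < N. (j, \<tau> j) \<notin> set (out i (\<tau> i))))"
proof
  assume "\<exists>m. idominant m"
  then obtain m where m: "idominant m" ..
  have "\<forall>i. \<exists>s. i < N \<longrightarrow> s < K \<and> true_at m i s" using some_true[OF m] by blast
  then obtain \<tau> where "\<And>i. i < N \<Longrightarrow> \<tau> i < K \<and> true_at m i (\<tau> i)" by metis
  then show "\<exists>\<tau>. (\<forall>i < N. \<tau> i < K) \<and> (\<forall>i < N. \<forall>j < N. (j, \<tau> j) \<notin> set (out i (\<tau> i)))"
    using no_conflict[OF m] by blast
next
  assume "\<exists>\<tau>. (\<forall>i < N. \<tau> i < K) \<and> (\<forall>i < N. \<forall>j < N. (j, \<tau> j) \<notin> set (out i (\<tau> i)))"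
  then show "\<exists>m. idominant m" using idominant_domi by blast
qed

end

section \<open>Space-time diagrams as tilings\<close>

text \<open>
  A cell records, for one column of one row, the state and the scanned symbols of the whole
  configuration, the content of this column on every tape together with its position relative to the
  head, and a flag that is used in row 0 only, where it marks the columns beyond the witness.
  Column 0 of every row is a separator, represented by \<open>None\<close>.
\<close>

datatype side = Before | Here | After

type_synonym cell = "nat \<times> nat list \<times> (nat \<times> side) list \<times> bool"

datatype kind = Sep | Lft | Inp nat | Wit | Blk | Mid | Acc

fun hnext :: "side \<Rightarrow> side \<Rightarrow> bool" where
  "hnext Before h \<longleftrightarrow> h \<noteq> After"
| "hnext _ h \<longleftrightarrow> h = After"

fun hmove :: "move \<Rightarrow> side \<Rightarrow> side \<Rightarrow> bool" where
  "hmove Stay h h' \<longleftrightarrow> h' = h"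
| "hmove Move_Right After h' \<longleftrightarrow> h' \<noteq> Before"
| "hmove Move_Right _ h' \<longleftrightarrow> h' = Before"
| "hmove Move_Left Before h' \<longleftrightarrow> h' \<noteq> After"
| "hmove Move_Left _ h' \<longleftrightarrow> h' = After"

definition side_of :: "int \<Rightarrow> int \<Rightarrow> side" where
  "side_of z h = (if z < h then Before else if z = h then Here else After)"

lemma hnext_side_of: "hnext (side_of z h) (side_of (z + 1) h)"
  by (simp add: side_of_def)

lemma hmove_side_of: "hmove d (side_of z h) (side_of z (h + offset d))"
  by (cases d) (auto simp: side_of_def)

lemma side_of_Here [simp]: "side_of z h = Here \<longleftrightarrow> z = h"
  by (simp add: side_of_def)

text \<open>\<open>hmove\<close> leaves one case open: a cell on the side towards which the head
  moves may or may not be its new place. The neighbour on the head's side decides by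
  \<open>hnext\<close>, and it lies in the window because \<open>h\<close> does.\<close>

lemma hmove_unique:
  fixes f :: "int \<Rightarrow> side"
  assumes move: "\<And>z. a \<le> z \<Longrightarrow> z \<le> b \<Longrightarrow> hmove d (side_of z h) (f z)"
    and nxt: "\<And>z. a \<le> z \<Longrightarrow> z < b \<Longrightarrow> hnext (f z) (f (z + 1))"
    and h: "a \<le> h" "h \<le> b" and z: "a \<le> z" "z \<le> b"
  shows "f z = side_of z (h + offset d)"
proof (cases d)
  case Stay
  then show ?thesis using move[OF z] by simp
next
  case Move_Right
  show ?thesis
  proof (cases "z \<le> h")
    case True
    then show ?thesis using move[OF z] Move_Right by (auto simp: side_of_def split: if_splits)
  next
    case False
    then have "hnext (f (z - 1)) (f z)" using nxt[of "z - 1"] z h by simp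
    moreover have "hmove d (side_of (z - 1) h) (f (z - 1))" using move[of "z - 1"] z h False by simp
    ultimately show ?thesis
      using move[OF z] Move_Right False
      by (cases "f (z - 1)"; cases "f z") (auto simp: side_of_def split: if_splits)
  qed
next
  case Move_Left
  show ?thesis
  proof (cases "h \<le> z")
    case True
    then show ?thesis using move[OF z] Move_Left by (auto simp: side_of_def split: if_splits)
  next
    case False
    then have "hnext (f z) (f (z + 1))" using nxt[of z] z h by simp
    moreover have "hmove d (side_of (z + 1) h) (f (z + 1))" using move[of "z + 1"] z h False by simp
    ultimately show ?thesis
      using move[OF z] Move_Left False
      by (cases "f (z + 1)"; cases "f z") (auto simp: side_of_def split: if_splits)
  qed
qed

text \<open>A head moves by at most \<open>T\<close> cells in \<open>T\<close> steps, whence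
  \<open>T\<close> columns to the left of cell 0 and \<open>T\<close> columns behind the space for
  the witness.\<close>

definition row0 :: "bool list \<Rightarrow> nat \<Rightarrow> nat \<Rightarrow> kind list" where
  "row0 x P T = Sep # replicate T Lft @ map Inp (bits x) @ [Inp 3] @ replicate P Wit @ replicate T Blk"

definition width :: "bool list \<Rightarrow> nat \<Rightarrow> nat \<Rightarrow> nat" where
  "width x P T = 2 * T + length x + P + 2"

definition kinds :: "bool list \<Rightarrow> nat \<Rightarrow> nat \<Rightarrow> kind list" where
  "kinds x P T = row0 x P T @
     concat (replicate (T - 1) (Sep # replicate (width x P T - 1) Mid)) @
     (Sep # replicate (width x P T - 1) Acc)"

lemma length_row0: "length (row0 x P T) = width x P T"
  by (simp add: row0_def width_def bits_def)

lemma length_concat_replicate: "length (concat (replicate m xs)) = m * length xs"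
  by (induction m) auto

lemma nth_concat_replicate: "i < m * length xs \<Longrightarrow> concat (replicate m xs) ! i = xs ! (i mod length xs)"
proof (induction m arbitrary: i)
  case (Suc m)
  show ?case
  proof (cases "i < length xs")
    case False
    then have "concat (replicate m xs) ! (i - length xs) = xs ! ((i - length xs) mod length xs)"
      using Suc by (intro Suc.IH) auto
    then show ?thesis using False by (simp add: nth_append le_mod_geq)
  qed (simp add: nth_append)
qed simp

locale layout =
  fixes x :: "bool list" and P T :: nat
  assumes T: "1 \<le> T"
begin

abbreviation "W \<equiv> width x P T"
abbreviation "ks \<equiv> kinds x P T"

lemma W_pos: "1 < W" by (simp add: width_def)

lemma length_kinds: "length ks = (T + 1) * W"
proof -
  have "length ks = W + (T - 1) * W + W"
    using W_pos by (simp add: kinds_def length_row0 length_concat_replicate)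
  also have "\<dots> = ((T - 1) + 2) * W" by (simp add: algebra_simps)
  also have "T - 1 + 2 = T + 1" using T by simp
  finally show ?thesis .
qed

lemma nth_kinds:
  assumes t: "t \<le> T" and c: "c < W"
  shows "ks ! (t * W + c) =
    (if c = 0 then Sep else if t = 0 then row0 x P T ! c else if t < T then Mid else Acc)"
proof -
  let ?mid = "concat (replicate (T - 1) (Sep # replicate (W - 1) Mid))"
  have lm: "length ?mid = (T - 1) * W" using W_pos by (simp add: length_concat_replicate)
  consider "t = 0" | "0 < t" "t < T" | "t = T" using t by linarith
  then show ?thesis
  proof cases
    case 1
    then show ?thesis using c by (simp add: kinds_def nth_append length_row0) (simp add: row0_def)
  next
    case 2
    then obtain t' where t': "t = Suc t'" by (cases t) auto
    have "Suc t' * W \<le> (T - 1) * W" using 2 t' by (intro mult_le_mono1) simp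
    then have lt: "t' * W + c < (T - 1) * W" using c by simp
    have "ks ! (t * W + c) = (?mid @ (Sep # replicate (W - 1) Acc)) ! (t' * W + c)"
      unfolding kinds_def t' by (simp add: nth_append length_row0 add.assoc)
    also have "\<dots> = ?mid ! (t' * W + c)" using lt lm by (simp add: nth_append)
    also have "\<dots> = (Sep # replicate (W - 1) Mid) ! ((t' * W + c) mod W)"
      using nth_concat_replicate[of "t' * W + c" "T - 1" "Sep # replicate (W - 1) Mid"] lt W_pos by simp
    also have "(t' * W + c) mod W = c" using c by simp
    finally show ?thesis using c 2 by (simp add: nth_Cons split: nat.split)
  next
    case 3
    obtain t' where t': "T = Suc t'" using T by (cases T) auto
    have "ks ! (t * W + c) = (?mid @ (Sep # replicate (W - 1) Acc)) ! (t' * W + c)"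
      unfolding kinds_def 3 by (simp add: nth_append length_row0 t' add.assoc)
    also have "\<dots> = (Sep # replicate (W - 1) Acc) ! c"
      using lm t' by (simp add: nth_append)
    finally show ?thesis using c 3 T by (simp add: nth_Cons split: nat.split)
  qed
qed

lemma nth_row0:
  "0 < c \<Longrightarrow> c \<le> T \<Longrightarrow> row0 x P T ! c = Lft"
  "i < length x \<Longrightarrow> row0 x P T ! (T + 1 + i) = Inp (bits x ! i)"
  "row0 x P T ! (T + 1 + length x) = Inp 3"
  "i < P \<Longrightarrow> row0 x P T ! (T + 2 + length x + i) = Wit"
  "i < T \<Longrightarrow> row0 x P T ! (T + 2 + length x + P + i) = Blk"
  by (cases c; simp add: row0_def nth_append bits_def)
    (simp_all add: row0_def nth_append bits_def)

lemma row0_not_Sep: "0 < c \<Longrightarrow> c < W \<Longrightarrow> row0 x P T ! c \<noteq> Sep"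
proof -
  assume c: "0 < c" "c < W"
  let ?r = "replicate T Lft @ map Inp (bits x) @ [Inp 3] @ replicate P Wit @ replicate T Blk"
  have "length (Sep # ?r) = W" using length_row0[of x P T] by (simp only: row0_def)
  then have "?r ! (c - 1) \<in> set ?r" using c by (intro nth_mem) simp
  moreover have "Sep \<notin> set ?r" by auto
  moreover have "row0 x P T ! c = ?r ! (c - 1)" using c by (simp add: row0_def)
  ultimately show ?thesis by metis
qed

lemma index_less: "t \<le> T \<Longrightarrow> c < W \<Longrightarrow> t * W + c < length ks"
proof -
  assume "t \<le> T" "c < W"
  then have "t * W \<le> T * W" by (intro mult_le_mono1)
  moreover have "(T + 1) * W = T * W + W" by simp
  ultimately show ?thesis using \<open>c < W\<close> length_kinds by linarith
qed

end

locale turing =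
  fixes M :: turing_machine
  assumes wf: "wf_turing_machine M"
begin

definition cells :: "cell set" where
  "cells = {(q, ss, ts, e). q < nstates M \<and> length ss = ntapes M \<and> set ss \<subseteq> {..<nsyms M} \<and>
     length ts = ntapes M \<and> fst ` set ts \<subseteq> {..<nsyms M}}"

text \<open>The scanned symbols are guessed by each row and checked wherever a head is
  \<open>Here\<close>. In row 0 the head position is prescribed only by \<open>Before\<close> on the
  left margin and not \<open>Before\<close> from cell 0 on; adjacency does the rest.\<close>

fun ok_kind :: "kind \<Rightarrow> cell option \<Rightarrow> bool" where
  "ok_kind \<kappa> None \<longleftrightarrow> \<kappa> = Sep"
| "ok_kind \<kappa> (Some (q, ss, ts, e)) \<longleftrightarrow> \<kappa> \<noteq> Sep \<and>
     (\<forall>j < ntapes M. snd (ts ! j) = Here \<longrightarrow> fst (ts ! j) = ss ! j) \<and>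
     (case \<kappa> of Sep \<Rightarrow> False | Mid \<Rightarrow> True | Acc \<Rightarrow> q = 1
      | Lft \<Rightarrow> q = 0 \<and> (\<forall>j < ntapes M. ts ! j = (0, Before))
      | Inp a \<Rightarrow> q = 0 \<and> (\<forall>j < ntapes M. fst (ts ! j) = (if j = 0 then a else 0) \<and> snd (ts ! j) \<noteq> Before)
      | Wit \<Rightarrow> q = 0 \<and> (\<forall>j < ntapes M. (if j = 0 \<and> \<not> e then fst (ts ! j) \<in> {1, 2} else fst (ts ! j) = 0) \<and>
          snd (ts ! j) \<noteq> Before)
      | Blk \<Rightarrow> q = 0 \<and> (\<forall>j < ntapes M. fst (ts ! j) = 0 \<and> snd (ts ! j) \<noteq> Before))"

fun ok_right :: "cell option \<Rightarrow> cell option \<Rightarrow> bool" where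
  "ok_right (Some (q, ss, ts, e)) (Some (q', ss', ts', e')) \<longleftrightarrow>
     q = q' \<and> ss = ss' \<and> (e \<longrightarrow> e') \<and> (\<forall>j < ntapes M. hnext (snd (ts ! j)) (snd (ts' ! j)))"
| "ok_right _ _ \<longleftrightarrow> True"

text \<open>Halting becomes an explicit idle transition, so the vertical condition is uniform and
  early acceptance persists up to row \<open>T\<close>.\<close>

definition trans :: "nat \<Rightarrow> nat list \<Rightarrow> nat \<times> (nat \<times> move) list" where
  "trans q ss = (if q \<in> {1, 2} then (q, map (\<lambda>a. (a, Stay)) ss) else delta M q ss)"

fun ok_up :: "cell option \<Rightarrow> cell option \<Rightarrow> bool" where
  "ok_up (Some (q, ss, ts, e)) (Some (q', ss', ts', e')) \<longleftrightarrow>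
     q' = fst (trans q ss) \<and>
     (\<forall>j < ntapes M. fst (ts' ! j) = (if snd (ts ! j) = Here then fst (snd (trans q ss) ! j) else fst (ts ! j)) \<and>
        hmove (snd (snd (trans q ss) ! j)) (snd (ts ! j)) (snd (ts' ! j)))"
| "ok_up _ _ \<longleftrightarrow> True"

definition wf_config :: "config \<Rightarrow> bool" where
  "wf_config C \<longleftrightarrow> fst C < nstates M \<and> length (snd C) = ntapes M \<and>
     (\<forall>j < ntapes M. \<forall>z. fst (snd C ! j) z < nsyms M)"

definition scanned :: "config \<Rightarrow> nat list" where
  "scanned C = map (\<lambda>(t, h). t h) (snd C)"

definition column :: "config \<Rightarrow> int \<Rightarrow> (nat \<times> side) list" where
  "column C z = map (\<lambda>(t, h). (t z, side_of z h)) (snd C)"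

lemma ntapes_pos: "0 < ntapes M"
  using wf by (simp add: wf_turing_machine_def)

lemma length_scanned: "wf_config C \<Longrightarrow> length (scanned C) = ntapes M"
  by (simp add: scanned_def wf_config_def)

lemma length_column: "wf_config C \<Longrightarrow> length (column C z) = ntapes M"
  by (simp add: column_def wf_config_def)

lemma nth_scanned: "wf_config C \<Longrightarrow> j < ntapes M \<Longrightarrow> scanned C ! j = fst (snd C ! j) (snd (snd C ! j))"
  by (simp add: scanned_def wf_config_def split_beta)

lemma nth_column: "wf_config C \<Longrightarrow> j < ntapes M \<Longrightarrow>
    column C z ! j = (fst (snd C ! j) z, side_of z (snd (snd C ! j)))"
  by (simp add: column_def wf_config_def split_beta)

lemma wf_trans:
  assumes "wf_config C"
  shows "fst (trans (fst C) (scanned C)) < nstates M"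
    and "length (snd (trans (fst C) (scanned C))) = ntapes M"
    and "j < ntapes M \<Longrightarrow> fst (snd (trans (fst C) (scanned C)) ! j) < nsyms M"
proof -
  have s: "length (scanned C) = ntapes M" "set (scanned C) \<subseteq> {..<nsyms M}"
    using assms length_scanned[OF assms] nth_scanned[OF assms]
    by (auto simp: in_set_conv_nth wf_config_def)
  have q: "fst C < nstates M" using assms by (simp add: wf_config_def)
  have d: "fst (delta M (fst C) (scanned C)) < nstates M"
    "length (snd (delta M (fst C) (scanned C))) = ntapes M"
    "fst ` set (snd (delta M (fst C) (scanned C))) \<subseteq> {..<nsyms M}"
    using wf q s unfolding wf_turing_machine_def by blast+
  show "fst (trans (fst C) (scanned C)) < nstates M"
    "length (snd (trans (fst C) (scanned C))) = ntapes M"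
    using q s(1) d by (simp_all add: trans_def)
  show "fst (snd (trans (fst C) (scanned C)) ! j) < nsyms M" if "j < ntapes M"
    using that s d(2,3) nth_mem[of j "scanned C"] nth_mem[of j "snd (delta M (fst C) (scanned C))"]
    by (auto simp: trans_def subset_iff)
qed

lemma step_eq:
  assumes C: "wf_config C"
  shows "fst (step M C) = fst (trans (fst C) (scanned C))"
    and "length (snd (step M C)) = ntapes M"
    and "j < ntapes M \<Longrightarrow> snd (step M C) ! j =
      ((fst (snd C ! j))(snd (snd C ! j) := fst (snd (trans (fst C) (scanned C)) ! j)),
       snd (snd C ! j) + offset (snd (snd (trans (fst C) (scanned C)) ! j)))"
proof -
  have len: "length (snd C) = ntapes M" using C by (simp add: wf_config_def)
  have act: "act p a = ((fst p)(snd p := fst a), snd p + offset (snd a))" for p a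
    by (cases p; cases a) simp
  have halt: "step M C = C" if "fst C \<in> {1, 2}" using that by (simp add: step_def)
  have run: "step M C = (fst (trans (fst C) (scanned C)), map2 act (snd C) (snd (trans (fst C) (scanned C))))"
    if "fst C \<notin> {1, 2}"
    using that by (simp add: step_def trans_def scanned_def Let_def split_beta)
  show "fst (step M C) = fst (trans (fst C) (scanned C))"
    by (cases "fst C \<in> {1, 2}") (simp_all add: halt run, simp add: trans_def)
  show "length (snd (step M C)) = ntapes M"
    by (cases "fst C \<in> {1, 2}") (simp_all add: halt run len wf_trans(2)[OF C])
  show "snd (step M C) ! j =
      ((fst (snd C ! j))(snd (snd C ! j) := fst (snd (trans (fst C) (scanned C)) ! j)),
       snd (snd C ! j) + offset (snd (snd (trans (fst C) (scanned C)) ! j)))" if j: "j < ntapes M"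
  proof (cases "fst C \<in> {1, 2}")
    case True
    then have "snd (trans (fst C) (scanned C)) ! j = (scanned C ! j, Stay)"
      using j length_scanned[OF C] by (simp add: trans_def)
    then show ?thesis using halt[OF True] nth_scanned[OF C j] by simp
  next
    case False
    then show ?thesis using run[OF False] j len wf_trans(2)[OF C] by (simp add: act)
  qed
qed

lemma wf_step: "wf_config C \<Longrightarrow> wf_config (step M C)"
  using step_eq[of C] wf_trans[of C] by (simp add: wf_config_def)

lemma ok_self_column:
  "wf_config C \<Longrightarrow> j < ntapes M \<Longrightarrow> snd (column C z ! j) = Here \<Longrightarrow> fst (column C z ! j) = scanned C ! j"
  by (auto simp: nth_column nth_scanned side_of_def split: if_splits)

lemma ok_right_column:
  "wf_config C \<Longrightarrow> (e \<Longrightarrow> e') \<Longrightarrow>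
   ok_right (Some (fst C, scanned C, column C z, e)) (Some (fst C, scanned C, column C (z + 1), e'))"
  by (auto simp: nth_column hnext_side_of)

lemma ok_up_column:
  assumes C: "wf_config C"
  shows "ok_up (Some (fst C, scanned C, column C z, e))
    (Some (fst (step M C), scanned (step M C), column (step M C) z, e'))"
  using step_eq[OF C] nth_column[OF C] nth_column[OF wf_step[OF C]]
  by (auto simp: hmove_side_of)

lemma column_in_cells:
  assumes C: "wf_config C"
  shows "(fst C, scanned C, column C z, e) \<in> cells"
proof -
  have "scanned C ! j < nsyms M \<and> fst (column C z ! j) < nsyms M" if "j < ntapes M" for j
    using C that by (simp add: nth_scanned nth_column wf_config_def)
  then show ?thesis
    using C length_scanned[OF C] length_column[OF C]
    unfolding cells_def wf_config_def by (fastforce simp: in_set_conv_nth)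
qed

text \<open>\<open>ok_up\<close> fixes the state and the contents, and \<open>hmove_unique\<close>
  the heads. The new scanned symbols are constant along the row by \<open>ok_right\<close>, and the
  cell under each head pins down its entry; the heads start strictly inside the window so that they
  are still in it after the step.\<close>

lemma row_determined:
  fixes R R' :: "int \<Rightarrow> cell"
  assumes C: "wf_config C"
    and R: "\<And>z. a \<le> z \<Longrightarrow> z \<le> b \<Longrightarrow> \<exists>e. R z = (fst C, scanned C, column C z, e)"
    and heads: "\<And>j. j < ntapes M \<Longrightarrow> a < snd (snd C ! j) \<and> snd (snd C ! j) < b"
    and R'_len: "\<And>z. a \<le> z \<Longrightarrow> z \<le> b \<Longrightarrow> R' z \<in> cells"
    and up: "\<And>z. a \<le> z \<Longrightarrow> z \<le> b \<Longrightarrow> ok_up (Some (R z)) (Some (R' z))"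
    and right: "\<And>z. a \<le> z \<Longrightarrow> z < b \<Longrightarrow> ok_right (Some (R' z)) (Some (R' (z + 1)))"
    and self: "\<And>z. a \<le> z \<Longrightarrow> z \<le> b \<Longrightarrow> \<exists>\<kappa>. ok_kind \<kappa> (Some (R' z))"
    and z: "a \<le> z" "z \<le> b"
  shows "\<exists>e. R' z = (fst (step M C), scanned (step M C), column (step M C) z, e)"
proof -
  let ?C' = "step M C"
  have C': "wf_config ?C'" by (rule wf_step[OF C])
  define q where "q = (\<lambda>z. fst (R' z))"
  define ss where "ss = (\<lambda>z. fst (snd (R' z)))"
  define ts where "ts = (\<lambda>z. fst (snd (snd (R' z))))"
  define e where "e = (\<lambda>z. snd (snd (snd (R' z))))"
  have R': "R' z = (q z, ss z, ts z, e z)" for z by (simp add: q_def ss_def ts_def e_def)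
  have up': "q z = fst ?C' \<and> (\<forall>j < ntapes M. fst (ts z ! j) = fst (column ?C' z ! j) \<and>
      hmove (snd (snd (trans (fst C) (scanned C)) ! j)) (side_of z (snd (snd C ! j))) (snd (ts z ! j)))"
    if z: "a \<le> z" "z \<le> b" for z
  proof -
    obtain e where "R z = (fst C, scanned C, column C z, e)" using R[OF z] by blast
    then show ?thesis
      using up[OF z] step_eq[OF C] nth_column[OF C] nth_column[OF C']
      by (auto simp: R' side_of_def split: if_splits)
  qed
  have ts: "ts z = column ?C' z" if z: "a \<le> z" "z \<le> b" for z
  proof (rule nth_equalityI)
    show "length (ts z) = length (column ?C' z)"
      using R'_len[OF z] length_column[OF C'] by (simp add: cells_def R')
    fix j assume "j < length (ts z)"
    then have j: "j < ntapes M" using R'_len[OF z] by (simp add: cells_def R')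
    have "snd (ts z ! j) = side_of z (snd (snd C ! j) + offset (snd (snd (trans (fst C) (scanned C)) ! j)))"
    proof (rule hmove_unique[where f = "\<lambda>z. snd (ts z ! j)" and a = a and b = b])
      show "hmove (snd (snd (trans (fst C) (scanned C)) ! j)) (side_of z (snd (snd C ! j))) (snd (ts z ! j))"
        if "a \<le> z" "z \<le> b" for z using up'[OF that] j by blast
      show "hnext (snd (ts z ! j)) (snd (ts (z + 1) ! j))" if "a \<le> z" "z < b" for z
        using right[OF that] j by (simp add: R')
      show "a \<le> snd (snd C ! j)" "snd (snd C ! j) \<le> b" using heads[OF j] by simp_all
    qed (use z in simp_all)
    then show "ts z ! j = column ?C' z ! j"
      using up'[OF z] j nth_column[OF C' j] step_eq(3)[OF C j] by (intro prod_eqI) simp_all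
  qed
  have ss: "ss z = ss (z + 1)" if "a \<le> z" "z < b" for z
    using right[OF that] by (simp add: R')
  have ss_a: "ss (a + int n) = ss a" if "a + int n \<le> b" for n
    using that
  proof (induction n)
    case (Suc n)
    then show ?case using ss[of "a + int n"] by (simp add: algebra_simps)
  qed simp
  have ss_const: "ss z = ss z'" if "a \<le> z" "z \<le> b" "a \<le> z'" "z' \<le> b" for z z'
    using ss_a[of "nat (z - a)"] ss_a[of "nat (z' - a)"] that by simp
  have "ss z = scanned ?C'"
  proof (rule nth_equalityI)
    show "length (ss z) = length (scanned ?C')"
      using R'_len[OF z] length_scanned[OF C'] by (simp add: cells_def R')
    fix j assume "j < length (ss z)"
    then have j: "j < ntapes M" using R'_len[OF z] by (simp add: cells_def R')
    let ?h = "snd (snd ?C' ! j)"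
    have h: "a \<le> ?h" "?h \<le> b"
      using heads[OF j] step_eq(3)[OF C j]
      by (cases "snd (snd (trans (fst C) (scanned C)) ! j)"; simp)+
    have c: "ts ?h ! j = (fst (snd ?C' ! j) ?h, Here)"
      unfolding ts[OF h] by (simp add: nth_column[OF C' j] side_of_def)
    obtain \<kappa> where "ok_kind \<kappa> (Some (R' ?h))" using self[OF h] by blast
    then have "snd (ts ?h ! j) = Here \<longrightarrow> fst (ts ?h ! j) = ss ?h ! j"
      using j unfolding R' ok_kind.simps by blast
    then have "fst (ts ?h ! j) = ss ?h ! j" using c by simp
    then show "ss z ! j = scanned ?C' ! j"
      using c ss_const[OF z h] nth_scanned[OF C' j] by simp
  qed
  then have "R' z = (fst ?C', scanned ?C', column ?C' z, e z)" using ts[OF z] up'[OF z] R'[of z] by simp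
  then show ?thesis by blast
qed

text \<open>The grid is a single list, so right adjacency also links the end of a row to the start
  of the next one; the separator \<open>None\<close> there makes this link vacuous.\<close>

definition tiling :: "kind list \<Rightarrow> nat \<Rightarrow> (nat \<Rightarrow> cell option) \<Rightarrow> bool" where
  "tiling ks W \<tau> \<longleftrightarrow>
     (\<forall>i < length ks. \<tau> i \<in> insert None (Some ` cells) \<and> ok_kind (ks ! i) (\<tau> i)) \<and>
     (\<forall>i. i + 1 < length ks \<longrightarrow> ok_right (\<tau> i) (\<tau> (i + 1))) \<and>
     (\<forall>i. i + W < length ks \<longrightarrow> ok_up (\<tau> i) (\<tau> (i + W)))"

end

section \<open>Accepting runs and tilings determine each other\<close>

locale turing_layout = turing + layout
begin

definition conf_at :: "bool list \<Rightarrow> nat \<Rightarrow> config" where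
  "conf_at w t = run M t (bits x @ 3 # bits w)"

lemma conf_at_Suc: "conf_at w (Suc t) = step M (conf_at w t)"
  by (simp add: conf_at_def run_def)

lemma conf_at_0: "fst (conf_at w 0) = 0" "j < ntapes M \<Longrightarrow>
    snd (conf_at w 0) ! j = (tape_of (if j = 0 then bits x @ 3 # bits w else []), 0)"
  by (cases j; simp add: conf_at_def run_def init_config_def)+

lemma wf_conf_at: "wf_config (conf_at w t)"
proof (induction t)
  case 0
  have syms: "4 \<le> nsyms M" "3 \<le> nstates M" using wf by (auto simp: wf_turing_machine_def)
  have "(bits x @ 3 # bits w) ! i < nsyms M" if "i < length (bits x @ 3 # bits w)" for i
  proof -
    have "set (bits x @ 3 # bits w) \<subseteq> {..<4}" by (auto simp: bits_def)
    then show ?thesis using nth_mem[OF that] syms by fastforce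
  qed
  then have "tape_of (if j = 0 then bits x @ 3 # bits w else []) z < nsyms M" for j :: nat and z
    using syms by (simp add: tape_of_def)
  moreover have "length (snd (conf_at w 0)) = ntapes M"
    using ntapes_pos by (simp add: conf_at_def run_def init_config_def)
  ultimately show ?case using conf_at_0 syms unfolding wf_config_def by simp
next
  case (Suc t)
  then show ?case by (simp add: conf_at_Suc wf_step)
qed

lemma heads_conf_at: "j < ntapes M \<Longrightarrow> \<bar>snd (snd (conf_at w t) ! j)\<bar> \<le> int t"
proof (induction t)
  case 0
  then show ?case using conf_at_0 by simp
next
  case (Suc t)
  have "\<bar>offset d\<bar> \<le> 1" for d by (cases d) auto
  from this[of "snd (snd (trans (fst (conf_at w t)) (scanned (conf_at w t))) ! j)"]
  show ?case using Suc step_eq(3)[OF wf_conf_at Suc.prems, of w t] unfolding conf_at_Suc by simp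
qed

lemma tape_of_witness:
  "tape_of (bits x @ 3 # bits w) z =
    (if z < 0 then 0 else if z < int (length x) then bits x ! nat z else if z = int (length x) then 3
     else if z \<le> int (length x + length w) then (if w ! nat (z - 1 - int (length x)) then 2 else 1) else 0)"
proof -
  have *: "nat (z - 1 - int (length x)) = nat z - Suc (length x)" by simp
  consider "z < 0" | "0 \<le> z" "z < int (length x)" | "z = int (length x)"
    | "int (length x) < z" "z \<le> int (length x + length w)" | "int (length x + length w) < z" by linarith
  then show ?thesis
    by cases (auto simp: tape_of_def nth_append bits_def nth_Cons' *)
qed

lemma tiling_of_run:
  assumes w: "length w \<le> P" and acc: "fst (conf_at w T) = 1"
  shows "\<exists>\<tau>. tiling ks W \<tau>"
proof -
  let ?C = "conf_at w"
  \<comment> \<open>Column 0 is the separator and column 1 shows tape cell \<open>- T\<close>, so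
    tape cell 0 is in column \<open>T + 1\<close>.\<close>
  define z where "z = (\<lambda>c. int c - int (T + 1))"
  define f where "f = (\<lambda>t c. if c = 0 then None
    else Some (fst (?C t), scanned (?C t), column (?C t) (z c), int (length x + length w) < z c))"
  define \<tau> where "\<tau> = (\<lambda>i. f (i div W) (i mod W))"
  have \<tau>: "\<tau> (t * W + c) = f t c" if "c < W" for t c
    using that W_pos by (simp add: \<tau>_def)
  have split: "\<exists>t \<le> T. \<exists>c < W. i = t * W + c" if "i < length ks" for i
  proof (intro exI conjI)
    show "i div W \<le> T" using that unfolding length_kinds by (simp add: less_mult_imp_div_less flip: less_Suc_eq_le)
    show "i mod W < W" using W_pos by simp
  qed simp
  have kind: "ok_kind (ks ! (t * W + c)) (f t c)" if t: "t \<le> T" and c: "c < W" for t c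
  proof (cases "c = 0")
    case True
    then show ?thesis using nth_kinds[OF t c] by (simp add: f_def)
  next
    case c0: False
    have self: "\<forall>j < ntapes M. snd (column (?C t) (z c) ! j) = Here \<longrightarrow> fst (column (?C t) (z c) ! j) = scanned (?C t) ! j"
      using ok_self_column[OF wf_conf_at] by blast
    show ?thesis
    proof (cases "t = 0")
      case False
      then show ?thesis
        using nth_kinds[OF t c] c0 self acc t by (auto simp: f_def)
    next
      case True
      have col: "column (?C 0) (z c) ! j =
          (if j = 0 then tape_of (bits x @ 3 # bits w) (z c) else 0, side_of (z c) 0)" if "j < ntapes M" for j
        using that nth_column[OF wf_conf_at that, of w 0 "z c"] conf_at_0(2)[OF that, of w]
        by (simp add: tape_of_def)
      have n: "(T * 2 + length x + P + 2) = W" by (simp add: width_def)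
      consider "c \<le> T" | i where "c = T + 1 + i" "i < length x" | "c = T + 1 + length x"
        | i where "c = T + 2 + length x + i" "i < P" | i where "c = T + 2 + length x + P + i" "i < T"
      proof -
        have "c \<le> T \<or> (\<exists>i < length x. c = T + 1 + i) \<or> c = T + 1 + length x \<or>
            (\<exists>i < P. c = T + 2 + length x + i) \<or> (\<exists>i < T. c = T + 2 + length x + P + i)"
          using c unfolding width_def by presburger
        then show ?thesis using that by blast
      qed
      then have "ok_kind (row0 x P T ! c) (f 0 c)"
      proof cases
        case 1
        then show ?thesis
          using nth_row0(1) c0 self True conf_at_0(1) col
          by (auto simp: f_def tape_of_def z_def side_of_def)
      next
        case 2
        then show ?thesis
          using nth_row0(2)[OF 2(2)] self True conf_at_0(1) col
          by (auto simp: f_def tape_of_witness z_def side_of_def)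
      next
        case 3
        have "\<forall>j < ntapes M. fst (column (?C 0) (z c) ! j) = (if j = 0 then 3 else 0) \<and>
            snd (column (?C 0) (z c) ! j) \<noteq> Before"
          using col 3 by (auto simp: tape_of_witness z_def side_of_def)
        then show ?thesis
          using nth_row0(3) self True conf_at_0(1) 3 c0 by (simp add: f_def)
      next
        case 4
        then show ?thesis
          using nth_row0(4)[OF 4(2)] self True conf_at_0(1) col
          by (auto simp: f_def tape_of_witness z_def side_of_def)
      next
        case 5
        then show ?thesis
          using nth_row0(5)[OF 5(2)] self True conf_at_0(1) col w
          by (auto simp: f_def tape_of_witness z_def side_of_def)
      qed
      then show ?thesis using nth_kinds[OF t c] c0 True by simp
    qed
  qed
  have "tiling ks W \<tau>"
    unfolding tiling_def
  proof (intro conjI allI impI)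
    fix i assume "i < length ks"
    then obtain t c where tc: "t \<le> T" "c < W" "i = t * W + c" using split by blast
    then show "ok_kind (ks ! i) (\<tau> i)" using kind \<tau> by simp
    show "\<tau> i \<in> insert None (Some ` cells)"
      using column_in_cells[OF wf_conf_at] tc \<tau> by (simp add: f_def)
  next
    fix i assume i: "i + 1 < length ks"
    then obtain t c where tc: "t \<le> T" "c < W" "i = t * W + c" using split[of i] by auto
    show "ok_right (\<tau> i) (\<tau> (i + 1))"
    proof (cases "c + 1 < W")
      case True
      then have "\<tau> i = f t c" "\<tau> (i + 1) = f t (c + 1)" using tc \<tau>[of c t] \<tau>[of "c + 1" t] by simp_all
      moreover have "z (c + 1) = z c + 1" by (simp add: z_def)
      ultimately show ?thesis
        using ok_right_column[OF wf_conf_at] by (auto simp: f_def)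
    next
      case False
      then have "i + 1 = Suc t * W + 0" using tc by simp
      then have "\<tau> (i + 1) = None" using \<tau>[of 0 "Suc t"] W_pos by (simp add: f_def)
      then show ?thesis by (cases "\<tau> i") auto
    qed
  next
    fix i assume i: "i + W < length ks"
    then obtain t c where tc: "t \<le> T" "c < W" "i = t * W + c" using split[of i] by auto
    then have "\<tau> i = f t c" "\<tau> (i + W) = f (Suc t) c"
      using \<tau>[of c t] \<tau>[of c "Suc t"] by (simp_all add: algebra_simps)
    then show "ok_up (\<tau> i) (\<tau> (i + W))"
      using ok_up_column[OF wf_conf_at] by (auto simp: f_def conf_at_Suc)
  qed
  then show ?thesis by blast
qed

text \<open>Row 0 determines a witness, and by induction on the rows the tiling can only display the
  run on it.\<close>

lemma run_of_tiling:
  assumes til: "tiling ks W \<tau>"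
  shows "\<exists>w. length w \<le> P \<and> fst (conf_at w T) = 1"
proof -
  have kind: "ok_kind (ks ! (t * W + c)) (\<tau> (t * W + c))"
    and cell: "\<tau> (t * W + c) \<in> insert None (Some ` cells)" if "t \<le> T" "c < W" for t c
    using til index_less[OF that] unfolding tiling_def by blast+
  define R where "R = (\<lambda>t z. the (\<tau> (t * W + nat (z + int (T + 1)))))"
  define b where "b = int (T + length x + P)"
  have \<tau>: "\<tau> (t * W + c) = Some (R t (int c - int (T + 1)))" if "t \<le> T" "0 < c" "c < W" for t c
  proof -
    have "\<tau> (t * W + c) \<noteq> None" using kind[of t c] nth_kinds[of t c] row0_not_Sep[of c] that
      by (cases "\<tau> (t * W + c)") (auto split: if_splits)
    then show ?thesis by (auto simp: R_def)
  qed
  have z: "\<exists>c. 0 < c \<and> c < W \<and> z = int c - int (T + 1)" if "- int T \<le> z" "z \<le> b" for z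
    using that by (intro exI[of _ "nat (z + int (T + 1))"]) (auto simp: b_def width_def)
  have R_cells: "R t z \<in> cells" if "t \<le> T" "- int T \<le> z" "z \<le> b" for t z
  proof -
    obtain c where c: "0 < c" "c < W" "z = int c - int (T + 1)" using z \<open>- int T \<le> z\<close> \<open>z \<le> b\<close> by blast
    then show ?thesis using cell[OF that(1) c(2)] \<tau>[OF that(1) c(1,2)] by auto
  qed
  have R_kind: "ok_kind (ks ! (t * W + nat (z + int (T + 1)))) (Some (R t z))"
    if "t \<le> T" "- int T \<le> z" "z \<le> b" for t z
  proof -
    obtain c where c: "0 < c" "c < W" "z = int c - int (T + 1)" using z \<open>- int T \<le> z\<close> \<open>z \<le> b\<close> by blast
    then show ?thesis using kind[OF that(1) c(2)] \<tau>[OF that(1) c(1,2)] by simp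
  qed
  have R_right: "ok_right (Some (R t z)) (Some (R t (z + 1)))" if "t \<le> T" "- int T \<le> z" "z < b" for t z
  proof -
    have "z \<le> b" using that by simp
    from z[OF that(2) this] obtain c where c: "0 < c" "c < W" "z = int c - int (T + 1)" by blast
    have c': "c + 1 < W" using c that by (simp add: b_def width_def)
    have "t * W + c + 1 < length ks" using index_less[OF that(1) c'] by (simp add: add.assoc)
    then have "ok_right (\<tau> (t * W + c)) (\<tau> (t * W + c + 1))" using til unfolding tiling_def by blast
    then show ?thesis using \<tau>[OF that(1) c(1,2)] \<tau>[OF that(1) _ c'] c by (simp add: add.assoc)
  qed
  have R_up: "ok_up (Some (R t z)) (Some (R (Suc t) z))" if "t < T" "- int T \<le> z" "z \<le> b" for t z
  proof -
    have "z \<le> b" using that by simp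
    from z[OF that(2) this] obtain c where c: "0 < c" "c < W" "z = int c - int (T + 1)" by blast
    have "t * W + c + W = Suc t * W + c" by simp
    moreover have "Suc t * W + c < length ks" using index_less[of "Suc t" c] that c by simp
    ultimately have "ok_up (\<tau> (t * W + c)) (\<tau> (Suc t * W + c))"
      using til unfolding tiling_def by metis
    then show ?thesis using \<tau>[of t c] \<tau>[of "Suc t" c] that c by simp
  qed

  have row0: "ok_kind Lft (Some (R 0 z))" if "- int T \<le> z" "z < 0" for z
    using R_kind[of 0 z] nth_kinds[of 0 "nat (z + int (T + 1))"] nth_row0(1)[of "nat (z + int (T + 1))"] that
    by (simp add: b_def width_def nat_less_iff del: ok_kind.simps)
  have row0': "ok_kind (row0 x P T ! (T + 1 + i)) (Some (R 0 (int i)))" if "i \<le> T + length x + P" for i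
    using R_kind[of 0 "int i"] nth_kinds[of 0 "T + 1 + i"] that
    by (simp add: b_def width_def nat_add_distrib del: ok_kind.simps) (simp add: add_ac)

  define fl where "fl = (\<lambda>i. snd (snd (snd (R 0 (int (length x + 1 + i))))))"
  define sy where "sy = (\<lambda>z. fst (fst (snd (snd (R 0 z))) ! 0))"
  \<comment> \<open>The witness ends at the first flagged column. Flags are monotone along the row,
    so all later witness columns are blank.\<close>
  define l where "l = length (takeWhile (\<lambda>i. \<not> fl i) [0..<P])"
  define w where "w = map (\<lambda>i. sy (int (length x + 1 + i)) = 2) [0..<l]"
  have l: "l \<le> P" unfolding l_def using length_takeWhile_le[of _ "[0..<P]"] by simp
  have lw: "length w = l" by (simp add: w_def)
  have fl_mono: "fl i \<Longrightarrow> fl (Suc i)" if "Suc i < P" for i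
    using R_right[of 0 "int (length x + 1 + i)"] that
    by (cases "R 0 (int (length x + 1 + i))"; cases "R 0 (int (length x + 1 + Suc i))")
      (auto simp: fl_def b_def add_ac)
  have fl_less: "\<not> fl i" if "i < l" for i
  proof -
    have "takeWhile (\<lambda>i. \<not> fl i) [0..<P] ! i \<in> set (takeWhile (\<lambda>i. \<not> fl i) [0..<P])"
      using that by (simp add: l_def)
    then have "\<not> fl (takeWhile (\<lambda>i. \<not> fl i) [0..<P] ! i)" by (auto dest: set_takeWhileD)
    then show ?thesis using that l takeWhile_nth[of i "\<lambda>i. \<not> fl i" "[0..<P]"] by (simp add: l_def)
  qed
  have fl_ge: "fl i" if "l \<le> i" "i < P" for i
    using that
  proof (induction i rule: dec_induct)
    case base
    then show ?case using nth_length_takeWhile[of "\<lambda>i. \<not> fl i" "[0..<P]"] by (simp add: l_def)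
  next
    case (step i)
    then show ?case using fl_mono[of i] by simp
  qed

  let ?C = "conf_at w"
  have "\<exists>e. R t z = (fst (?C t), scanned (?C t), column (?C t) z, e)"
    if "t \<le> T" "- int T \<le> z" "z \<le> b" for t z
    using that
  proof (induction t arbitrary: z)
    case 0
    define q where "q = (\<lambda>z. fst (R 0 z))"
    define ss where "ss = (\<lambda>z. fst (snd (R 0 z)))"
    define ts where "ts = (\<lambda>z. fst (snd (snd (R 0 z))))"
    define e where "e = (\<lambda>z. snd (snd (snd (R 0 z))))"
    have R: "R 0 z = (q z, ss z, ts z, e z)" for z by (simp add: q_def ss_def ts_def e_def)
    have neg: "q z = 0 \<and> (\<forall>j < ntapes M. ts z ! j = (0, Before))" if "- int T \<le> z" "z < 0" for z
      using row0[OF that] by (simp add: R)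
    have nonneg: "q (int i) = 0 \<and> (\<forall>j < ntapes M. snd (ts (int i) ! j) \<noteq> Before \<and>
        fst (ts (int i) ! j) = (if j = 0 then tape_of (bits x @ 3 # bits w) (int i) else 0))"
      if i: "i \<le> T + length x + P" for i
    proof -
      consider "i < length x" | "i = length x" | i' where "i = length x + 1 + i'" "i' < P"
        | i' where "i = length x + 1 + P + i'" "i' < T"
      proof -
        have "i < length x \<or> i = length x \<or> (\<exists>i' < P. i = length x + 1 + i') \<or>
            (\<exists>i' < T. i = length x + 1 + P + i')"
          using i by presburger
        then show ?thesis using that by blast
      qed
      then show ?thesis
      proof cases
        case 1
        then show ?thesis using row0'[OF i] nth_row0(2)[OF 1] by (auto simp: R tape_of_witness)
      next
        case 2
        then show ?thesis using row0'[OF i] nth_row0(3) by (auto simp: R tape_of_witness)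
      next
        case 3
        have r: "row0 x P T ! (T + 1 + i) = Wit" using nth_row0(4)[OF 3(2)] 3(1) by (simp add: add_ac)
        have f: "e (int i) = fl i'" "fst (ts (int i) ! 0) = sy (int i)"
          using 3(1) by (simp_all add: e_def fl_def ts_def sy_def add_ac)
        have "sy (int i) = tape_of (bits x @ 3 # bits w) (int i)"
        proof (cases "i' < l")
          case True
          then have "w ! i' \<longleftrightarrow> sy (int i) = 2" using 3(1) by (simp add: w_def add_ac)
          moreover have "sy (int i) \<in> {1, 2}"
            using row0'[OF i] r fl_less[OF True] f ntapes_pos by (auto simp: R)
          moreover have "nat (int i - 1 - int (length x)) = i'" using 3(1) by simp
          ultimately show ?thesis using True 3(1) lw by (auto simp: tape_of_witness)
        next
          case False
          then have "sy (int i) = 0"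
            using row0'[OF i] r fl_ge[of i'] 3(2) f ntapes_pos by (auto simp: R)
          then show ?thesis using False 3(1) lw by (simp add: tape_of_witness)
        qed
        then show ?thesis using row0'[OF i] r f by (auto simp: R)
      next
        case 4
        have r: "row0 x P T ! (T + 1 + i) = Blk" using nth_row0(5)[OF 4(2)] 4(1) by (simp add: add_ac)
        then show ?thesis using row0'[OF i] l 4(1) lw by (auto simp: R tape_of_witness)
      qed
    qed
    have nxt: "hnext (snd (ts z ! j)) (snd (ts (z + 1) ! j))" and ss: "ss z = ss (z + 1)"
      if "- int T \<le> z" "z < b" "j < ntapes M" for z j
      using R_right[of 0 z] that by (auto simp: R)
    have col: "ts z ! j = column (?C 0) z ! j" if z: "- int T \<le> z" "z \<le> b" and j: "j < ntapes M" for z j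
    proof -
      have c: "column (?C 0) z ! j = (if j = 0 then tape_of (bits x @ 3 # bits w) z else 0, side_of z 0)"
        using nth_column[OF wf_conf_at j, of w 0 z] conf_at_0(2)[OF j, of w] by (simp add: tape_of_def)
      show ?thesis
      proof (cases "z < 0")
        case True
        then show ?thesis using neg[OF z(1) True] j c by (simp add: tape_of_def side_of_def)
      next
        case False
        define i where "i = nat z"
        have i: "z = int i" "i \<le> T + length x + P" using False z by (auto simp: b_def i_def)
        have n: "snd (ts z ! j) \<noteq> Before" "fst (ts z ! j) = (if j = 0 then tape_of (bits x @ 3 # bits w) z else 0)"
          using nonneg[OF i(2)] j i(1) by auto
        \<comment> \<open>Left of cell 0 every side is \<open>Before\<close> and from cell 0 on none
          is, so \<open>hnext\<close> puts the head exactly at 0; \<open>1 \<le> T\<close> provides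
          the column of cell -1.\<close>
        have p: "hnext (snd (ts (z - 1) ! j)) (snd (ts z ! j))" using nxt[of "z - 1" j] False z T j by simp
        have "snd (ts z ! j) = side_of z 0"
        proof (cases "z = 0")
          case True
          then have "snd (ts (z - 1) ! j) = Before" using neg[of "z - 1"] T j by simp
          then show ?thesis using p n True by (cases "snd (ts z ! j)") (auto simp: side_of_def)
        next
          case z0: False
          then have "snd (ts (z - 1) ! j) \<noteq> Before"
            using nonneg[of "i - 1"] i j by (auto simp: of_nat_diff)
          then show ?thesis using p False z0 by (cases "snd (ts (z - 1) ! j)") (auto simp: side_of_def)
        qed
        then show ?thesis using n c by (simp add: prod_eq_iff)
      qed
    qed
    have len: "length (ts z) = ntapes M" "length (ss z) = ntapes M" if "- int T \<le> z" "z \<le> b" for z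
      using R_cells[of 0 z] that by (simp_all add: R cells_def)
    have ss_a: "ss (- int T + int n) = ss (- int T)" if "- int T + int n \<le> b" for n
      using that
    proof (induction n)
      case (Suc n)
      then show ?case using ss[of "- int T + int n" 0] ntapes_pos by (simp add: algebra_simps)
    qed simp
    have ss_const: "ss z = ss 0" using ss_a[of "nat (z + int T)"] ss_a[of T] 0 by (simp add: b_def)
    have "ss z = scanned (?C 0)"
    proof (rule nth_equalityI)
      show "length (ss z) = length (scanned (?C 0))" using len 0 length_scanned[OF wf_conf_at] by simp
      fix j assume "j < length (ss z)"
      then have j: "j < ntapes M" using len 0 by simp
      have c: "ts 0 ! j = column (?C 0) 0 ! j" using col[OF _ _ j, of 0] by (simp add: b_def)
      have h: "column (?C 0) 0 ! j = (scanned (?C 0) ! j, Here)"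
        using nth_column[OF wf_conf_at j, of w 0 0] nth_scanned[OF wf_conf_at j, of w 0] conf_at_0(2)[OF j, of w]
        by simp
      have "\<exists>\<kappa>. ok_kind \<kappa> (Some (R 0 0))" using R_kind[of 0 0] by (auto simp: b_def)
      then have "ts 0 ! j = (scanned (?C 0) ! j, Here) \<longrightarrow> scanned (?C 0) ! j = ss 0 ! j"
        using j unfolding R ok_kind.simps by (metis fst_conv snd_conv)
      then show "ss z ! j = scanned (?C 0) ! j" using c h ss_const by simp
    qed
    moreover have "ts z = column (?C 0) z"
      using len 0 length_column[OF wf_conf_at] col by (intro nth_equalityI) auto
    moreover have "q z = fst (?C 0)"
    proof (cases "z < 0")
      case True
      then show ?thesis using neg 0 conf_at_0(1) by simp
    next
      case False
      then show ?thesis using nonneg[of "nat z"] 0 conf_at_0(1) by (simp add: b_def)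
    qed
    ultimately have "R 0 z = (fst (?C 0), scanned (?C 0), column (?C 0) z, e z)" by (simp add: R)
    then show ?case by blast
  next
    case (Suc t)
    show ?case
      unfolding conf_at_Suc
    proof (rule row_determined[where R = "R t" and R' = "R (Suc t)" and a = "- int T" and b = b])
      show "wf_config (?C t)" by (rule wf_conf_at)
      show "- int T < snd (snd (?C t) ! j) \<and> snd (snd (?C t) ! j) < b" if "j < ntapes M" for j
        using heads_conf_at[OF that, of w t] Suc.prems T by (auto simp: b_def)
      show "\<exists>\<kappa>. ok_kind \<kappa> (Some (R (Suc t) z))" if "- int T \<le> z" "z \<le> b" for z
        using R_kind[OF Suc.prems(1) that] by blast
    qed (use Suc R_cells R_right R_up in auto)
  qed
  from this[of T 0] obtain e where "R T 0 = (fst (?C T), scanned (?C T), column (?C T) 0, e)"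
    using T by (auto simp: b_def)
  moreover have "ok_kind Acc (Some (R T 0))"
    using R_kind[of T 0] nth_kinds[of T "T + 1"] T by (simp add: b_def width_def nat_add_distrib del: ok_kind.simps)
  ultimately have "fst (?C T) = 1" by simp
  then show ?thesis using l lw by auto
qed

theorem tiling_iff: "(\<exists>\<tau>. tiling ks W \<tau>) \<longleftrightarrow> (\<exists>w. length w \<le> P \<and> fst (run M T (bits x @ [3] @ bits w)) = 1)"
  using tiling_of_run run_of_tiling unfolding conf_at_def by auto

end

section \<open>Counter programs\<close>

text \<open>
  The positions of the heads serve as counters: register \<open>v\<close> is the position of the head on tape \<open>v\<close>.
  Register 0 belongs to the input tape; tape 1 is written by \<open>Out\<close> only and has no register. The other
  tapes carry a single mark, symbol 3 at position 0, which makes zero testable.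
\<close>

datatype instr = Inc nat | Dec nat | Out bool

datatype test = NZ nat | Bit | One

datatype com = Skip | Do instr | Seq com com | Cnd test com com | Loop test com

fun holds :: "bool list \<Rightarrow> (nat \<Rightarrow> nat) \<Rightarrow> test \<Rightarrow> bool" where
  "holds x \<sigma> (NZ v) \<longleftrightarrow> \<sigma> v \<noteq> 0"
| "holds x \<sigma> Bit \<longleftrightarrow> \<sigma> 0 < length x"
| "holds x \<sigma> One \<longleftrightarrow> \<sigma> 0 < length x \<and> x ! \<sigma> 0"

fun nxt :: "(test \<Rightarrow> bool) \<Rightarrow> com \<Rightarrow> com \<times> instr option" where
  "nxt h Skip = (Skip, None)"
| "nxt h (Do i) = (Skip, Some i)"
| "nxt h (Seq c d) = (if c = Skip then (d, None) else (Seq (fst (nxt h c)) d, snd (nxt h c)))"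
| "nxt h (Cnd b c d) = (if h b then c else d, None)"
| "nxt h (Loop b c) = (if h b then Seq c (Loop b c) else Skip, None)"

fun effect :: "instr option \<Rightarrow> (nat \<Rightarrow> nat) \<times> bool list \<Rightarrow> (nat \<Rightarrow> nat) \<times> bool list" where
  "effect None s = s"
| "effect (Some (Inc v)) (\<sigma>, o') = (\<sigma>(v := Suc (\<sigma> v)), o')"
| "effect (Some (Dec v)) (\<sigma>, o') = (\<sigma>(v := \<sigma> v - 1), o')"
| "effect (Some (Out b)) (\<sigma>, o') = (\<sigma>, o' @ [b])"

text \<open>No head may pass to the left of cell 0, where a position would cease to be a counter,
  nor beyond \<open>B\<close>, on which the time bound rests.\<close>

fun safe :: "nat \<Rightarrow> instr option \<Rightarrow> (nat \<Rightarrow> nat) \<Rightarrow> bool" where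
  "safe B (Some (Inc v)) \<sigma> \<longleftrightarrow> \<sigma> v < B"
| "safe B (Some (Dec v)) \<sigma> \<longleftrightarrow> 0 < \<sigma> v"
| "safe B _ \<sigma> \<longleftrightarrow> True"

type_synonym state = "com \<times> (nat \<Rightarrow> nat) \<times> bool list"

definition go :: "bool list \<Rightarrow> state \<Rightarrow> state" where
  "go x a = (let r = nxt (holds x (fst (snd a))) (fst a) in (fst r, effect (snd r) (snd a)))"

definition goes :: "bool list \<Rightarrow> nat \<Rightarrow> state \<Rightarrow> state \<Rightarrow> bool" where
  "goes x B a b \<longleftrightarrow> fst a \<noteq> Skip \<and> safe B (snd (nxt (holds x (fst (snd a))) (fst a))) (fst (snd a)) \<and> b = go x a"

definition ex :: "bool list \<Rightarrow> nat \<Rightarrow> com \<Rightarrow> (nat \<Rightarrow> nat) \<times> bool list \<Rightarrow> (nat \<Rightarrow> nat) \<times> bool list \<Rightarrow> bool" where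
  "ex x B c s s' \<longleftrightarrow> (goes x B)\<^sup>*\<^sup>* (c, s) (Skip, s')"

lemma ex_Skip: "ex x B Skip s s"
  by (simp add: ex_def)

lemma ex_Inc: "\<sigma> v < B \<Longrightarrow> ex x B (Do (Inc v)) (\<sigma>, o') (\<sigma>(v := Suc (\<sigma> v)), o')"
  unfolding ex_def by (rule r_into_rtranclp) (simp add: goes_def go_def)

lemma ex_Dec: "0 < \<sigma> v \<Longrightarrow> ex x B (Do (Dec v)) (\<sigma>, o') (\<sigma>(v := \<sigma> v - 1), o')"
  unfolding ex_def by (rule r_into_rtranclp) (simp add: goes_def go_def)

lemma ex_Out: "ex x B (Do (Out b)) (\<sigma>, o') (\<sigma>, o' @ [b])"
  unfolding ex_def by (rule r_into_rtranclp) (simp add: goes_def go_def)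

lemma goes_Seq: "goes x B (c, s) (c', s') \<Longrightarrow> goes x B (Seq c d, s) (Seq c' d, s')"
  by (simp add: goes_def go_def Let_def)

lemma ex_Seq:
  assumes "ex x B c s s'" "ex x B d s' s''"
  shows "ex x B (Seq c d) s s''"
proof -
  have "(goes x B)\<^sup>*\<^sup>* (Seq c d, s) (Seq Skip d, s')"
    using assms(1) unfolding ex_def
    by (induction rule: converse_rtranclp_induct2) (auto intro: goes_Seq converse_rtranclp_into_rtranclp)
  also have "goes x B (Seq Skip d, s') (d, s')" by (simp add: goes_def go_def)
  finally show ?thesis using assms(2) unfolding ex_def by simp
qed

lemma ex_Cnd: "ex x B (if holds x (fst s) b then c else d) s s' \<Longrightarrow> ex x B (Cnd b c d) s s'"
  unfolding ex_def
  by (rule converse_rtranclp_into_rtranclp[where b = "(if holds x (fst s) b then c else d, s)"])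
    (simp_all add: goes_def go_def Let_def)

lemma ex_Loop_end: "\<not> holds x (fst s) b \<Longrightarrow> ex x B (Loop b c) s s"
  unfolding ex_def by (rule r_into_rtranclp) (simp add: goes_def go_def Let_def)

lemma ex_Loop_step:
  assumes "holds x (fst s) b" "ex x B c s s'" "ex x B (Loop b c) s' s''"
  shows "ex x B (Loop b c) s s''"
proof -
  have "goes x B (Loop b c, s) (Seq c (Loop b c), s)"
    using assms(1) by (simp add: goes_def go_def Let_def)
  then show ?thesis
    using ex_Seq[OF assms(2,3)] unfolding ex_def by (rule converse_rtranclp_into_rtranclp)
qed

fun test_ok :: "nat \<Rightarrow> test \<Rightarrow> bool" where
  "test_ok n (NZ v) \<longleftrightarrow> 2 \<le> v \<and> v < n"
| "test_ok n _ \<longleftrightarrow> True"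

fun instr_ok :: "nat \<Rightarrow> instr \<Rightarrow> bool" where
  "instr_ok n (Inc v) \<longleftrightarrow> v \<noteq> 1 \<and> v < n"
| "instr_ok n (Dec v) \<longleftrightarrow> v \<noteq> 1 \<and> v < n"
| "instr_ok n (Out b) \<longleftrightarrow> True"

fun com_ok :: "nat \<Rightarrow> com \<Rightarrow> bool" where
  "com_ok n Skip \<longleftrightarrow> True"
| "com_ok n (Do i) \<longleftrightarrow> instr_ok n i"
| "com_ok n (Seq c d) \<longleftrightarrow> com_ok n c \<and> com_ok n d"
| "com_ok n (Cnd b c d) \<longleftrightarrow> test_ok n b \<and> com_ok n c \<and> com_ok n d"
| "com_ok n (Loop b c) \<longleftrightarrow> test_ok n b \<and> com_ok n c"

text \<open>The control states of a program are its residuals.\<close>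

fun residuals :: "com \<Rightarrow> com set" where
  "residuals Skip = {Skip}"
| "residuals (Do i) = {Do i, Skip}"
| "residuals (Seq c d) = (\<lambda>c'. Seq c' d) ` residuals c \<union> residuals d"
| "residuals (Cnd b c d) = {Cnd b c d} \<union> residuals c \<union> residuals d"
| "residuals (Loop b c) = {Loop b c, Skip} \<union> (\<lambda>c'. Seq c' (Loop b c)) ` residuals c"

lemma finite_residuals: "finite (residuals c)"
  by (induction c) auto

lemma self_residual: "c \<in> residuals c"
  by (induction c) auto

lemma nxt_residual: "c' \<in> residuals c \<Longrightarrow> fst (nxt h c') \<in> residuals c"
proof (induction c arbitrary: c')
  case (Seq c d)
  from Seq.prems consider e where "e \<in> residuals c" "c' = Seq e d" | "c' \<in> residuals d" by auto
  then show ?case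
  proof cases
    case 1
    then show ?thesis using Seq.IH(1)[of e] self_residual[of d] by simp
  qed (use Seq.IH(2) in simp)
next
  case (Cnd b c d)
  from Cnd.prems consider "c' = Cnd b c d" | "c' \<in> residuals c" | "c' \<in> residuals d" by auto
  then show ?case
    by cases (use Cnd.IH self_residual in simp_all)
next
  case (Loop b c)
  from Loop.prems consider "c' = Loop b c" | "c' = Skip" | e where "e \<in> residuals c" "c' = Seq e (Loop b c)"
    by auto
  then show ?case
    by cases (use Loop.IH self_residual[of c] in simp_all)
qed auto

lemma com_ok_residuals: "com_ok n c \<Longrightarrow> residuals c \<subseteq> Collect (com_ok n)"
proof (induction c)
  case (Seq c d)
  from Seq.prems have "com_ok n c" "com_ok n d" by simp_all
  with Seq.IH(1)[OF this(1)] Seq.IH(2)[OF this(2)] show ?case by auto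
next
  case (Cnd b c d)
  from Cnd.prems have "com_ok n c" "com_ok n d" "test_ok n b" by simp_all
  with Cnd.IH(1)[OF this(1)] Cnd.IH(2)[OF this(2)] show ?case by auto
next
  case (Loop b c)
  from Loop.prems have "com_ok n c" "test_ok n b" by simp_all
  with Loop.IH[OF this(1)] show ?case by auto
qed auto

lemma com_ok_residual: "com_ok n c \<Longrightarrow> c' \<in> residuals c \<Longrightarrow> com_ok n c'"
  using com_ok_residuals by blast

lemma instr_ok_nxt: "com_ok n c \<Longrightarrow> snd (nxt h c) = Some i \<Longrightarrow> instr_ok n i"
  by (induction c) (simp_all split: if_splits)

lemma nxt_cong: "com_ok n c \<Longrightarrow> (\<And>b. test_ok n b \<Longrightarrow> h b = h' b) \<Longrightarrow> nxt h c = nxt h' c"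
  by (induction c) simp_all

text \<open>
  The output does not influence the run, so a terminating run never repeats a pair of control state
  and registers. This bounds its length polynomially in a bound of the registers.
\<close>

lemma ex_steps:
  assumes e: "ex x B c (\<sigma>, o') s'" and ok: "com_ok nv c"
    and \<sigma>: "\<And>v. \<sigma> v \<le> B" "\<And>v. nv \<le> v \<Longrightarrow> \<sigma> v = 0"
  obtains n where "n \<le> card (residuals c) * (B + 1) ^ nv"
    and "(go x ^^ n) (c, \<sigma>, o') = (Skip, s')"
    and "\<And>i. i < n \<Longrightarrow> goes x B ((go x ^^ i) (c, \<sigma>, o')) ((go x ^^ Suc i) (c, \<sigma>, o'))"
proof -
  let ?a = "\<lambda>i. (go x ^^ i) (c, \<sigma>, o')"
  from e obtain n where "((goes x B) ^^ n) (c, \<sigma>, o') (Skip, s')"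
    unfolding ex_def by (blast dest: rtranclp_imp_relpowp)
  then obtain f where f: "f 0 = (c, \<sigma>, o')" "f n = (Skip, s')" "\<And>i. i < n \<Longrightarrow> goes x B (f i) (f (Suc i))"
    unfolding relpowp_fun_conv by blast
  have fa: "f i = ?a i" if "i \<le> n" for i
    using that by (induction i) (use f(1,3) in \<open>auto simp: goes_def\<close>)
  have step: "goes x B (?a i) (?a (Suc i))" if "i < n" for i
    using f(3)[OF that] fa[of i] fa[of "Suc i"] that by simp
  have fin: "?a n = (Skip, s')" using fa[of n] f(2) by simp
  let ?p = "\<lambda>a :: state. (fst a, fst (snd a))"
  have p_go: "?p (go x a) = ?p (go x b)" if "?p a = ?p b" for a b
  proof -
    have "fst (effect i (\<sigma>, o1)) = fst (effect i (\<sigma>, o2))" for i \<sigma> o1 o2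
      by (cases "(i, (\<sigma>, o1))" rule: effect.cases) auto
    then show ?thesis
      using that by (cases a; cases b) (auto simp: go_def Let_def)
  qed
  have p_iter: "?p ((go x ^^ k) a) = ?p ((go x ^^ k) b)" if "?p a = ?p b" for a b k
  proof (induction k)
    case (Suc k)
    show ?case using p_go[OF Suc] by simp
  qed (use that in simp)
  have inj: "inj_on (\<lambda>i. ?p (?a i)) {..n}"
  proof -
    \<comment> \<open>If the projections agreed at \<open>i < j\<close>, they would still agree
      \<open>n - j\<close> steps later, so \<open>Skip\<close> would occur before step
      \<open>n\<close>; but \<open>goes\<close> admits no step from \<open>Skip\<close>.\<close>
    have "?p (?a i) \<noteq> ?p (?a j)" if ij: "i < j" "j \<le> n" for i j
    proof
      assume "?p (?a i) = ?p (?a j)"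
      then have "?p ((go x ^^ (n - j)) (?a i)) = ?p ((go x ^^ (n - j)) (?a j))" by (rule p_iter)
      moreover have "(go x ^^ (n - j)) (?a l) = ?a (n - j + l)" for l by (simp add: funpow_add)
      ultimately have "?p (?a (n - j + i)) = ?p (?a (n - j + j))" by metis
      moreover have "?a (n - j + j) = (Skip, s')" using fin ij by simp
      ultimately have "fst (?a (n - j + i)) = Skip" by (metis fst_conv prod.inject)
      moreover have "n - j + i < n" using ij by simp
      ultimately show False using step unfolding goes_def by blast
    qed
    then show ?thesis by (auto simp: inj_on_def) (metis linorder_neqE_nat)
  qed
  let ?R = "{\<sigma>. (\<forall>v. \<sigma> v \<le> B) \<and> (\<forall>v \<ge> nv. \<sigma> v = 0)}"
  have inv: "fst (?a i) \<in> residuals c \<and> fst (snd (?a i)) \<in> ?R" if "i \<le> n" for i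
    using that
  proof (induction i)
    case 0
    then show ?case using self_residual \<sigma> by simp
  next
    case (Suc i)
    obtain c' \<sigma>' o1 where a: "?a i = (c', \<sigma>', o1)" by (cases "?a i") auto
    have *: "c' \<in> residuals c" "\<sigma>' \<in> ?R" using Suc a by auto
    have g: "safe B (snd (nxt (holds x \<sigma>') c')) \<sigma>'" using step[of i] Suc.prems a by (simp add: goes_def)
    have "com_ok nv c'" by (rule com_ok_residual[OF ok *(1)])
    then have "instr_ok nv j" if "snd (nxt (holds x \<sigma>') c') = Some j" for j
      using that by (rule instr_ok_nxt)
    then have "fst (effect (snd (nxt (holds x \<sigma>') c')) (\<sigma>', o1)) \<in> ?R"
      using g *(2)
      by (cases "(snd (nxt (holds x \<sigma>') c'), (\<sigma>', o1))" rule: effect.cases)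
        (auto simp: le_diff_conv intro: le_SucI)
    moreover have "?a (Suc i) = go x (c', \<sigma>', o1)" using a by simp
    then have "?a (Suc i) = (fst (nxt (holds x \<sigma>') c'), effect (snd (nxt (holds x \<sigma>') c')) (\<sigma>', o1))"
      by (simp add: go_def Let_def)
    ultimately show ?case using nxt_residual[OF *(1), of "holds x \<sigma>'"] by (simp only: fst_conv snd_conv)
  qed
  let ?F = "residuals c \<times> ?R"
  let ?l = "\<lambda>\<sigma> :: nat \<Rightarrow> nat. map \<sigma> [0..<nv]"
  let ?LL = "{xs. set xs \<subseteq> {..B} \<and> length xs = nv}"
  have injl: "inj_on ?l ?R"
  proof (rule inj_onI)
    fix \<sigma> \<tau> assume *: "\<sigma> \<in> ?R" "\<tau> \<in> ?R" "?l \<sigma> = ?l \<tau>"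
    have "\<sigma> v = \<tau> v" for v
      using * by (cases "v < nv") (auto simp: list_eq_iff_nth_eq)
    then show "\<sigma> = \<tau>" by blast
  qed
  have sub: "?l ` ?R \<subseteq> ?LL" by auto
  have finL: "finite ?LL" "card ?LL = (B + 1) ^ nv"
    using finite_lists_length_eq[of "{..B}" nv] card_lists_length_eq[of "{..B}" nv] by simp_all
  have finR: "finite ?R" using injl sub finL(1) by (meson finite_imageD finite_subset)
  have cardR: "card ?R \<le> (B + 1) ^ nv"
    using card_inj_on_le[OF injl sub finL(1)] finL(2) by simp
  have "card {..n} \<le> card ?F"
    using inv finR finite_residuals by (intro card_inj_on_le[OF inj]) auto
  then have "n \<le> card (residuals c) * (B + 1) ^ nv"
    using cardR by (simp add: card_cartesian_product) (meson Suc_leD le_trans mult_le_mono2)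
  then show ?thesis using that fin step by blast
qed

section \<open>From counter programs to Turing machines\<close>

definition mark_tape :: tape where
  "mark_tape = (\<lambda>i. if i = 0 then 3 else 0)"

fun scan :: "nat list \<Rightarrow> test \<Rightarrow> bool" where
  "scan ss (NZ v) \<longleftrightarrow> ss ! v \<noteq> 3"
| "scan ss Bit \<longleftrightarrow> ss ! 0 \<noteq> 0"
| "scan ss One \<longleftrightarrow> ss ! 0 = 2"

fun action :: "nat list \<Rightarrow> instr option \<Rightarrow> nat \<Rightarrow> nat \<times> move" where
  "action ss None v = (ss ! v, Stay)"
| "action ss (Some (Inc u)) v = (ss ! v, if v = u then Move_Right else Stay)"
| "action ss (Some (Dec u)) v = (ss ! v, if v = u then Move_Left else Stay)"
| "action ss (Some (Out b)) v = (if v = 1 then (if b then 2 else 1, Move_Right) else (ss ! v, Stay))"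

lemma tape_of_snoc: "(tape_of w)(int (length w) := a) = tape_of (w @ [a])"
  by (rule ext) (auto simp: tape_of_def nth_append)

lemma tape_of_bits: "tape_of (bits x) (int i) = (if i < length x then if x ! i then 2 else 1 else 0)"
  by (simp add: tape_of_def bits_def)

locale compiler =
  fixes c0 :: com and nv :: nat and enc :: "com \<Rightarrow> nat" and ns :: nat
  assumes ok: "com_ok nv c0" and nv: "2 \<le> nv"
    and enc: "inj_on enc (residuals c0)" "enc Skip = 1"
    and enc_range: "\<And>c. c \<in> residuals c0 \<Longrightarrow> enc c < ns" "\<And>c. c \<in> residuals c0 \<Longrightarrow> c \<noteq> Skip \<Longrightarrow> 3 \<le> enc c"
    and ns: "3 \<le> ns"
begin

text \<open>State 0 serves only to write the marks on the counter tapes. Residuals are the other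
  states, with \<open>Skip\<close> as the accepting state 1; the last branch covers numbers that
  encode no residual.\<close>

definition machine :: turing_machine where
  "machine = \<lparr>ntapes = nv, nstates = ns, nsyms = 4,
     delta = (\<lambda>q ss.
       if q = 0 then (enc c0, map (\<lambda>v. (if 2 \<le> v then 3 else ss ! v, Stay)) [0..<nv])
       else if q \<in> enc ` residuals c0 then
         (let r = nxt (scan ss) (inv_into (residuals c0) enc q) in (enc (fst r), map (action ss (snd r)) [0..<nv]))
       else (1, map (action ss None) [0..<nv]))\<rparr>"

lemma wf_machine: "wf_turing_machine machine"
proof -
  have a: "fst (action ss i v) < 4" if "length ss = nv" "set ss \<subseteq> {..<4}" "v < nv" for ss i v
  proof -
    have "ss ! v < 4" using that by (metis lessThan_iff nth_mem subsetD)
    then show ?thesis by (cases "(ss, i, v)" rule: action.cases) auto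
  qed
  have "1 < ns" using ns by simp
  then show ?thesis
    using nv ns a enc_range(1) nxt_residual self_residual inv_into_into[of _ enc "residuals c0"]
    unfolding wf_turing_machine_def machine_def
    by (auto simp: Let_def subset_iff nth_mem)
qed

text \<open>The head of tape 1 stands right behind the output produced so far, so writing there and
  moving right appends a bit, as in \<open>tape_of_snoc\<close>.\<close>

definition conf :: "bool list \<Rightarrow> state \<Rightarrow> config" where
  "conf x a = (enc (fst a), map (\<lambda>v.
     (if v = 0 then tape_of (bits x) else if v = 1 then tape_of (bits (snd (snd a))) else mark_tape,
      if v = 1 then int (length (snd (snd a))) else int (fst (snd a) v))) [0..<nv])"

lemma step_conf:
  assumes a: "fst a \<in> residuals c0" and g: "goes x B a b"
  shows "step machine (conf x a) = conf x b"
proof -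
  obtain c \<sigma> o' where a': "a = (c, \<sigma>, o')" by (cases a) auto
  have c: "c \<in> residuals c0" "c \<noteq> Skip" using a g a' by (auto simp: goes_def)
  let ?ss = "map (\<lambda>(t, h). t h) (snd (conf x a))"
  have len: "length ?ss = nv" by (simp add: conf_def)
  have ss: "?ss ! v = (if v = 0 then tape_of (bits x) (int (\<sigma> 0)) else if v = 1
      then tape_of (bits o') (int (length o')) else mark_tape (int (\<sigma> v)))" if "v < nv" for v
    using that by (simp add: conf_def a')
  have okc: "com_ok nv c" by (rule com_ok_residual[OF ok c(1)])
  have scan: "scan ?ss b = holds x \<sigma> b" if "test_ok nv b" for b
    using that nv ss by (cases b) (auto simp: tape_of_bits mark_tape_def)
  let ?r = "nxt (holds x \<sigma>) c"
  have r: "nxt (scan ?ss) c = ?r" by (rule nxt_cong[OF okc scan])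
  have q: "enc c \<notin> {0, 1, 2}" using enc_range(2)[OF c] by auto
  have "delta machine (enc c) ?ss = (enc (fst ?r), map (action ?ss (snd ?r)) [0..<nv])"
    using q c r enc(1) by (simp add: machine_def Let_def)
  then have st: "step machine (conf x a) =
      (enc (fst ?r), map2 act (snd (conf x a)) (map (action ?ss (snd ?r)) [0..<nv]))"
    using q unfolding step_def Let_def by (simp add: a' conf_def del: map_map)
  have "map2 act (snd (conf x a)) (map (action ?ss (snd ?r)) [0..<nv]) = snd (conf x b)"
  proof (rule nth_equalityI)
    fix v assume "v < length (map2 act (snd (conf x a)) (map (action ?ss (snd ?r)) [0..<nv]))"
    then have v: "v < nv" by (simp add: conf_def)
    have iok: "instr_ok nv i" if "snd ?r = Some i" for i using okc that by (rule instr_ok_nxt)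
    have sf: "safe B (snd ?r) \<sigma>" using g by (simp add: goes_def a')
    have b: "b = (fst ?r, effect (snd ?r) (\<sigma>, o'))" using g by (simp add: goes_def go_def a' Let_def)
    have "map2 act (snd (conf x a)) (map (action ?ss (snd ?r)) [0..<nv]) ! v =
        act (snd (conf x a) ! v) (action ?ss (snd ?r) v)"
      using v by (simp add: conf_def)
    also have "\<dots> = snd (conf x b) ! v"
    proof (cases "(?ss, snd ?r, v)" rule: action.cases)
      case (1 ss v')
      then show ?thesis using v ss[OF v] by (simp add: conf_def a' b)
    next
      case (2 ss u v')
      then show ?thesis using v ss[OF v] iok by (simp add: conf_def a' b)
    next
      case (3 ss u v')
      then show ?thesis using v ss[OF v] iok sf by (auto simp: conf_def a' b)
    next
      case (4 ss b' v')
      then show ?thesis using v ss[OF v] tape_of_snoc[of "bits o'" "if b' then 2 else 1"]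
        by (auto simp: conf_def a' b bits_def)
    qed
    finally show "map2 act (snd (conf x a)) (map (action ?ss (snd ?r)) [0..<nv]) ! v = snd (conf x b) ! v" .
  qed (simp add: conf_def)
  moreover have "fst (conf x b) = enc (fst ?r)" using g by (simp add: goes_def go_def a' Let_def conf_def)
  ultimately show ?thesis unfolding st by (simp add: conf_def)
qed

lemma step_init: "step machine (init_config machine (bits x)) = conf x (c0, \<lambda>_. 0, [])"
proof -
  define I where "I = init_config machine (bits x)"
  have t: "(tape_of [])(0 := 3) = mark_tape" by (rule ext) (simp add: tape_of_def mark_tape_def)
  have len: "length (snd I) = nv" and "fst I = 0"
    using nv by (simp_all add: I_def init_config_def machine_def)
  have i: "snd I ! v = (if v = 0 then tape_of (bits x) else tape_of [], 0)" if "v < nv" for v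
    using that by (cases v) (simp_all add: I_def init_config_def machine_def)
  have "delta machine 0 ss = (enc c0, map (\<lambda>v. (if 2 \<le> v then 3 else ss ! v, Stay)) [0..<nv])" for ss
    by (simp add: machine_def)
  then have "step machine I = (enc c0, map2 act (snd I)
      (map (\<lambda>v. (if 2 \<le> v then 3 else map (\<lambda>(t, h). t h) (snd I) ! v, Stay)) [0..<nv]))"
    using \<open>fst I = 0\<close> unfolding step_def Let_def by (simp del: map_map)
  moreover have "map2 act (snd I)
      (map (\<lambda>v. (if 2 \<le> v then 3 else map (\<lambda>(t, h). t h) (snd I) ! v, Stay)) [0..<nv]) =
      snd (conf x (c0, \<lambda>_. 0, []))"
    by (rule nth_equalityI) (auto simp: len i conf_def t bits_def[of "[]"])
  ultimately show ?thesis by (simp add: conf_def I_def)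
qed

text \<open>One machine step simulates one program step; the extra step is the initial one that
  writes the marks. After \<open>Skip\<close> the machine has halted, so a larger time bound does no
  harm.\<close>

lemma run_machine:
  assumes e: "ex x B c0 (\<lambda>_. 0, []) (\<sigma>', o')" and t: "card (residuals c0) * (B + 1) ^ nv + 1 \<le> t"
  shows "run machine t (bits x) = conf x (Skip, \<sigma>', o')"
proof -
  obtain n where n: "n \<le> card (residuals c0) * (B + 1) ^ nv"
    "(go x ^^ n) (c0, \<lambda>_. 0, []) = (Skip, \<sigma>', o')"
    "\<And>i. i < n \<Longrightarrow> goes x B ((go x ^^ i) (c0, \<lambda>_. 0, [])) ((go x ^^ Suc i) (c0, \<lambda>_. 0, []))"
    by (rule ex_steps[OF e ok]) auto
  have run_Suc: "run machine (Suc k) w = step machine (run machine k w)" for k w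
    by (simp add: run_def)
  have "run machine (Suc i) (bits x) = conf x ((go x ^^ i) (c0, \<lambda>_. 0, [])) \<and>
      fst ((go x ^^ i) (c0, \<lambda>_. 0, [])) \<in> residuals c0" if "i \<le> n" for i
    using that
  proof (induction i)
    case 0
    then show ?case using step_init self_residual by (simp add: run_def)
  next
    case (Suc i)
    let ?a = "(go x ^^ i) (c0, \<lambda>_. 0, [])"
    have *: "run machine (Suc i) (bits x) = conf x ?a" "fst ?a \<in> residuals c0" using Suc by auto
    have "step machine (conf x ?a) = conf x ((go x ^^ Suc i) (c0, \<lambda>_. 0, []))"
      using step_conf[OF *(2) n(3)] Suc.prems by simp
    moreover have "fst (go x ?a) \<in> residuals c0"
      using nxt_residual[OF *(2)] unfolding go_def Let_def fst_conv by blast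
    ultimately show ?case using * unfolding run_Suc[of "Suc i"] by simp
  qed
  from this[of n] have end': "run machine (Suc n) (bits x) = conf x (Skip, \<sigma>', o')" using n(2) by simp
  have fix': "run machine (Suc n + k) (bits x) = conf x (Skip, \<sigma>', o')" for k
  proof (induction k)
    case (Suc k)
    then show ?case using enc(2) by (simp add: run_Suc step_def conf_def)
  qed (simp add: end')
  show ?thesis using fix'[of "t - Suc n"] n(1) t by simp
qed

end

text \<open>The program and its number of tapes are fixed, so a polynomial register bound turns the
  count of control states and register contents into a polynomial time bound.\<close>

theorem polytime_computable_program:
  assumes ok: "com_ok nv c" and nv: "2 \<le> nv"
    and e: "\<And>x. \<exists>\<sigma>. ex x (poly B (length x)) c (\<lambda>_. 0, []) (\<sigma>, f x)"
  shows "polytime_computable f"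
proof -
  obtain g :: "com \<Rightarrow> nat" and k where g: "g ` residuals c = {i. i < k}" "inj_on g (residuals c)"
    using finite_imp_inj_to_nat_seg[OF finite_residuals[of c]] by blast
  define enc where "enc = (\<lambda>d. if d = Skip then 1 else g d + 3)"
  interpret compiler c nv enc "k + 3"
  proof
    show "inj_on enc (residuals c)" using g(2) by (auto simp: enc_def inj_on_def)
    show "enc d < k + 3" if "d \<in> residuals c" for d using g(1) that by (auto simp: enc_def)
  qed (use ok nv in \<open>auto simp: enc_def\<close>)
  let ?p = "[:card (residuals c):] * (B + 1) ^ nv + 1"
  have p: "poly ?p n = card (residuals c) * (poly B n + 1) ^ nv + 1" for n
    by (simp add: poly_power)
  have "let r = run machine (poly ?p (length x)) (bits x)
      in fst r = 1 \<and> fst (snd r ! 1) = tape_of (bits (f x))" for x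
  proof -
    obtain \<sigma> where \<sigma>: "ex x (poly B (length x)) c (\<lambda>_. 0, []) (\<sigma>, f x)" using e by blast
    have "run machine (poly ?p (length x)) (bits x) = conf x (Skip, \<sigma>, f x)"
      by (rule run_machine[OF \<sigma>]) (simp only: p order_refl)
    then show ?thesis using nv enc(2) by (simp add: Let_def conf_def)
  qed
  moreover have "ntapes machine \<ge> 2" using nv by (simp add: machine_def)
  ultimately show ?thesis unfolding polytime_computable_def using wf_machine by blast
qed

section \<open>The gadget graph of a tiling problem\<close>

lemma nth_concat_blocks:
  assumes "\<And>i. i < n \<Longrightarrow> length (f i) = k" "i < n" "j < k"
  shows "concat (map f [0..<n]) ! (i * k + j) = f i ! j"
  using assms
proof (induction n)
  case (Suc n)
  have len: "length (concat (map f [0..<n])) = n * k" using Suc.prems(1) by (induction n) auto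
  show ?case
  proof (cases "i = n")
    case False
    then have i: "i < n" using Suc.prems by simp
    then have "Suc i * k \<le> n * k" by (intro mult_le_mono1) simp
    then have "i * k + j < n * k" using Suc.prems by simp
    then show ?thesis using Suc.IH i Suc.prems len by (simp add: nth_append)
  qed (simp add: nth_append len)
qed simp

lemma length_concat_blocks:
  "(\<And>i. i < n \<Longrightarrow> length (f i) = k) \<Longrightarrow> length (concat (map f [0..<n])) = n * k"
  by (induction n) auto

lemma concat_map_concat: "concat (map h (concat xss)) = concat (map (\<lambda>xs. concat (map h xs)) xss)"
  by (induction xss) auto

locale symbols =
  fixes K :: nat and kind_ok :: "kind \<Rightarrow> nat \<Rightarrow> bool" and right_ok up_ok :: "nat \<Rightarrow> nat \<Rightarrow> bool"
  assumes K: "0 < K"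

locale tiles = symbols +
  fixes ks :: "kind list" and W :: nat
  assumes W: "2 \<le> W"
begin

text \<open>A symbol that the kind of the position forbids is put in conflict with itself, so unary
  and binary constraints use the same edges. The bound \<open>2 \<le> W\<close> keeps the three
  groups of targets apart.\<close>

definition out :: "nat \<Rightarrow> nat \<Rightarrow> (nat \<times> nat) list" where
  "out i s = (if kind_ok (ks ! i) s then [] else [(i, s)]) @
     (if i + 1 < length ks then map (Pair (i + 1)) (filter (\<lambda>t. \<not> right_ok s t) [0..<K]) else []) @
     (if i + W < length ks then map (Pair (i + W)) (filter (\<lambda>t. \<not> up_ok s t) [0..<K]) else [])"

definition inn :: "nat \<Rightarrow> nat \<Rightarrow> (nat \<times> nat) list" where
  "inn i s = (if kind_ok (ks ! i) s then [] else [(i, s)]) @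
     (if 1 \<le> i then map (Pair (i - 1)) (filter (\<lambda>t. \<not> right_ok t s) [0..<K]) else []) @
     (if W \<le> i then map (Pair (i - W)) (filter (\<lambda>t. \<not> up_ok t s) [0..<K]) else [])"

sublocale gadget "length ks" K out inn
proof
  show "distinct (out i s)" if "i < length ks" "s < K" for i s
    using W that by (auto simp: out_def distinct_map inj_on_def)
  show "distinct (inn i s)" if "i < length ks" "s < K" for i s
    using W that by (auto simp: inn_def distinct_map inj_on_def)
  show "j < length ks \<and> t < K \<and> (i, s) \<in> set (inn j t)"
    if "i < length ks" "s < K" "(j, t) \<in> set (out i s)" for i s j t
    using that by (auto simp: out_def inn_def split: if_splits)
  show "j < length ks \<and> t < K \<and> (i, s) \<in> set (out j t)"
    if "i < length ks" "s < K" "(j, t) \<in> set (inn i s)" for i s j t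
    using that W by (auto simp: out_def inn_def split: if_splits)
qed (rule K)

text \<open>Each position owns a block of \<open>12 * K\<close> consecutive numbers behind the 11
  global nodes, so the number of any neighbour is a constant plus the offset of the block it lies
  in.\<close>

fun num :: "node \<Rightarrow> nat" where
  "num (Glob j) = j"
| "num (Gt i s g) = 11 + 12 * K * i + 12 * s + g"

definition position_nodes :: "nat \<Rightarrow> node list" where
  "position_nodes i = concat (map (\<lambda>s. map (Gt i s) [0..<12]) [0..<K])"

definition node_list :: "node list" where
  "node_list = map Glob [0..<11] @ concat (map position_nodes [0..<length ks])"

definition ps :: "nat list list" where
  "ps = map (\<lambda>v. map num (L v)) node_list"

lemma length_position_nodes: "length (position_nodes i) = 12 * K"
  unfolding position_nodes_def by (subst length_concat_blocks[where k = 12]) simp_all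

lemma length_node_list: "length node_list = 11 + 12 * K * length ks"
  unfolding node_list_def by (simp add: length_concat_blocks[OF length_position_nodes])

lemma nth_num_node_list: "v \<in> V \<Longrightarrow> num v < length node_list \<and> node_list ! num v = v"
proof (cases v)
  case (Glob j)
  then show ?thesis if "v \<in> V" using that by (simp add: length_node_list) (simp add: node_list_def nth_append)
next
  case (Gt i s g)
  assume "v \<in> V"
  with Gt have *: "i < length ks" "s < K" "g < 12" by auto
  have b: "12 * s + g < 12 * K" using * by simp
  have "Suc i * (12 * K) \<le> length ks * (12 * K)" using * by (intro mult_le_mono1) simp
  then have "num v < length node_list" using b by (simp add: length_node_list Gt algebra_simps)
  moreover have "node_list ! num v = concat (map position_nodes [0..<length ks]) ! (i * (12 * K) + (12 * s + g))"
    by (simp add: node_list_def nth_append Gt algebra_simps)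
  moreover have "\<dots> = position_nodes i ! (s * 12 + g)"
    using nth_concat_blocks[of "length ks" position_nodes "12 * K" i "12 * s + g"] length_position_nodes * b
    by (simp add: mult.commute)
  moreover have "\<dots> = v"
    unfolding position_nodes_def using nth_concat_blocks[of K "\<lambda>s. map (Gt i s) [0..<12]" 12 s g] * Gt by simp
  ultimately show ?thesis by simp
qed

lemma node_list_num:
  assumes u: "u < length node_list"
  obtains v where "v \<in> V" "u = num v"
proof (cases "u < 11")
  case True
  then show ?thesis using that[of "Glob u"] by simp
next
  case False
  define r where "r = u - 11"
  have r: "r < 12 * K * length ks" "u = 11 + r" using u False by (auto simp: r_def length_node_list)
  let ?i = "r div (12 * K)" and ?s = "r mod (12 * K) div 12" and ?g = "r mod (12 * K) mod 12"
  have "?i < length ks" using r(1) by (simp add: less_mult_imp_div_less mult.commute)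
  moreover have "?s < K" using K by (intro less_mult_imp_div_less) (simp add: mult.commute)
  moreover have "12 * K * ?i + 12 * ?s + ?g = r" by (simp add: add.assoc)
  ultimately show ?thesis using that[of "Gt ?i ?s ?g"] r(2) by (simp add: add.assoc)
qed

sublocale numbered_preferences V L ps num
proof
  show "bij_betw num V {..<length ps}"
    unfolding bij_betw_def
  proof
    show "inj_on num V" using nth_num_node_list by (metis inj_onI)
    show "num ` V = {..<length ps}"
      using nth_num_node_list node_list_num by (auto simp: ps_def image_iff) metis
  qed
  show "ps ! num v = map num (L v)" if "v \<in> V" for v
    using nth_num_node_list[OF that] by (simp add: ps_def)
qed

lemma out_free_iff:
  assumes \<tau>: "\<And>i. i < length ks \<Longrightarrow> \<tau> i < K"
  shows "(\<forall>i < length ks. \<forall>j < length ks. (j, \<tau> j) \<notin> set (out i (\<tau> i))) \<longleftrightarrow>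
    (\<forall>i < length ks. kind_ok (ks ! i) (\<tau> i)) \<and>
    (\<forall>i. i + 1 < length ks \<longrightarrow> right_ok (\<tau> i) (\<tau> (i + 1))) \<and>
    (\<forall>i. i + W < length ks \<longrightarrow> up_ok (\<tau> i) (\<tau> (i + W)))"
  (is "?l \<longleftrightarrow> ?r")
proof
  assume l: ?l
  have "kind_ok (ks ! i) (\<tau> i)" if "i < length ks" for i
    using l[rule_format, OF that that] by (auto simp: out_def split: if_splits)
  moreover have "right_ok (\<tau> i) (\<tau> (i + 1))" if "i + 1 < length ks" for i
    using l[rule_format, of i "i + 1"] that \<tau>[OF that] by (auto simp: out_def)
  moreover have "up_ok (\<tau> i) (\<tau> (i + W))" if "i + W < length ks" for i
    using l[rule_format, of i "i + W"] that \<tau>[OF that] by (auto simp: out_def)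
  ultimately show ?r by blast
next
  assume ?r
  then show ?l using W by (auto simp: out_def)
qed

theorem dominant_ps_iff:
  "(\<exists>M. dominant (graph_of ps) M) \<longleftrightarrow>
   (\<exists>\<tau>. (\<forall>i < length ks. \<tau> i < K \<and> kind_ok (ks ! i) (\<tau> i)) \<and>
     (\<forall>i. i + 1 < length ks \<longrightarrow> right_ok (\<tau> i) (\<tau> (i + 1))) \<and>
     (\<forall>i. i + W < length ks \<longrightarrow> up_ok (\<tau> i) (\<tau> (i + W))))"
proof -
  have "(\<exists>M. dominant (graph_of ps) M) \<longleftrightarrow> (\<exists>m. idominant m)"
    using dominant_edges_of idominant_mate by blast
  also have "\<dots> \<longleftrightarrow> (\<exists>\<tau>. (\<forall>i < length ks. \<tau> i < K \<and> kind_ok (ks ! i) (\<tau> i)) \<and>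
     (\<forall>i. i + 1 < length ks \<longrightarrow> right_ok (\<tau> i) (\<tau> (i + 1))) \<and>
     (\<forall>i. i + W < length ks \<longrightarrow> up_ok (\<tau> i) (\<tau> (i + W))))"
    unfolding idominant_iff using out_free_iff by (intro ex_cong1) blast
  finally show ?thesis .
qed

lemma stable_ps: "\<exists>S. stable_matching (graph_of ps) S"
  using stable_edges_of[OF istable_stab] by blast

definition encode_position :: "nat \<Rightarrow> bool list" where
  "encode_position i = concat (map (\<lambda>s. concat (map (\<lambda>g. encode_list (map num (gates i s ! g))) [0..<12])) [0..<K])"

lemma encode_ps:
  "encode ps = concat (map (\<lambda>j. encode_list (map num (L (Glob j)))) [0..<11]) @
     concat (map encode_position [0..<length ks])"
proof -
  have "concat (map (\<lambda>v. encode_list (map num (L v))) (position_nodes i)) = encode_position i" for i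
    by (simp only: position_nodes_def encode_position_def concat_map_concat map_map comp_def L.simps)
  then show ?thesis
    by (simp only: encode_def ps_def node_list_def map_append concat_append concat_map_concat map_map comp_def)
qed

end

section \<open>Program constructs\<close>

definition seqs :: "com list \<Rightarrow> com" where
  "seqs cs = foldr Seq cs Skip"

lemma seqs_simps [simp]: "seqs [] = Skip" "seqs (c # cs) = Seq c (seqs cs)"
  by (simp_all add: seqs_def)

text \<open>Counting down destroys the counter, so \<open>t\<close> counts up at the same time and
  refills \<open>v\<close> afterwards; hence \<open>v\<close> can bound further loops.\<close>

definition For :: "nat \<Rightarrow> nat \<Rightarrow> com \<Rightarrow> com" where
  "For v t c = Seq (Loop (NZ v) (Seq (Do (Dec v)) (Seq (Do (Inc t)) c)))
     (Loop (NZ t) (Seq (Do (Dec t)) (Do (Inc v))))"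

lemma com_ok_seqs: "com_ok n (seqs cs) \<longleftrightarrow> (\<forall>c \<in> set cs. com_ok n c)"
  by (induction cs) auto

lemma com_ok_For: "com_ok n (For v t c) \<longleftrightarrow> 2 \<le> v \<and> v < n \<and> 2 \<le> t \<and> t < n \<and> com_ok n c"
  by (auto simp: For_def)

text \<open>\<open>S i\<close> is the state before round \<open>i\<close>, with the counters shown
  as they are outside of the loop. During the rounds they have other values, so the body has to work
  for arbitrary \<open>a\<close> and \<open>b\<close> in their place.\<close>

lemma ex_For:
  assumes vt: "v \<noteq> t" and m: "m \<le> B"
    and S: "\<And>i. i \<le> m \<Longrightarrow> S i v = m" "\<And>i. i \<le> m \<Longrightarrow> S i t = 0"
    and body: "\<And>i a b. i < m \<Longrightarrow> ex x B c ((S i)(v := a, t := b), O' i) ((S (Suc i))(v := a, t := b), O' (Suc i))"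
  shows "ex x B (For v t c) (S 0, O' 0) (S m, O' m)"
proof -
  let ?l = "Loop (NZ v) (Seq (Do (Dec v)) (Seq (Do (Inc t)) c))" and ?l' = "Loop (NZ t) (Seq (Do (Dec t)) (Do (Inc v)))"
  have 1: "k \<le> m \<Longrightarrow> ex x B ?l ((S (m - k))(v := k, t := m - k), O' (m - k)) ((S m)(v := 0, t := m), O' m)" for k
  proof (induction k)
    case 0
    show ?case using vt by (intro ex_Loop_end[THEN back_subst[of "ex x B ?l _"]]) auto
  next
    case (Suc k)
    let ?\<sigma> = "(S (m - Suc k))(v := Suc k, t := m - Suc k)"
    have "Suc (m - Suc k) = m - k" using Suc.prems by simp
    have e: "(?\<sigma>(v := ?\<sigma> v - 1))(t := Suc ((?\<sigma>(v := ?\<sigma> v - 1)) t)) = (S (m - Suc k))(v := k, t := m - k)"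
      using vt Suc.prems by (auto simp: fun_eq_iff Suc_diff_Suc)
    have d: "ex x B (Do (Dec v)) (?\<sigma>, O' (m - Suc k)) (?\<sigma>(v := ?\<sigma> v - 1), O' (m - Suc k))"
      using vt by (intro ex_Dec) simp
    have i: "ex x B (Do (Inc t)) (?\<sigma>(v := ?\<sigma> v - 1), O' (m - Suc k)) ((S (m - Suc k))(v := k, t := m - k), O' (m - Suc k))"
      unfolding e[symmetric] using vt m Suc.prems by (intro ex_Inc) simp
    have b: "ex x B c ((S (m - Suc k))(v := k, t := m - k), O' (m - Suc k)) ((S (m - k))(v := k, t := m - k), O' (m - k))"
      using body[of "m - Suc k" k "m - k"] Suc.prems \<open>Suc (m - Suc k) = m - k\<close> by simp
    show ?case
    proof (rule ex_Loop_step[OF _ ex_Seq[OF d ex_Seq[OF i b]]])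
      show "holds x (fst (?\<sigma>, O' (m - Suc k))) (NZ v)" using vt by simp
      show "ex x B ?l ((S (m - k))(v := k, t := m - k), O' (m - k)) ((S m)(v := 0, t := m), O' m)"
        using Suc.prems by (intro Suc.IH) simp
    qed
  qed
  have 2: "k \<le> m \<Longrightarrow> ex x B ?l' ((S m)(v := m - k, t := k), O' m) ((S m)(v := m, t := 0), O' m)" for k
  proof (induction k)
    case 0
    show ?case using vt by (intro ex_Loop_end[THEN back_subst[of "ex x B ?l' _"]]) auto
  next
    case (Suc k)
    let ?\<sigma> = "(S m)(v := m - Suc k, t := Suc k)"
    have e: "(?\<sigma>(t := ?\<sigma> t - 1))(v := Suc ((?\<sigma>(t := ?\<sigma> t - 1)) v)) = (S m)(v := m - k, t := k)"
      using vt Suc.prems by (auto simp: fun_eq_iff Suc_diff_Suc)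
    have d: "ex x B (Do (Dec t)) (?\<sigma>, O' m) (?\<sigma>(t := ?\<sigma> t - 1), O' m)"
      using vt by (intro ex_Dec) simp
    have i: "ex x B (Do (Inc v)) (?\<sigma>(t := ?\<sigma> t - 1), O' m) ((S m)(v := m - k, t := k), O' m)"
      unfolding e[symmetric] using vt m Suc.prems by (intro ex_Inc) simp
    show ?case
    proof (rule ex_Loop_step[OF _ ex_Seq[OF d i]])
      show "holds x (fst (?\<sigma>, O' m)) (NZ t)" using vt by simp
      show "ex x B ?l' ((S m)(v := m - k, t := k), O' m) ((S m)(v := m, t := 0), O' m)"
        using Suc.prems by (intro Suc.IH) simp
    qed
  qed
  have "(S 0)(v := m, t := 0) = S 0" "(S m)(v := m, t := 0) = S m" using S vt by (auto simp: fun_eq_iff)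
  then show ?thesis
    unfolding For_def using ex_Seq[OF 1[OF order_refl] _] 2[OF order_refl] by simp
qed

definition reps :: "nat \<Rightarrow> nat \<Rightarrow> com" where
  "reps k v = seqs (replicate k (Do (Inc v)))"

lemma ex_reps: "\<sigma> v + k \<le> B \<Longrightarrow> ex x B (reps k v) (\<sigma>, o') (\<sigma>(v := \<sigma> v + k), o')"
proof (induction k arbitrary: \<sigma>)
  case 0
  then show ?case by (simp add: reps_def ex_Skip)
next
  case (Suc k)
  let ?\<tau> = "\<sigma>(v := Suc (\<sigma> v))"
  have "?\<tau>(v := ?\<tau> v + k) = \<sigma>(v := \<sigma> v + Suc k)" by (rule ext) simp
  moreover have "ex x B (reps k v) (?\<tau>, o') (?\<tau>(v := ?\<tau> v + k), o')"
    by (rule Suc.IH) (use Suc.prems in simp)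
  ultimately have "ex x B (reps k v) (?\<tau>, o') (\<sigma>(v := \<sigma> v + Suc k), o')" by (simp only:)
  moreover have "ex x B (Do (Inc v)) (\<sigma>, o') (?\<tau>, o')" using Suc.prems by (intro ex_Inc) simp
  ultimately show ?case unfolding reps_def replicate_Suc seqs_simps by (rule ex_Seq[rotated])
qed

definition reset :: "nat \<Rightarrow> com" where
  "reset v = Loop (NZ v) (Do (Dec v))"

lemma ex_reset: "ex x B (reset v) (\<sigma>, o') (\<sigma>(v := 0), o')"
proof (induction "\<sigma> v" arbitrary: \<sigma>)
  case 0
  then have "\<sigma>(v := 0) = \<sigma>" by auto
  then show ?case unfolding reset_def using 0 by (metis ex_Loop_end fst_conv holds.simps(1))
next
  case (Suc k)
  have "ex x B (reset v) (\<sigma>(v := \<sigma> v - 1), o') ((\<sigma>(v := \<sigma> v - 1))(v := 0), o')"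
    using Suc.hyps(2) by (intro Suc.hyps(1)) simp
  then have loop: "ex x B (reset v) (\<sigma>(v := \<sigma> v - 1), o') (\<sigma>(v := 0), o')"
    unfolding fun_upd_upd .
  have "0 < \<sigma> v" using Suc.hyps(2)[symmetric] by simp
  then show ?case
    using ex_Loop_step[OF _ ex_Dec loop[unfolded reset_def]] unfolding reset_def by simp
qed

definition prints :: "bool list \<Rightarrow> nat \<Rightarrow> com \<Rightarrow> (nat \<Rightarrow> nat) \<Rightarrow> bool list \<Rightarrow> bool" where
  "prints x B c \<sigma> w \<longleftrightarrow> (\<forall>o'. ex x B c (\<sigma>, o') (\<sigma>, o' @ w))"

lemma prints_Skip: "prints x B Skip \<sigma> []"
  by (simp add: prints_def ex_Skip)

lemma prints_Out: "prints x B (Do (Out b)) \<sigma> [b]"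
  by (simp add: prints_def ex_Out)

lemma prints_Seq: "prints x B c \<sigma> w \<Longrightarrow> prints x B d \<sigma> w' \<Longrightarrow> prints x B (Seq c d) \<sigma> (w @ w')"
  unfolding prints_def by (metis append.assoc ex_Seq)

lemma prints_seqs:
  "(\<And>a. a \<in> set cs \<Longrightarrow> prints x B (f a) \<sigma> (g a)) \<Longrightarrow> prints x B (seqs (map f cs)) \<sigma> (concat (map g cs))"
  by (induction cs) (auto intro: prints_Skip prints_Seq)

text \<open>A node is described by registers and a constant, whose sum is its number.\<close>

type_synonym desc = "nat list \<times> nat"

definition value_of :: "(nat \<Rightarrow> nat) \<Rightarrow> desc \<Rightarrow> nat" where
  "value_of \<sigma> d = sum_list (map \<sigma> (fst d)) + snd d"

text \<open>In unary a sum is a concatenation: the summands are printed one after another and no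
  addition is performed.\<close>

definition emit_node :: "desc \<Rightarrow> com" where
  "emit_node d = Seq (seqs (map (\<lambda>v. For v 15 (Do (Out True))) (fst d)))
     (seqs (map (\<lambda>b. Do (Out b)) (replicate (Suc (snd d)) True @ [False])))"

definition emit_list :: "desc list \<Rightarrow> com" where
  "emit_list ds = Seq (seqs (map emit_node ds)) (Do (Out False))"

definition desc_ok :: "nat \<Rightarrow> (nat \<Rightarrow> nat) \<Rightarrow> desc \<Rightarrow> bool" where
  "desc_ok B \<sigma> d \<longleftrightarrow> \<sigma> 15 = 0 \<and> (\<forall>v \<in> set (fst d). v \<noteq> 15 \<and> \<sigma> v \<le> B)"

lemma prints_reg:
  assumes "\<sigma> 15 = 0" "v \<noteq> 15" "\<sigma> v \<le> B"
  shows "prints x B (For v 15 (Do (Out True))) \<sigma> (replicate (\<sigma> v) True)"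
  unfolding prints_def
proof
  fix o'
  have "ex x B (Do (Out True)) (\<sigma>(v := a, 15 := b), o' @ replicate i True)
      (\<sigma>(v := a, 15 := b), o' @ replicate (Suc i) True)" for a b i
    using ex_Out[of x B True "\<sigma>(v := a, 15 := b)" "o' @ replicate i True"]
    by (simp add: replicate_append_same)
  then show "ex x B (For v 15 (Do (Out True))) (\<sigma>, o') (\<sigma>, o' @ replicate (\<sigma> v) True)"
    using ex_For[of v 15 "\<sigma> v" B "\<lambda>_. \<sigma>" x "Do (Out True)" "\<lambda>i. o' @ replicate i True"] assms by simp
qed

lemma concat_replicate_True: "concat (map (\<lambda>v. replicate (f v) True) vs) = replicate (sum_list (map f vs)) True"
  by (induction vs) (auto simp: replicate_add)

lemma prints_node:
  assumes "desc_ok B \<sigma> d"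
  shows "prints x B (emit_node d) \<sigma> (encode_node (value_of \<sigma> d))"
proof -
  have "prints x B (seqs (map (\<lambda>v. For v 15 (Do (Out True))) (fst d))) \<sigma>
      (concat (map (\<lambda>v. replicate (\<sigma> v) True) (fst d)))"
    using assms by (intro prints_seqs prints_reg) (auto simp: desc_ok_def)
  moreover have "prints x B (seqs (map (\<lambda>b. Do (Out b)) bs)) \<sigma> (concat (map (\<lambda>b. [b]) bs))" for bs
    by (intro prints_seqs prints_Out)
  ultimately have "prints x B (emit_node d) \<sigma> (replicate (sum_list (map \<sigma> (fst d))) True @
      concat (map (\<lambda>b. [b]) (replicate (Suc (snd d)) True @ [False])))"
    unfolding emit_node_def concat_replicate_True by (rule prints_Seq)
  moreover have "concat (map (\<lambda>b. [b]) bs) = bs" for bs :: "bool list" by (induction bs) auto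
  moreover have "replicate (sum_list (map \<sigma> (fst d))) True @ replicate (Suc (snd d)) True @ [False] =
      encode_node (value_of \<sigma> d)"
    by (simp add: encode_node_def value_of_def replicate_add replicate_append_same flip: append_assoc)
  ultimately show ?thesis by metis
qed

lemma prints_nodes:
  assumes "\<And>d. d \<in> set ds \<Longrightarrow> desc_ok B \<sigma> d"
  shows "prints x B (seqs (map emit_node ds)) \<sigma> (concat (map encode_node (map (value_of \<sigma>) ds)))"
  using assms prints_seqs[of ds x B emit_node \<sigma> "\<lambda>d. encode_node (value_of \<sigma> d)"] prints_node
  by (simp add: comp_def)

lemma prints_list:
  assumes "\<And>d. d \<in> set ds \<Longrightarrow> desc_ok B \<sigma> d"
  shows "prints x B (emit_list ds) \<sigma> (encode_list (map (value_of \<sigma>) ds))"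
  unfolding emit_list_def encode_list_def by (intro prints_Seq prints_nodes prints_Out assms)

text \<open>Horner's rule, with the argument in register 2.\<close>

primrec horner_value :: "nat list \<Rightarrow> nat \<Rightarrow> nat" where
  "horner_value [] n = 0"
| "horner_value (a # cs) n = a + n * horner_value cs n"

text \<open>Multiplication by \<open>n\<close>: while register \<open>r\<close> is counted down,
  register 2 is added to register 14 once per unit; the product is then moved back to
  \<open>r\<close>. Register 16 is the spare counter of the inner loop.\<close>

primrec horner :: "nat \<Rightarrow> nat list \<Rightarrow> com" where
  "horner r [] = Skip"
| "horner r (a # cs) = seqs [horner r cs, Loop (NZ r) (Seq (Do (Dec r)) (For 2 16 (Do (Inc 14)))),
     Loop (NZ 14) (Seq (Do (Dec 14)) (Do (Inc r))), reps a r]"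

lemma horner_value_mono: "n \<le> n' \<Longrightarrow> horner_value cs n \<le> horner_value cs n'"
  by (induction cs) (auto intro: add_mono mult_le_mono)

lemma horner_value_poly: "horner_value (coeffs p) n = poly p n"
proof -
  have "horner_value cs n = poly (Poly cs) n" for cs by (induction cs) auto
  then show ?thesis by simp
qed

lemma ex_add_times:
  assumes r: "r \<notin> {2, 14, 16}" and s: "\<sigma> 2 = n" "\<sigma> 16 = 0" "n \<le> B" and b: "\<sigma> 14 + \<sigma> r * n \<le> B"
  shows "ex x B (Loop (NZ r) (Seq (Do (Dec r)) (For 2 16 (Do (Inc 14))))) (\<sigma>, o')
    (\<sigma>(r := 0, 14 := \<sigma> 14 + \<sigma> r * n), o')"
  using s b
proof (induction "\<sigma> r" arbitrary: \<sigma>)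
  case 0
  then have "\<sigma>(r := 0, 14 := \<sigma> 14 + \<sigma> r * n) = \<sigma>" by (auto simp: fun_eq_iff)
  then show ?case using 0 by (metis ex_Loop_end fst_conv holds.simps(1))
next
  case (Suc k)
  let ?\<tau> = "\<sigma>(r := \<sigma> r - 1)"
  let ?S = "\<lambda>i. ?\<tau>(14 := \<sigma> 14 + i)"
  have bnd: "\<sigma> 14 + n + k * n \<le> B" using Suc.prems(4) Suc.hyps(2)[symmetric] by (simp add: add_ac)
  have "ex x B (For 2 16 (Do (Inc 14))) (?S 0, o') (?S n, o')"
  proof (rule ex_For[where S = ?S and O' = "\<lambda>_. o'" and m = n])
    fix i a b assume "i < n"
    then have "((?S i)(2 := a, 16 := b)) 14 < B" using bnd by simp
    then have "ex x B (Do (Inc 14)) ((?S i)(2 := a, 16 := b), o')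
        (((?S i)(2 := a, 16 := b))(14 := Suc (((?S i)(2 := a, 16 := b)) 14)), o')" by (rule ex_Inc)
    moreover have "((?S i)(2 := a, 16 := b))(14 := Suc (((?S i)(2 := a, 16 := b)) 14)) = (?S (Suc i))(2 := a, 16 := b)"
      by (auto simp: fun_eq_iff)
    ultimately show "ex x B (Do (Inc 14)) ((?S i)(2 := a, 16 := b), o') ((?S (Suc i))(2 := a, 16 := b), o')"
      by simp
  qed (use Suc.prems r in auto)
  moreover have "?S 0 = ?\<tau>" using r by (auto simp: fun_eq_iff)
  ultimately have body: "ex x B (Seq (Do (Dec r)) (For 2 16 (Do (Inc 14)))) (\<sigma>, o') (?S n, o')"
    using ex_Seq[OF ex_Dec[of \<sigma> r]] Suc.hyps(2) by simp
  have "ex x B (Loop (NZ r) (Seq (Do (Dec r)) (For 2 16 (Do (Inc 14))))) (?S n, o')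
      ((?S n)(r := 0, 14 := ?S n 14 + ?S n r * n), o')"
    using Suc.hyps(2)[symmetric] Suc.prems r bnd by (intro Suc.hyps(1)) auto
  moreover have "(?S n)(r := 0, 14 := ?S n 14 + ?S n r * n) = \<sigma>(r := 0, 14 := \<sigma> 14 + \<sigma> r * n)"
    using r Suc.hyps(2)[symmetric] by (auto simp: fun_eq_iff)
  ultimately have "ex x B (Loop (NZ r) (Seq (Do (Dec r)) (For 2 16 (Do (Inc 14))))) (?S n, o')
      (\<sigma>(r := 0, 14 := \<sigma> 14 + \<sigma> r * n), o')" by simp
  from ex_Loop_step[OF _ body this] show ?case using Suc.hyps(2) by simp
qed

lemma ex_move:
  assumes "v \<noteq> r" "\<sigma> v + \<sigma> r \<le> B"
  shows "ex x B (Loop (NZ v) (Seq (Do (Dec v)) (Do (Inc r)))) (\<sigma>, o') (\<sigma>(v := 0, r := \<sigma> r + \<sigma> v), o')"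
  using assms(2)
proof (induction "\<sigma> v" arbitrary: \<sigma>)
  case 0
  then have "\<sigma>(v := 0, r := \<sigma> r + \<sigma> v) = \<sigma>" by (auto simp: fun_eq_iff)
  then show ?case using 0 by (metis ex_Loop_end fst_conv holds.simps(1))
next
  case (Suc k)
  let ?\<tau> = "\<sigma>(v := \<sigma> v - 1)"
  let ?\<rho> = "?\<tau>(r := Suc (?\<tau> r))"
  have body: "ex x B (Seq (Do (Dec v)) (Do (Inc r))) (\<sigma>, o') (?\<rho>, o')"
    using Suc.hyps(2)[symmetric] Suc.prems assms(1) by (intro ex_Seq[OF ex_Dec ex_Inc]) auto
  have "ex x B (Loop (NZ v) (Seq (Do (Dec v)) (Do (Inc r)))) (?\<rho>, o') (?\<rho>(v := 0, r := ?\<rho> r + ?\<rho> v), o')"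
    using Suc.hyps(2)[symmetric] Suc.prems assms(1) by (intro Suc.hyps(1)) auto
  moreover have "?\<rho>(v := 0, r := ?\<rho> r + ?\<rho> v) = \<sigma>(v := 0, r := \<sigma> r + \<sigma> v)"
    using Suc.hyps(2)[symmetric] assms(1) by (auto simp: fun_eq_iff)
  ultimately have "ex x B (Loop (NZ v) (Seq (Do (Dec v)) (Do (Inc r)))) (?\<rho>, o') (\<sigma>(v := 0, r := \<sigma> r + \<sigma> v), o')"
    by simp
  from ex_Loop_step[OF _ body this] show ?case using Suc.hyps(2) by simp
qed

text \<open>The bound is taken at \<open>Suc n\<close> because it has to cover all intermediate
  values: for \<open>n = 0\<close> the higher coefficients vanish from the result but still pass
  through \<open>r\<close>.\<close>

lemma ex_horner:
  assumes r: "r \<notin> {2, 14, 16}" and s: "\<sigma> r = 0" "\<sigma> 2 = n" "\<sigma> 14 = 0" "\<sigma> 16 = 0" "n \<le> B"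
    and b: "horner_value cs (Suc n) \<le> B"
  shows "ex x B (horner r cs) (\<sigma>, o') (\<sigma>(r := horner_value cs n), o')"
  using b
proof (induction cs)
  case Nil
  have "\<sigma>(r := 0) = \<sigma>" using s by auto
  then show ?case by (simp add: ex_Skip)
next
  case (Cons a cs)
  let ?h = "horner_value cs n"
  have h: "a + n * ?h \<le> B" "?h * n \<le> B"
    using horner_value_mono[of n "Suc n" "a # cs"] Cons.prems by (simp_all add: mult.commute)
  have "ex x B (horner r cs) (\<sigma>, o') (\<sigma>(r := ?h), o')"
    by (rule Cons.IH) (use Cons.prems in simp)
  moreover have "ex x B (Loop (NZ r) (Seq (Do (Dec r)) (For 2 16 (Do (Inc 14))))) (\<sigma>(r := ?h), o')
      (\<sigma>(r := 0, 14 := ?h * n), o')"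
    using ex_add_times[OF r, of "\<sigma>(r := ?h)" n B x o'] r s h by (simp add: fun_upd_twist)
  moreover have "ex x B (Loop (NZ 14) (Seq (Do (Dec 14)) (Do (Inc r)))) (\<sigma>(r := 0, 14 := ?h * n), o')
      (\<sigma>(r := ?h * n), o')"
  proof -
    have "(\<sigma>(r := 0, 14 := ?h * n))(14 := 0, r := 0 + ?h * n) = \<sigma>(r := ?h * n)"
      using r s by (auto simp: fun_eq_iff)
    then show ?thesis using ex_move[of 14 r "\<sigma>(r := 0, 14 := ?h * n)" B x o'] r h by simp
  qed
  moreover have "ex x B (reps a r) (\<sigma>(r := ?h * n), o') (\<sigma>(r := a + n * ?h), o')"
    using ex_reps[of "\<sigma>(r := ?h * n)" r a B x o'] h by (simp add: mult.commute add.commute)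
  ultimately show ?case
    unfolding horner.simps horner_value.simps seqs_simps by (intro ex_Seq[OF _ ex_Seq[OF _ ex_Seq[OF _ ex_Seq[OF _ ex_Skip]]]])
qed

lemma com_ok_horner: "r < n \<Longrightarrow> 2 \<le> r \<Longrightarrow> 17 \<le> n \<Longrightarrow> com_ok n (horner r cs)"
  by (induction cs) (auto simp: com_ok_seqs com_ok_For reps_def)

section \<open>The printing program\<close>

text \<open>
  A program that runs through grid positions \<open>i\<close> keeps the registers in \<open>D\<close> at the values \<open>dy i\<close> and
  prints \<open>w i\<close>; the other registers are its parameters, with values given by \<open>\<rho>\<close>.
\<close>

locale sweep =
  fixes x :: "bool list" and B :: nat and D :: "nat set" and dy :: "nat \<Rightarrow> nat \<Rightarrow> nat"
    and \<rho> :: "nat \<Rightarrow> nat" and w :: "nat \<Rightarrow> bool list"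
begin

definition pat :: "(nat \<Rightarrow> nat) \<Rightarrow> nat \<Rightarrow> nat \<Rightarrow> nat" where
  "pat \<sigma> i v = (if v \<in> D then dy i v else \<sigma> v)"

text \<open>\<open>R\<close> contains the parameters that have to hold their values; all other
  registers outside of \<open>D\<close> are arbitrary. This freedom lets a program serve as the body
  of a loop whose counters are in the midst of being changed.\<close>

definition advances :: "nat set \<Rightarrow> com \<Rightarrow> nat \<Rightarrow> nat \<Rightarrow> bool" where
  "advances R c p q \<longleftrightarrow> p \<le> q \<and> (\<forall>\<sigma> o'. (\<forall>v \<in> R. \<sigma> v = \<rho> v) \<longrightarrow>
     ex x B c (pat \<sigma> p, o') (pat \<sigma> q, o' @ concat (map w [p..<q])))"

lemma pat_upd: "v \<notin> D \<Longrightarrow> (pat \<sigma> i)(v := a) = pat (\<sigma>(v := a)) i"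
  by (rule ext) (auto simp: pat_def)

lemma advances_le: "advances R c p q \<Longrightarrow> p \<le> q"
  by (simp add: advances_def)

lemma advances_mono: "advances R c p q \<Longrightarrow> R \<subseteq> R' \<Longrightarrow> advances R' c p q"
  unfolding advances_def by blast

lemma advances_Skip: "advances R Skip p p"
  by (simp add: advances_def ex_Skip)

lemma advances_Seq:
  assumes "advances R c p q" "advances R d q r"
  shows "advances R (Seq c d) p r"
  unfolding advances_def
proof (intro conjI allI impI)
  show "p \<le> r" using assms advances_le le_trans by blast
  fix \<sigma> o' assume \<sigma>: "\<forall>v \<in> R. \<sigma> v = \<rho> v"
  obtain l where kl: "r = q + l"
    using assms[THEN advances_le] by (auto simp: le_iff_add)
  have 1: "ex x B c (pat \<sigma> p, o') (pat \<sigma> q, o' @ concat (map w [p..<q]))"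
    using assms(1) \<sigma> unfolding advances_def by blast
  have 2: "ex x B d (pat \<sigma> q, o' @ concat (map w [p..<q]))
      (pat \<sigma> r, (o' @ concat (map w [p..<q])) @ concat (map w [q..<r]))"
    using assms(2) \<sigma> unfolding advances_def by blast
  have "[p..<r] = [p..<q] @ [q..<r]" unfolding kl by (rule upt_add_eq_append[OF advances_le[OF assms(1)]])
  then show "ex x B (Seq c d) (pat \<sigma> p, o') (pat \<sigma> r, o' @ concat (map w [p..<r]))"
    using ex_Seq[OF 1 2] by simp
qed

lemma advances_Seq':
  "advances R c p q \<Longrightarrow> advances R' d q r \<Longrightarrow> R \<subseteq> S \<Longrightarrow> R' \<subseteq> S \<Longrightarrow> advances S (Seq c d) p r"
  by (meson advances_Seq advances_mono)

text \<open>Each round handles a block of \<open>d\<close> positions. The body must not rely on the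
  two counters, whence \<open>v\<close> and \<open>t\<close> are not in \<open>R\<close>, but the
  loop as a whole does.\<close>

lemma advances_For:
  assumes v: "v \<notin> D" "t \<notin> D" "v \<noteq> t" "v \<notin> R" "t \<notin> R" and m: "\<rho> v = m" "\<rho> t = 0" "m \<le> B"
    and q: "q = p + m * d"
    and c: "\<And>i. i < m \<Longrightarrow> advances R c (p + i * d) (p + Suc i * d)"
  shows "advances (insert v (insert t R)) (For v t c) p q"
  unfolding advances_def
proof (intro conjI allI impI)
  show "p \<le> q" using q by simp
  fix \<sigma> o' assume \<sigma>: "\<forall>v \<in> insert v (insert t R). \<sigma> v = \<rho> v"
  let ?S = "\<lambda>i. pat \<sigma> (p + i * d)" and ?O = "\<lambda>i. o' @ concat (map w [p..<p + i * d])"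
  have "ex x B (For v t c) (?S 0, ?O 0) (?S m, ?O m)"
  proof (rule ex_For[where S = ?S and O' = ?O])
    show "?S i v = m" "?S i t = 0" for i using \<sigma> v m by (simp_all add: pat_def)
    fix i a b assume i: "i < m"
    have "\<forall>u \<in> R. (\<sigma>(v := a, t := b)) u = \<rho> u" using \<sigma> v by auto
    then have "ex x B c (pat (\<sigma>(v := a, t := b)) (p + i * d), ?O i) (pat (\<sigma>(v := a, t := b)) (p + Suc i * d),
        ?O i @ concat (map w [p + i * d..<p + Suc i * d]))"
      using c[OF i] unfolding advances_def by blast
    moreover have "(?S j)(v := a, t := b) = pat (\<sigma>(v := a, t := b)) (p + j * d)" for j
      using v by (simp add: pat_upd)
    moreover have "[p..<p + Suc i * d] = [p..<p + i * d] @ [p + i * d..<p + Suc i * d]"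
    proof -
      have e: "p + Suc i * d = p + i * d + d" by simp
      show ?thesis unfolding e by (rule upt_add_eq_append) simp
    qed
    ultimately show "ex x B c ((?S i)(v := a, t := b), ?O i) ((?S (Suc i))(v := a, t := b), ?O (Suc i))"
      by (simp only: map_append concat_append append_assoc)
  qed (use v m in simp_all)
  then show "ex x B (For v t c) (pat \<sigma> p, o') (pat \<sigma> q, o' @ concat (map w [p..<q]))"
    using q by simp
qed

lemma advances_For1:
  assumes "v \<notin> D" "t \<notin> D" "v \<noteq> t" "v \<notin> R" "t \<notin> R" "\<rho> v = m" "\<rho> t = 0" "m \<le> B"
    and "q = p + m" and "\<And>i. p \<le> i \<Longrightarrow> i < q \<Longrightarrow> advances R c i (Suc i)"
  shows "advances (insert v (insert t R)) (For v t c) p q"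
  using advances_For[of v t R m q p 1 c] assms by simp

end

context symbols
begin

text \<open>
  Registers 2 to 9 hold \<open>n\<close>, \<open>P\<close>, \<open>T\<close>, \<open>T - 1\<close>, \<open>W - 1\<close>, \<open>W - 2\<close>, \<open>12 * K * W\<close> and \<open>N\<close>. Registers 10, 11
  and 12 hold the offsets of the gates at the current position, at its left neighbour and at the one
  below; the remaining registers are scratch space.
\<close>

abbreviation "own s g \<equiv> ([10::nat], 11 + 12 * s + g :: nat)"
abbreviation "gl j \<equiv> ([] :: nat list, j :: nat)"

definition gate_descs :: "kind \<Rightarrow> bool \<Rightarrow> bool \<Rightarrow> bool \<Rightarrow> bool \<Rightarrow> nat \<Rightarrow> desc list list" where
  "gate_descs \<kappa> lf rf df uf s =
    [[own s 1, if s = 0 then gl 8 else own (s - 1) 1, own s 3, gl 0],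
     [own s 2, own s 4, own s 8, own s 0, if Suc s < K then own (Suc s) 0 else gl 0],
     [own s 3, own s 1], [own s 0, own s 2],
     [gl 8, own s 5, own s 1, own s 7],
     [own s 6] @ ((if kind_ok \<kappa> s then [] else [own s 8]) @
        (if rf then map (\<lambda>t. ([10], 11 + 12 * K + 12 * t + 8)) (filter (\<lambda>t. \<not> right_ok s t) [0..<K]) else []) @
        (if uf then map (\<lambda>t. ([10, 8], 11 + 12 * t + 8)) (filter (\<lambda>t. \<not> up_ok s t) [0..<K]) else [])) @ [own s 4],
     [own s 7, own s 5], [own s 4, own s 6],
     [own s 9, own s 1, own s 11] @ (if kind_ok \<kappa> s then [] else [own s 5]) @
        (if lf then map (\<lambda>t. ([11], 11 + 12 * t + 5)) (filter (\<lambda>t. \<not> right_ok t s) [0..<K]) else []) @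
        (if df then map (\<lambda>t. ([12], 11 + 12 * t + 5)) (filter (\<lambda>t. \<not> up_ok t s) [0..<K]) else []),
     [own s 10, gl 9, own s 8],
     [own s 11, own s 9], [own s 8, own s 10]]"

lemma gate_descs_regs:
  "\<forall>ds \<in> set (gate_descs \<kappa> lf rf df uf s). \<forall>d \<in> set ds. set (fst d) \<subseteq> {8, 10, 11, 12}"
proof -
  have b: "(\<forall>d \<in> set (if c then as else bs). Q d) = (if c then \<forall>d \<in> set as. Q d else \<forall>d \<in> set bs. Q d)"
    for c as bs and Q :: "desc \<Rightarrow> bool"
    by simp
  have f: "fst (if c then a else b) = (if c then fst a else fst b)" for c and a b :: desc by simp
  have s: "set (if c then a else b) = (if c then set a else set b)" for c and a b :: "nat list" by simp
  show ?thesis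
    by (simp add: gate_descs_def ball_Un b f s split del: if_split) auto
qed

text \<open>The registers for the left and the lower neighbour start to move only when this
  neighbour exists, which agrees with truncated subtraction in their intended values.\<close>

definition step_regs :: "bool \<Rightarrow> bool \<Rightarrow> com" where
  "step_regs lf df = seqs [reps (12 * K) 10, if lf then reps (12 * K) 11 else Skip, if df then reps (12 * K) 12 else Skip]"

definition emit_position :: "kind \<Rightarrow> bool \<Rightarrow> bool \<Rightarrow> bool \<Rightarrow> bool \<Rightarrow> com" where
  "emit_position \<kappa> lf rf df uf =
     Seq (seqs (map (\<lambda>s. seqs (map emit_list (gate_descs \<kappa> lf rf df uf s))) [0..<K])) (step_regs lf df)"

definition emit_global :: "desc list \<Rightarrow> desc list \<Rightarrow> com" where
  "emit_global ds es = seqs [seqs (map emit_node ds),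
     For 9 16 (Seq (seqs (map emit_node es)) (reps (12 * K) 10)), reset 10, Do (Out False)]"

definition emit_globals :: com where
  "emit_globals = seqs [
     emit_global [gl 3, gl 10] (map (\<lambda>s. own s 0) [0..<K] @ [own (K - 1) 1]),
     emit_list [gl 2, gl 6], emit_list [gl 3, gl 1], emit_list [gl 2, gl 4, gl 0], emit_list [gl 5, gl 7, gl 3],
     emit_list [gl 6, gl 4], emit_list [gl 5, gl 1], emit_list [gl 8, gl 4],
     emit_global [gl 7] (own 0 0 # map (\<lambda>s. own s 4) [0..<K]),
     emit_global [gl 10] (map (\<lambda>s. own s 9) [0..<K]),
     emit_list [gl 9, gl 0]]"

text \<open>The flags tell whether a left, right, lower and upper neighbour exists. They and the
  kind are built into the printing code, so the grid is cut into stretches on which they are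
  constant; the last position lacks a right neighbour and is split off, hence \<open>W - 2\<close>
  in register 7.\<close>

definition emit_positions :: com where
  "emit_positions = seqs [
     emit_position Sep False True False True,
     For 4 16 (emit_position Lft True True False True),
     For 2 16 (Seq (Cnd One (emit_position (Inp 2) True True False True) (emit_position (Inp 1) True True False True))
       (Do (Inc 0))),
     emit_position (Inp 3) True True False True,
     For 3 16 (emit_position Wit True True False True),
     For 4 16 (emit_position Blk True True False True),
     For 5 16 (Seq (emit_position Sep True True True True) (For 6 17 (emit_position Mid True True True True))),
     emit_position Sep True True True False,
     For 7 16 (emit_position Acc True True True False),
     emit_position Acc True False True False]"

text \<open>Tape 0 holds the input and has no mark at its start, so its head is brought back by
  counting: register 2 remembers the length of the input.\<close>

definition program :: "(nat \<times> nat list) list \<Rightarrow> com" where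
  "program pols = seqs ([Loop Bit (Seq (Do (Inc 0)) (Do (Inc 2))), For 2 16 (Do (Dec 0))] @
     map (\<lambda>(r, cs). horner r cs) pols @ [emit_globals, emit_positions])"

end

section \<open>Agreement of the printed string with the encoded instance\<close>

locale printing = symbols + layout
begin

sublocale tiles K kind_ok right_ok up_ok ks W
  by unfold_locales (simp add: width_def)

abbreviation "n \<equiv> length x"
abbreviation "N \<equiv> length ks"

definition regs :: "nat \<Rightarrow> nat" where
  "regs v = (if v < 10 then [0, 0, n, P, T, T - 1, W - 1, W - 2, 12 * K * W, N] ! v else 0)"

text \<open>Register 0, the input head, waits at 0 during the left margin, follows the input
  columns, and then rests at \<open>n\<close>. The other three are block offsets.\<close>

definition pos_regs :: "nat \<Rightarrow> nat \<Rightarrow> nat" where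
  "pos_regs i v = (if v = 0 then min n (i - (T + 1)) else 12 * K * (if v = 10 then i else if v = 11 then i - 1 else i - W))"

lemma N_eq: "N = (T + 1) * W"
  by (rule length_kinds)

lemma W_le_N: "2 * W \<le> N"
  using T unfolding N_eq by simp

lemma map_nth_upt: "map (\<lambda>g. f (xs ! g)) [0..<length xs] = map f xs"
  by (rule nth_equalityI) simp_all

lemma length_gates: "length (gates i s) = 12"
  by (simp add: gates_def)

lemma ks_nonempty [simp]: "ks \<noteq> []"
  using W_le_N W_pos by auto

lemma gate_descs:
  assumes "i < N" "s < K" "\<sigma> 10 = 12 * K * i" "\<sigma> 11 = 12 * K * (i - 1)" "\<sigma> 12 = 12 * K * (i - W)" "\<sigma> 8 = 12 * K * W"
  shows "map (map (value_of \<sigma>)) (gate_descs (ks ! i) (1 \<le> i) (i + 1 < N) (W \<le> i) (i + W < N) s) =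
    map (map num) (gates i s)"
  using assms
  by (simp add: gate_descs_def gates_def value_of_def out_def inn_def comp_def add_ac add_mult_distrib2)

context
  fixes B :: nat
  assumes B: "12 * K * N \<le> B"
begin

interpretation sweep x B "{0, 10, 11, 12}" pos_regs regs encode_position .

lemma N_le_B: "N \<le> B"
proof -
  have "N \<le> 12 * K * N" using K by (cases K) simp_all
  then show ?thesis using B by (rule le_trans)
qed

lemma regs_le: "v < 10 \<Longrightarrow> regs v \<le> B"
proof -
  have "T \<le> T * W" using W_pos by (cases W) simp_all
  also have "T * W \<le> N" unfolding N_eq by simp
  finally have "T \<le> N" .
  moreover have "n \<le> W" "P \<le> W" by (simp_all add: width_def)
  moreover have "12 * K * W \<le> 12 * K * N" using W_le_N by (intro mult_le_mono2) linarith
  ultimately have *: "T \<le> B" "n \<le> B" "P \<le> B" "W \<le> B" "N \<le> B" "12 * K * W \<le> B"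
    using N_le_B W_le_N B by linarith+
  assume "v < 10"
  then have "v \<in> {0, 1, 2, 3, 4, 5, 6, 7, 8, 9}" by simp arith
  then show "regs v \<le> B" using * by (auto simp: regs_def)
qed

text \<open>Printing a position does not move the input head, so the first claim keeps register 0 at
  its old value. Away from the input columns this value is also the one for the next
  position.\<close>

lemma advances_position:
  assumes i: "i < N" and k: "ks ! i = \<kappa>"
    and f: "lf \<longleftrightarrow> 1 \<le> i" "rf \<longleftrightarrow> i + 1 < N" "df \<longleftrightarrow> W \<le> i" "uf \<longleftrightarrow> i + W < N"
  shows "\<forall>v \<in> {8, 15}. \<sigma> v = regs v \<Longrightarrow> ex x B (emit_position \<kappa> lf rf df uf) (pat \<sigma> i, o')
      ((pat \<sigma> (Suc i))(0 := pos_regs i 0), o' @ encode_position i)"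
    and "i < T + 1 \<or> T + 1 + n \<le> i \<Longrightarrow> advances {8, 15} (emit_position \<kappa> lf rf df uf) i (Suc i)"
proof -
  show *: "ex x B (emit_position \<kappa> lf rf df uf) (pat \<sigma> i, o')
      ((pat \<sigma> (Suc i))(0 := pos_regs i 0), o' @ encode_position i)" if \<sigma>: "\<forall>v \<in> {8, 15}. \<sigma> v = regs v" for \<sigma> o'
  proof -
    let ?\<tau> = "pat \<sigma> i"
    have \<tau>: "?\<tau> 10 = 12 * K * i" "?\<tau> 11 = 12 * K * (i - 1)" "?\<tau> 12 = 12 * K * (i - W)" "?\<tau> 8 = 12 * K * W"
        "?\<tau> 15 = 0"
      using \<sigma> by (simp_all add: pat_def pos_regs_def regs_def)
    have le: "12 * K * j \<le> B" if "j \<le> N" for j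
      using mult_le_mono2[OF that, of "12 * K"] B by (rule le_trans)
    have ok: "desc_ok B ?\<tau> d" if "ds \<in> set (gate_descs \<kappa> lf rf df uf s)" "d \<in> set ds" for ds d s
    proof -
      have "set (fst d) \<subseteq> {8, 10, 11, 12}" using gate_descs_regs that by blast
      moreover have "?\<tau> v \<le> B" if "v \<in> {8, 10, 11, 12}" for v
        using that \<tau> le[of i] le[of "i - 1"] le[of "i - W"] le[of W] i W_le_N by auto
      ultimately show ?thesis using \<tau>(5) by (auto simp: desc_ok_def)
    qed
    have out: "concat (map (\<lambda>ds. encode_list (map (value_of ?\<tau>) ds)) (gate_descs \<kappa> lf rf df uf s)) =
        concat (map (\<lambda>g. encode_list (map num (gates i s ! g))) [0..<12])" if s: "s < K" for s
    proof -
      have "map (\<lambda>ds. encode_list (map (value_of ?\<tau>) ds)) (gate_descs \<kappa> lf rf df uf s) =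
          map encode_list (map (map (value_of ?\<tau>)) (gate_descs \<kappa> lf rf df uf s))" by simp
      also have "\<dots> = map encode_list (map (map num) (gates i s))"
        using gate_descs[OF i s \<tau>(1-4)] k f by simp
      also have "\<dots> = map (\<lambda>l. encode_list (map num l)) (gates i s)" by simp
      also have "\<dots> = map (\<lambda>g. encode_list (map num (gates i s ! g))) [0..<12]"
        using map_nth_upt[of "\<lambda>l. encode_list (map num l)" "gates i s"] by (simp only: length_gates)
      finally show ?thesis by simp
    qed
    have "prints x B (seqs (map (\<lambda>s. seqs (map emit_list (gate_descs \<kappa> lf rf df uf s))) [0..<K])) ?\<tau>
        (concat (map (\<lambda>s. concat (map (\<lambda>ds. encode_list (map (value_of ?\<tau>) ds)) (gate_descs \<kappa> lf rf df uf s))) [0..<K]))"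
      by (intro prints_seqs prints_list ok)
    also have "map (\<lambda>s. concat (map (\<lambda>ds. encode_list (map (value_of ?\<tau>) ds)) (gate_descs \<kappa> lf rf df uf s))) [0..<K] =
        map (\<lambda>s. concat (map (\<lambda>g. encode_list (map num (gates i s ! g))) [0..<12])) [0..<K]"
      using out by (intro map_cong) auto
    finally have p: "ex x B (seqs (map (\<lambda>s. seqs (map emit_list (gate_descs \<kappa> lf rf df uf s))) [0..<K]))
        (?\<tau>, o') (?\<tau>, o' @ encode_position i)"
      unfolding prints_def encode_position_def by blast
    let ?k = "12 * K"
    let ?\<tau>1 = "?\<tau>(10 := ?\<tau> 10 + ?k)"
    let ?\<tau>2 = "if lf then ?\<tau>1(11 := ?\<tau>1 11 + ?k) else ?\<tau>1"
    let ?\<tau>3 = "if df then ?\<tau>2(12 := ?\<tau>2 12 + ?k) else ?\<tau>2"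
    have e1: "?\<tau> 10 + ?k = 12 * K * Suc i" by (simp add: \<tau>)
    have e2: "1 \<le> i \<Longrightarrow> ?\<tau> 11 + ?k = 12 * K * i" using \<tau>(2) by (cases i) simp_all
    have e3: "W \<le> i \<Longrightarrow> ?\<tau> 12 + ?k = 12 * K * (Suc i - W)" using \<tau>(3) by (simp add: Suc_diff_le)
    have 1: "ex x B (reps ?k 10) (?\<tau>, o'') (?\<tau>1, o'')" for o''
      using e1 le[of "Suc i"] i by (intro ex_reps) simp
    have 2: "ex x B (if lf then reps ?k 11 else Skip) (?\<tau>1, o'') (?\<tau>2, o'')" for o''
    proof (cases lf)
      case True
      then have "?\<tau>1 11 + ?k \<le> B" using e2 f(1) le[of i] i by simp
      then show ?thesis using True by (simp only: if_True ex_reps)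
    qed (simp only: if_False ex_Skip)
    have 3: "ex x B (if df then reps ?k 12 else Skip) (?\<tau>2, o'') (?\<tau>3, o'')" for o''
    proof (cases df)
      case True
      then have "?\<tau>2 12 + ?k \<le> B" using e3 f(3) le[of "Suc i - W"] i by simp
      then show ?thesis using True by (simp only: if_True ex_reps)
    qed (simp only: if_False ex_Skip)
    have "?\<tau>3 = (pat \<sigma> (Suc i))(0 := pos_regs i 0)"
    proof (rule ext)
      fix v :: nat
      have "v = 0 \<or> v = 10 \<or> v = 11 \<or> v = 12 \<or> v \<notin> {0, 10, 11, 12}" by blast
      then show "?\<tau>3 v = ((pat \<sigma> (Suc i))(0 := pos_regs i 0)) v"
        using e1 e2 e3 f(1,3) by (elim disjE) (auto simp: pat_def pos_regs_def not_le)
    qed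
    then show ?thesis
      unfolding emit_position_def step_regs_def seqs_simps
      using ex_Seq[OF p ex_Seq[OF 1 ex_Seq[OF 2 ex_Seq[OF 3 ex_Skip]]]] by (simp only:)
  qed
  assume "i < T + 1 \<or> T + 1 + n \<le> i"
  then have "pos_regs (Suc i) 0 = pos_regs i 0" by (auto simp: pos_regs_def)
  then have "(pat \<sigma> (Suc i))(0 := pos_regs i 0) = pat \<sigma> (Suc i)" for \<sigma> by (auto simp: pat_def fun_eq_iff)
  then show "advances {8, 15} (emit_position \<kappa> lf rf df uf) i (Suc i)"
    using * unfolding advances_def by simp
qed

text \<open>Here the kind depends on \<open>x\<close>: the bit under the input head selects the code
  for \<open>Inp 2\<close> or \<open>Inp 1\<close>, and the head moves on afterwards.\<close>

lemma advances_input: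
  assumes j: "j < n" and i: "i = T + 1 + j"
  shows "advances {8, 15} (Seq (Cnd One (emit_position (Inp 2) True True False True) (emit_position (Inp 1) True True False True))
    (Do (Inc 0))) i (Suc i)"
  unfolding advances_def
proof (intro conjI allI impI)
  fix \<sigma> o' assume \<sigma>: "\<forall>v \<in> {8, 15}. \<sigma> v = regs v"
  have iW: "i < W" using i j by (simp add: width_def)
  then have iN: "i < N" "i + 1 < N" "i + W < N" "\<not> W \<le> i" "1 \<le> i" using W_le_N i by auto
  have k: "ks ! i = Inp (bits x ! j)" using nth_kinds[of 0 i] iW nth_row0(2)[OF j] i by simp
  have h: "pat \<sigma> i 0 = j" using i j by (simp add: pat_def pos_regs_def)
  let ?c = "\<lambda>a. emit_position (Inp a) True True False True"
  let ?\<tau> = "(pat \<sigma> (Suc i))(0 := pos_regs i 0)"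
  have "ex x B (?c (bits x ! j)) (pat \<sigma> i, o') (?\<tau>, o' @ encode_position i)"
    using iN by (intro advances_position(1)[OF iN(1) k] \<sigma>) simp_all
  moreover have "?c (bits x ! j) = (if holds x (pat \<sigma> i) One then ?c 2 else ?c 1)"
    using h j by (simp add: bits_def)
  ultimately have 1: "ex x B (Cnd One (?c 2) (?c 1)) (pat \<sigma> i, o') (?\<tau>, o' @ encode_position i)"
    by (intro ex_Cnd) simp
  have "n \<le> B" using regs_le[of 2] by (simp add: regs_def)
  then have "?\<tau> 0 < B" using i j by (simp add: pos_regs_def)
  then have "ex x B (Do (Inc 0)) (?\<tau>, o' @ encode_position i) (?\<tau>(0 := Suc (?\<tau> 0)), o' @ encode_position i)"
    by (rule ex_Inc)
  moreover have "?\<tau>(0 := Suc (?\<tau> 0)) = pat \<sigma> (Suc i)"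
    using i j by (auto simp: pat_def pos_regs_def fun_eq_iff)
  ultimately have 2: "ex x B (Do (Inc 0)) (?\<tau>, o' @ encode_position i) (pat \<sigma> (Suc i), o' @ encode_position i)"
    by (simp only:)
  show "ex x B (Seq (Cnd One (?c 2) (?c 1)) (Do (Inc 0))) (pat \<sigma> i, o') (pat \<sigma> (Suc i), o' @ concat (map encode_position [i..<Suc i]))"
    using ex_Seq[OF 1 2] by simp
qed simp

lemma advances_positions: "advances {2, 3, 4, 5, 6, 7, 8, 15, 16, 17} emit_positions 0 N"
proof -
  have W_eq: "W = 2 * T + n + P + 2" by (simp add: width_def)
  have r0: "advances {8, 15} (emit_position \<kappa> True True False True) i (Suc i)"
    if "ks ! i = \<kappa>" "1 \<le> i" "i < T + 1 \<or> T + 1 + n \<le> i" "i < W" for \<kappa> i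
    using that W_le_N by (intro advances_position(2)) simp_all
  have kind: "t \<le> T \<Longrightarrow> c < W \<Longrightarrow> ks ! (t * W + c) =
      (if c = 0 then Sep else if t = 0 then row0 x P T ! c else if t < T then Mid else Acc)" for t c
    by (rule nth_kinds)
  have p1: "advances {8, 15} (emit_position Sep False True False True) 0 1"
    using kind[of 0 0] W_le_N W_pos unfolding One_nat_def by (intro advances_position(2)) simp_all
  have p2: "advances (insert 4 (insert 16 {8, 15})) (For 4 16 (emit_position Lft True True False True)) 1 (1 + T)"
  proof (rule advances_For1)
    fix i assume "1 \<le> i" "i < 1 + T"
    then show "advances {8, 15} (emit_position Lft True True False True) i (Suc i)"
      using kind[of 0 i] nth_row0(1)[of i] W_eq by (intro r0) simp_all
  qed (use regs_le[of 4] in \<open>simp_all add: regs_def\<close>)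
  have p3: "advances (insert 2 (insert 16 {8, 15})) (For 2 16 (Seq (Cnd One (emit_position (Inp 2) True True False True)
      (emit_position (Inp 1) True True False True)) (Do (Inc 0)))) (1 + T) (1 + T + n)"
  proof (rule advances_For1)
    fix i assume "1 + T \<le> i" "i < 1 + T + n"
    then show "advances {8, 15} (Seq (Cnd One (emit_position (Inp 2) True True False True)
      (emit_position (Inp 1) True True False True)) (Do (Inc 0))) i (Suc i)"
      by (intro advances_input[of "i - (T + 1)"]) simp_all
  qed (use regs_le[of 2] in \<open>simp_all add: regs_def\<close>)
  have p4: "advances {8, 15} (emit_position (Inp 3) True True False True) (1 + T + n) (2 + T + n)"
    using kind[of 0 "1 + T + n"] nth_row0(3) W_eq r0[of "1 + T + n" "Inp 3"] by simp
  have p5: "advances (insert 3 (insert 16 {8, 15})) (For 3 16 (emit_position Wit True True False True)) (2 + T + n) (2 + T + n + P)"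
  proof (rule advances_For1)
    fix i assume i: "2 + T + n \<le> i" "i < 2 + T + n + P"
    define j where "j = i - (2 + T + n)"
    have j: "i = T + 2 + n + j" "j < P" using i by (auto simp: j_def)
    show "advances {8, 15} (emit_position Wit True True False True) i (Suc i)"
      using kind[of 0 i] nth_row0(4)[OF j(2)] j W_eq by (intro r0) simp_all
  qed (use regs_le[of 3] in \<open>simp_all add: regs_def\<close>)
  have p6: "advances (insert 4 (insert 16 {8, 15})) (For 4 16 (emit_position Blk True True False True)) (2 + T + n + P) W"
  proof (rule advances_For1)
    fix i assume i: "2 + T + n + P \<le> i" "i < W"
    define j where "j = i - (2 + T + n + P)"
    have j: "i = T + 2 + n + P + j" "j < T" using i W_eq by (auto simp: j_def)
    show "advances {8, 15} (emit_position Blk True True False True) i (Suc i)"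
      using kind[of 0 i] nth_row0(5)[OF j(2)] j W_eq by (intro r0) simp_all
  qed (use regs_le[of 4] W_eq in \<open>simp_all add: regs_def\<close>)
  have row_step: "advances {8, 15} (emit_position \<kappa> True rf True uf) i (Suc i)"
    if "ks ! i = \<kappa>" "W \<le> i" "i < N" "rf \<longleftrightarrow> i + 1 < N" "uf \<longleftrightarrow> i + W < N" for \<kappa> rf uf i
    using that W_pos W_eq by (intro advances_position(2)) simp_all
  \<comment> \<open>The \<open>T - 1\<close> middle rows, one block of length \<open>W\<close> per
    round: a separator and an inner loop over \<open>W - 1\<close> cells with its own spare register
    17.\<close>
  have p7: "advances (insert 5 (insert 16 (insert 6 (insert 17 {8, 15})))) (For 5 16 (Seq (emit_position Sep True True True True)
      (For 6 17 (emit_position Mid True True True True)))) W (T * W)"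
  proof (rule advances_For[where d = W])
    show "T * W = W + (T - 1) * W" using T by (cases T) simp_all
    fix t assume t: "t < T - 1"
    let ?p = "W + t * W"
    have tW: "Suc (Suc t) * W \<le> T * W" using t by (intro mult_le_mono1) simp
    have lt: "?p + c + W < N" if "c < W" for c using tW that unfolding N_eq by simp
    have a: "advances {8, 15} (emit_position Sep True True True True) ?p (Suc ?p)"
      using kind[of "Suc t" 0] t lt[of 0] W_pos by (intro row_step) simp_all
    have b: "advances (insert 6 (insert 17 {8, 15})) (For 6 17 (emit_position Mid True True True True)) (Suc ?p) (?p + W)"
    proof (rule advances_For1)
      fix i assume i: "Suc ?p \<le> i" "i < ?p + W"
      then obtain c where c: "i = ?p + c" by (auto simp: le_iff_add)
      then have c': "0 < c" "c < W" using i by auto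
      show "advances {8, 15} (emit_position Mid True True True True) i (Suc i)"
        using kind[of "Suc t" c] t lt[OF c'(2)] c c' by (intro row_step) simp_all
    next
      show "?p + W = Suc ?p + (W - 1)" using W_pos by linarith
    qed (use regs_le[of 6] in \<open>simp_all add: regs_def\<close>)
    have e: "W + Suc t * W = ?p + W" by simp
    show "advances (insert 6 (insert 17 {8, 15})) (Seq (emit_position Sep True True True True)
      (For 6 17 (emit_position Mid True True True True))) ?p (W + Suc t * W)"
      unfolding e by (rule advances_Seq'[OF a b]) auto
  qed (use regs_le[of 5] in \<open>simp_all add: regs_def\<close>)
  have TW: "W \<le> T * W" using mult_le_mono1[OF T, of W] by simp
  have N': "N = T * W + W" by (simp add: N_eq)
  have p8: "advances {8, 15} (emit_position Sep True True True False) (T * W) (T * W + 1)"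
    using kind[of T 0] T TW W_pos N' row_step[of "T * W" Sep True False] by simp
  have p9: "advances (insert 7 (insert 16 {8, 15})) (For 7 16 (emit_position Acc True True True False)) (T * W + 1) (N - 1)"
  proof (rule advances_For1)
    fix i assume i: "T * W + 1 \<le> i" "i < N - 1"
    then obtain c where c: "i = T * W + c" by (auto simp: le_iff_add)
    then have c': "0 < c" "c + 1 < W" using i N' by auto
    show "advances {8, 15} (emit_position Acc True True True False) i (Suc i)"
      using kind[of T c] T trans_le_add1[OF TW, of c] c c' N' by (intro row_step) simp_all
  next
    show "N - 1 = T * W + 1 + (W - 2)" using N' W_pos by linarith
  qed (use regs_le[of 7] in \<open>simp_all add: regs_def\<close>)
  have "N - 1 = T * W + (W - 1)" using N' W_pos by simp
  then have k: "ks ! (N - 1) = Acc" using kind[of T "W - 1"] W_pos T by simp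
  have "Suc (N - 1) = N" using N' W_pos by simp
  then have p10: "advances {8, 15} (emit_position Acc True False True False) (N - 1) N"
    using row_step[OF k, of False False] trans_le_add1[OF TW, of "W - 1"] \<open>N - 1 = T * W + (W - 1)\<close> N' W_pos
    by simp
  show ?thesis
    unfolding emit_positions_def seqs_simps
    by (rule advances_Seq[OF advances_mono[OF p1]], simp,
        rule advances_Seq[OF advances_mono[OF p2]], simp,
        rule advances_Seq[OF advances_mono[OF p3]], simp,
        rule advances_Seq[OF advances_mono[OF p4]], simp,
        rule advances_Seq[OF advances_mono[OF p5]], simp,
        rule advances_Seq[OF advances_mono[OF p6]], simp,
        rule advances_Seq[OF advances_mono[OF p7]], simp,
        rule advances_Seq[OF advances_mono[OF p8]], simp,
        rule advances_Seq[OF advances_mono[OF p9]], simp,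
        rule advances_Seq[OF advances_mono[OF p10]], simp,
        rule advances_Skip)
qed

end

end

context printing
begin

context
  fixes B :: nat
  assumes B: "12 * K * N \<le> B"
begin

lemma ex_emit_global:
  assumes ds: "\<And>d. d \<in> set ds \<Longrightarrow> fst d = []" and es: "\<And>d. d \<in> set es \<Longrightarrow> fst d = [10]"
  shows "ex x B (emit_global ds es) (regs, o')
    (regs, o' @ encode_list (map snd ds @ concat (map (\<lambda>i. map (\<lambda>d. 12 * K * i + snd d) es) [0..<N])))"
proof -
  let ?S = "\<lambda>i. regs(10 := 12 * K * i)"
  let ?w = "\<lambda>i. concat (map encode_node (map (value_of (?S i)) es))"
  let ?O = "\<lambda>i. (o' @ concat (map encode_node (map (value_of regs) ds))) @ concat (map ?w [0..<i])"
  have le: "12 * K * i \<le> B" if "i \<le> N" for i using mult_le_mono2[OF that, of "12 * K"] B by (rule le_trans)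
  have 1: "ex x B (seqs (map emit_node ds)) (regs, o') (?S 0, ?O 0)"
  proof -
    have "prints x B (seqs (map emit_node ds)) regs (concat (map encode_node (map (value_of regs) ds)))"
      using ds by (intro prints_nodes) (simp add: desc_ok_def regs_def)
    moreover have "?S 0 = regs" by (auto simp: regs_def)
    ultimately show ?thesis unfolding prints_def by simp
  qed
  have 2: "ex x B (For 9 16 (Seq (seqs (map emit_node es)) (reps (12 * K) 10))) (?S 0, ?O 0) (?S N, ?O N)"
  proof (rule ex_For[where S = ?S and O' = ?O])
    show "N \<le> B" by (rule N_le_B[OF B])
    show "?S i 9 = N" "?S i 16 = 0" for i by (simp_all add: regs_def)
    fix i a b assume i: "i < N"
    let ?\<tau> = "(?S i)(9 := a, 16 := b)"
    have "prints x B (seqs (map emit_node es)) ?\<tau> (concat (map encode_node (map (value_of ?\<tau>) es)))"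
      using es le[of i] i by (intro prints_nodes) (simp add: desc_ok_def regs_def)
    moreover have "map (value_of ?\<tau>) es = map (value_of (?S i)) es"
      using es by (auto simp: value_of_def)
    ultimately have "prints x B (seqs (map emit_node es)) ?\<tau> (?w i)" by (simp only:)
    then have a: "ex x B (seqs (map emit_node es)) (?\<tau>, ?O i) (?\<tau>, ?O i @ ?w i)"
      unfolding prints_def by (rule spec)
    have "?\<tau> 10 + 12 * K = 12 * K * Suc i" by simp
    then have "ex x B (reps (12 * K) 10) (?\<tau>, ?O i @ ?w i) (?\<tau>(10 := ?\<tau> 10 + 12 * K), ?O i @ ?w i)"
      using le[of "Suc i"] i by (intro ex_reps) simp
    moreover have "?\<tau>(10 := ?\<tau> 10 + 12 * K) = (?S (Suc i))(9 := a, 16 := b)"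
      unfolding \<open>?\<tau> 10 + 12 * K = 12 * K * Suc i\<close> by (auto simp: fun_eq_iff)
    moreover have "?O i @ ?w i = ?O (Suc i)" by simp
    ultimately have "ex x B (reps (12 * K) 10) (?\<tau>, ?O i @ ?w i) ((?S (Suc i))(9 := a, 16 := b), ?O (Suc i))"
      by (simp only:)
    with a show "ex x B (Seq (seqs (map emit_node es)) (reps (12 * K) 10)) (?\<tau>, ?O i)
        ((?S (Suc i))(9 := a, 16 := b), ?O (Suc i))" by (rule ex_Seq)
  qed simp
  have 3: "ex x B (reset 10) (?S N, ?O N) (regs, ?O N)"
  proof -
    have "(?S N)(10 := 0) = regs" by (auto simp: regs_def fun_eq_iff)
    then show ?thesis using ex_reset[of x B 10 "?S N" "?O N"] by (simp only:)
  qed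
  have 4: "ex x B (Do (Out False)) (regs, ?O N) (regs, ?O N @ [False])" by (rule ex_Out)
  have m: "map (value_of regs) ds = map snd ds" using ds by (auto simp: value_of_def)
  have m': "map (value_of (?S i)) es = map (\<lambda>d. 12 * K * i + snd d) es" for i
    using es by (auto simp: value_of_def)
  have "?O N @ [False] = o' @ encode_list (map snd ds @ concat (map (\<lambda>i. map (\<lambda>d. 12 * K * i + snd d) es) [0..<N]))"
    unfolding m m'
    by (simp only: encode_list_def map_append concat_append concat_map_concat map_map comp_def append_assoc)
  then show ?thesis
    unfolding emit_global_def seqs_simps
    using ex_Seq[OF 1 ex_Seq[OF 2 ex_Seq[OF 3 ex_Seq[OF 4 ex_Skip]]]] by (simp only:)
qed

lemma ex_emit_globals:
  "ex x B emit_globals (regs, o') (regs, o' @ concat (map (\<lambda>j. encode_list (map num (L (Glob j)))) [0..<11]))"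
proof -
  have small: "ex x B (emit_list ds) (regs, o'') (regs, o'' @ encode_list (map snd ds))"
    if "\<forall>d \<in> set ds. fst d = []" for ds o''
  proof -
    have "prints x B (emit_list ds) regs (encode_list (map (value_of regs) ds))"
      using that by (intro prints_list) (simp add: desc_ok_def regs_def)
    moreover have "map (value_of regs) ds = map snd ds" using that by (auto simp: value_of_def)
    ultimately show ?thesis by (simp add: prints_def)
  qed
  have r: "[0..<11] = [0, 1, 2, 3, 4, 5, 6, 7, 8, 9, 10::nat]" by code_simp
  have g0: "map num (L RT) = map snd [gl 3, gl 10] @ concat (map (\<lambda>i. map (\<lambda>d. 12 * K * i + snd d)
      (map (\<lambda>s. own s 0) [0..<K] @ [own (K - 1) 1])) [0..<N])"
    by (simp add: L_glob map_concat comp_def add_ac)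
  have g8: "map num (L DD) = map snd [gl 7] @ concat (map (\<lambda>i. map (\<lambda>d. 12 * K * i + snd d)
      (own 0 0 # map (\<lambda>s. own s 4) [0..<K])) [0..<N])"
    by (simp add: L_glob map_concat comp_def add_ac)
  have g9: "map num (L C2) = map snd [gl 10] @ concat (map (\<lambda>i. map (\<lambda>d. 12 * K * i + snd d)
      (map (\<lambda>s. own s 9) [0..<K])) [0..<N])"
    by (simp add: L_glob map_concat comp_def add_ac)
  have 0: "ex x B (emit_global [gl 3, gl 10] (map (\<lambda>s. own s 0) [0..<K] @ [own (K - 1) 1])) (regs, o'')
      (regs, o'' @ encode_list (map num (L RT)))" for o''
    unfolding g0 by (rule ex_emit_global) auto
  have 8: "ex x B (emit_global [gl 7] (own 0 0 # map (\<lambda>s. own s 4) [0..<K])) (regs, o'')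
      (regs, o'' @ encode_list (map num (L DD)))" for o''
    unfolding g8 by (rule ex_emit_global) auto
  have 9: "ex x B (emit_global [gl 10] (map (\<lambda>s. own s 9) [0..<K])) (regs, o'')
      (regs, o'' @ encode_list (map num (L C2)))" for o''
    unfolding g9 by (rule ex_emit_global) auto
  have s: "ex x B (emit_list ds) (regs, o'') (regs, o'' @ encode_list (map num (L (Glob j))))"
    if "\<forall>d \<in> set ds. fst d = []" "map snd ds = map num (L (Glob j))" for ds j o''
    using small[OF that(1)] that(2) by simp
  show ?thesis
    unfolding r emit_globals_def seqs_simps list.map concat.simps append_Nil2 append_assoc[symmetric]
    by (rule ex_Seq[OF 0], rule ex_Seq[OF s[where j = 1]], simp, simp add: L_small,
        rule ex_Seq[OF s[where j = 2]], simp, simp add: L_small,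
        rule ex_Seq[OF s[where j = 3]], simp, simp add: L_small,
        rule ex_Seq[OF s[where j = 4]], simp, simp add: L_small,
        rule ex_Seq[OF s[where j = 5]], simp, simp add: L_small,
        rule ex_Seq[OF s[where j = 6]], simp, simp add: L_small,
        rule ex_Seq[OF s[where j = 7]], simp, simp add: L_small,
        rule ex_Seq[OF 8], rule ex_Seq[OF 9], rule ex_Seq[OF s[where j = 10]], simp, simp add: L_small, rule ex_Skip)
qed

text \<open>After the input length is measured, the list \<open>pols\<close> fills the registers 3
  to 9 in order; the state \<open>?S r\<close> of the proof has exactly the parameters below
  \<open>r\<close> in place.\<close>

lemma ex_program:
  assumes len: "map fst pols = [3..<10]"
    and pols: "\<And>r cs. (r, cs) \<in> set pols \<Longrightarrow> horner_value cs n = regs r \<and> horner_value cs (Suc n) \<le> B"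
  shows "\<exists>\<sigma>. ex x B (program pols) (\<lambda>_. 0, []) (\<sigma>, encode ps)"
proof -
  interpret sweep x B "{0, 10, 11, 12}" pos_regs regs encode_position .
  have n: "n \<le> B" using regs_le[OF B, of 2] by (simp add: regs_def)
  let ?A = "\<lambda>i. (\<lambda>_ :: nat. 0 :: nat)(0 := i, 2 := i)"
  have 1: "k \<le> n \<Longrightarrow> ex x B (Loop Bit (Seq (Do (Inc 0)) (Do (Inc 2)))) (?A (n - k), []) (?A n, [])" for k
  proof (induction k)
    case 0
    show ?case unfolding diff_zero by (rule ex_Loop_end) simp
  next
    case (Suc k)
    let ?\<sigma> = "?A (n - Suc k)"
    have a: "ex x B (Do (Inc 0)) (?\<sigma>, []) (?\<sigma>(0 := Suc (?\<sigma> 0)), [])"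
      using n Suc.prems by (intro ex_Inc) simp
    let ?\<tau> = "?\<sigma>(0 := Suc (?\<sigma> 0))"
    have b: "ex x B (Do (Inc 2)) (?\<tau>, []) (?\<tau>(2 := Suc (?\<tau> 2)), [])"
      using n Suc.prems by (intro ex_Inc) simp
    have e: "?\<tau>(2 := Suc (?\<tau> 2)) = ?A (n - k)"
      using Suc.prems by (auto simp: fun_eq_iff)
    show ?case
    proof (rule ex_Loop_step)
      show "holds x (fst (?\<sigma>, [])) Bit" using Suc.prems by simp
      show "ex x B (Seq (Do (Inc 0)) (Do (Inc 2))) (?\<sigma>, []) (?A (n - k), [])"
        using ex_Seq[OF a b] unfolding e .
      show "ex x B (Loop Bit (Seq (Do (Inc 0)) (Do (Inc 2)))) (?A (n - k), []) (?A n, [])"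
        by (rule Suc.IH) (use Suc.prems in simp)
    qed
  qed
  let ?S = "\<lambda>r v. if v < r then regs v else 0"
  let ?T = "\<lambda>i. (\<lambda>_ :: nat. 0 :: nat)(0 := n - i, 2 := n)"
  have 2: "ex x B (For 2 16 (Do (Dec 0))) (?T 0, []) (?T n, [])"
  proof (rule ex_For[where S = ?T and O' = "\<lambda>_. []"])
    fix i a b assume "i < n"
    let ?\<tau> = "(?T i)(2 := a, 16 := b)"
    have "ex x B (Do (Dec 0)) (?\<tau>, []) (?\<tau>(0 := ?\<tau> 0 - 1), [])"
      using \<open>i < n\<close> by (intro ex_Dec) simp
    moreover have "?\<tau>(0 := ?\<tau> 0 - 1) = (?T (Suc i))(2 := a, 16 := b)" by (auto simp: fun_eq_iff)
    ultimately show "ex x B (Do (Dec 0)) (?\<tau>, []) ((?T (Suc i))(2 := a, 16 := b), [])" by (simp only:)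
  qed (use n in simp_all)
  have T: "?T 0 = ?A n" "?T n = ?S 3"
    by (auto simp: fun_eq_iff regs_def less_Suc_eq numeral_3_eq_3 numeral_2_eq_2)
  have 3: "ex x B (seqs (map (\<lambda>(r, cs). horner r cs) ps' @ cs')) (?S r, []) s'"
    if "map fst ps' = [r..<10]" "set ps' \<subseteq> set pols" "3 \<le> r" "r \<le> 10" "ex x B (seqs cs') (regs, []) s'" for r ps' cs' s'
    using that
  proof (induction ps' arbitrary: r)
    case Nil
    then have "[r..<10] = []" "r \<le> 10" by simp_all
    then have "r = 10" by simp
    then have "?S r = regs" by (auto simp: regs_def fun_eq_iff)
    then show ?case using Nil by simp
  next
    case (Cons p ps')
    have e: "[r..<10] = fst p # map fst ps'" using Cons.prems(1) by simp
    then have "r < 10" by (cases "r < 10") simp_all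
    with e have r: "r < 10" "fst p = r" "map fst ps' = [Suc r..<10]" by (auto simp: upt_conv_Cons)
    obtain cs where p: "p = (r, cs)" using r(2) by (cases p) auto
    have h: "horner_value cs n = regs r" "horner_value cs (Suc n) \<le> B" using pols[of r cs] Cons.prems(2) p by auto
    have "ex x B (horner r cs) (?S r, []) ((?S r)(r := horner_value cs n), [])"
      using r(1) Cons.prems(3) n h(2) by (intro ex_horner) (auto simp: regs_def)
    moreover have "(?S r)(r := horner_value cs n) = ?S (Suc r)" using h by (auto simp: fun_eq_iff less_Suc_eq)
    moreover have "ex x B (seqs (map (\<lambda>(r, cs). horner r cs) ps' @ cs')) (?S (Suc r), []) s'"
      using Cons r by (intro Cons.IH) auto
    ultimately have "ex x B (Seq (horner r cs) (seqs (map (\<lambda>(r, cs). horner r cs) ps' @ cs'))) (?S r, []) s'"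
      using ex_Seq by metis
    then show ?case by (simp add: p)
  qed
  let ?g = "concat (map (\<lambda>j. encode_list (map num (L (Glob j)))) [0..<11])"
  have "pat regs 0 = regs" by (auto simp: pat_def pos_regs_def regs_def fun_eq_iff)
  moreover have "\<forall>v \<in> {2, 3, 4, 5, 6, 7, 8, 15, 16, 17}. regs v = regs v" by simp
  ultimately have 4: "ex x B emit_positions (regs, ?g) (pat regs N, ?g @ concat (map encode_position [0..<N]))"
    using advances_positions[OF B] unfolding advances_def by metis
  have 5: "ex x B emit_globals (regs, []) (regs, ?g)" using ex_emit_globals[of "[]"] by simp
  have 6: "ex x B (seqs [emit_globals, emit_positions]) (regs, []) (pat regs N, encode ps)"
    unfolding seqs_simps encode_ps using ex_Seq[OF 5 ex_Seq[OF 4 ex_Skip]] by simp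
  have A0: "?A 0 = (\<lambda>_. 0)" by auto
  have 7: "ex x B (Loop Bit (Seq (Do (Inc 0)) (Do (Inc 2)))) (\<lambda>_. 0, []) (?T 0, [])"
    using 1[OF order_refl] unfolding diff_self_eq_0 A0 T(1) .
  have 8: "ex x B (For 2 16 (Do (Dec 0))) (?T 0, []) (?S 3, [])" using 2 unfolding T(2) .
  have 9: "ex x B (seqs (map (\<lambda>(r, cs). horner r cs) pols @ [emit_globals, emit_positions])) (?S 3, [])
      (pat regs N, encode ps)"
    using len 6 by (intro 3) simp_all
  have "ex x B (program pols) (\<lambda>_. 0, []) (pat regs N, encode ps)"
    unfolding program_def append_Cons append_Nil seqs_simps by (rule ex_Seq[OF 7 ex_Seq[OF 8 9]])
  then show ?thesis by (intro exI)
qed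

end

end

lemma (in symbols) com_ok_program:
  assumes "\<And>r cs. (r, cs) \<in> set pols \<Longrightarrow> 2 \<le> r \<and> r < 18"
  shows "com_ok 18 (program pols)"
proof -
  have n: "com_ok 18 (seqs (map emit_node ds))" if "\<forall>d \<in> set ds. set (fst d) \<subseteq> {8, 10, 11, 12}" for ds
    using that by (fastforce simp: com_ok_seqs emit_node_def com_ok_For)
  have l: "com_ok 18 (emit_list ds)" if "\<forall>d \<in> set ds. set (fst d) \<subseteq> {8, 10, 11, 12}" for ds
    using n[OF that] by (simp add: emit_list_def)
  have r: "com_ok 18 (reps k v)" if "2 \<le> v" "v < 18" for k v
    using that by (simp add: reps_def com_ok_seqs)
  have p: "com_ok 18 (emit_position \<kappa> lf rf df uf)" for \<kappa> lf rf df uf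
    using l[OF bspec[OF gate_descs_regs]]
    by (auto simp: emit_position_def step_regs_def com_ok_seqs r)
  have g: "com_ok 18 (emit_global ds es)"
    if "\<forall>d \<in> set ds. set (fst d) \<subseteq> {8, 10, 11, 12}" "\<forall>d \<in> set es. set (fst d) \<subseteq> {8, 10, 11, 12}" for ds es
    using n[OF that(1)] n[OF that(2)] by (simp add: emit_global_def com_ok_For r reset_def)
  have h: "com_ok 18 (horner r cs)" if "(r, cs) \<in> set pols" for r cs
    using assms[OF that] by (intro com_ok_horner) auto
  have "com_ok 18 emit_positions" by (simp add: emit_positions_def com_ok_For p)
  moreover have "com_ok 18 emit_globals" by (simp add: emit_globals_def g l)
  ultimately show ?thesis using h by (auto simp: program_def com_ok_seqs com_ok_For)
qed

section \<open>The reduction\<close>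

lemma poly_nat_mono:
  fixes p :: "nat poly"
  shows "a \<le> b \<Longrightarrow> poly p a \<le> poly p b"
  by (induction p) (auto intro: add_mono mult_le_mono)

lemma (in turing) finite_cells: "finite cells"
proof -
  let ?q = "{..<nstates M}" and ?ss = "{ss. set ss \<subseteq> {..<nsyms M} \<and> length ss = ntapes M}"
    and ?ts = "{ts. set ts \<subseteq> {..<nsyms M} \<times> (UNIV :: side set) \<and> length ts = ntapes M}"
  have "(UNIV :: side set) = {Before, Here, After}" using side.exhaust by blast
  then have "finite (UNIV :: side set)" by (metis finite.emptyI finite_insert)
  then have "finite (?q \<times> ?ss \<times> ?ts \<times> (UNIV :: bool set))"
    by (intro finite_cartesian_product finite_lists_length_eq) auto
  moreover have "cells \<subseteq> ?q \<times> ?ss \<times> ?ts \<times> UNIV" unfolding cells_def by fastforce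
  ultimately show ?thesis by (rule rev_finite_subset)
qed

lemma run_halted:
  assumes "fst (run M t w) \<in> {1, 2}" "t \<le> t'"
  shows "run M t' w = run M t w"
proof -
  have "run M (t + k) w = run M t w" for k
    using assms(1) by (induction k) (auto simp: run_def step_def)
  then show ?thesis using assms(2) by (metis le_add_diff_inverse)
qed

text \<open>One construction serves both hardness claims, since the graph has a stable matching
  whether or not \<open>x\<close> belongs to \<open>A\<close>.\<close>

lemma NP_reduction:
  assumes "A \<in> NP"
  shows "\<exists>f. polytime_computable f \<and>
    (\<forall>x. \<exists>ps \<in> pref_lists. f x = encode ps \<and> (\<exists>S. stable_matching (graph_of ps) S) \<and>
      (x \<in> A \<longleftrightarrow> (\<exists>M. dominant (graph_of ps) M)))"
proof -
  obtain R p where R: "polytime_decidable_rel R"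
    and A: "\<And>x. x \<in> A \<longleftrightarrow> (\<exists>w. length w \<le> poly p (length x) \<and> (x, w) \<in> R)"
    using assms unfolding NP_def by blast
  then obtain M q where M: "wf_turing_machine M"
    and run: "\<And>x w. fst (run M (poly q (length x + length w)) (bits x @ [3] @ bits w)) = (if (x, w) \<in> R then 1 else 2)"
    unfolding polytime_decidable_rel_def by blast
  interpret turing M by unfold_locales (rule M)
  obtain al :: "cell option list" where al: "set al = insert None (Some ` cells)"
    using finite_list[of "insert None (Some ` cells)"] finite_cells by auto
  \<comment> \<open>Symbols are indices into a list of all possible labels. Their number depends on
    the verifier only, so \<open>K\<close> and the conflict tables are constants of the
    program.\<close>
  define K where "K = length al"
  have K: "0 < K" using al by (cases al) (auto simp: K_def)
  let ?kind = "\<lambda>\<kappa> s. ok_kind \<kappa> (al ! s)" and ?right = "\<lambda>s t. ok_right (al ! s) (al ! t)"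
    and ?up = "\<lambda>s t. ok_up (al ! s) (al ! t)"
  interpret symbols K ?kind ?right ?up by unfold_locales (rule K)
  define X where "X = [:0, 1 :: nat:]"
  \<comment> \<open>A time bound for all witnesses of length at most \<open>P\<close> at once; the
    summand 1 ensures that there is at least one step.\<close>
  define pT where "pT = pcompose q (X + p) + 1"
  define pW where "pW = 2 * pT + X + p + 2"
  define pols :: "(nat \<times> nat poly) list" where
    "pols = [(3, p), (4, pT), (5, pcompose q (X + p)), (6, 2 * pT + X + p + 1), (7, 2 * pT + X + p),
      (8, [:12 * K:] * pW), (9, (pT + 1) * pW)]"
  \<comment> \<open>The first summand bounds the block offsets and thus all loop counters; composing
    with \<open>X + 1\<close> yields the values at \<open>Suc n\<close> that
    \<open>ex_horner\<close> demands.\<close>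
  define B where "B = [:12 * K:] * ((pT + 1) * pW) + sum_list (map (\<lambda>r. pcompose (snd r) (X + 1)) pols)"
  define pols' where "pols' = map (\<lambda>(r, p). (r, coeffs p)) pols"
  have X: "poly X n = n" for n by (simp add: X_def)
  have "\<exists>ps. ps \<in> pref_lists \<and> (\<exists>S. stable_matching (graph_of ps) S) \<and>
      (x \<in> A \<longleftrightarrow> (\<exists>M. dominant (graph_of ps) M)) \<and>
      (\<exists>\<sigma>. ex x (poly B (length x)) (program pols') (\<lambda>_. 0, []) (\<sigma>, encode ps))" for x
  proof -
    define P where "P = poly p (length x)"
    define T where "T = poly pT (length x)"
    have T_eq: "T = poly q (length x + P) + 1" by (simp add: T_def pT_def poly_pcompose X P_def)
    interpret turing_layout M x P T by unfold_locales (simp add: T_eq)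
    interpret printing K ?kind ?right ?up x P T by unfold_locales
    have W: "W = poly pW n" by (simp add: pW_def width_def X T_def P_def)
    have pT: "poly pT n = T" by (simp only: T_def)
    have N: "N = poly ((pT + 1) * pW) n" by (simp only: N_eq poly_mult poly_add poly_1 pT W[symmetric])
    have vals: "poly p n = P" "poly pT n = T" "poly (pcompose q (X + p)) n = T - 1"
        "poly (2 * pT + X + p + 1) n = W - 1" "poly (2 * pT + X + p) n = W - 2"
        "poly ([:12 * K:] * pW) n = 12 * K * W" "poly ((pT + 1) * pW) n = N"
      subgoal by (simp only: P_def)
      subgoal by (rule pT)
      subgoal unfolding T_eq by (simp add: poly_pcompose X P_def)
      subgoal unfolding width_def by (simp add: pT X P_def)
      subgoal unfolding width_def by (simp add: pT X P_def)
      subgoal unfolding W by simp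
      subgoal by (rule N[symmetric])
      done
    have B1: "12 * K * N \<le> poly B n" by (simp add: B_def N)
    have pol: "horner_value cs n = regs r \<and> horner_value cs (Suc n) \<le> poly B n" if r: "(r, cs) \<in> set pols'" for r cs
    proof -
      from r obtain p' where p': "(r, p') \<in> set pols" "cs = coeffs p'" by (auto simp: pols'_def)
      have "\<forall>(r, p') \<in> set pols. poly p' n = regs r"
        unfolding pols_def list.set ball_simps prod.case vals by (simp add: regs_def)
      then have "poly p' n = regs r" using p'(1) by blast
      moreover have "poly (sum_list (map (\<lambda>r. pcompose (snd r) (X + 1)) ps')) n =
          sum_list (map (\<lambda>r. poly (snd r) (Suc n)) ps')" for ps' :: "(nat \<times> nat poly) list"
        by (induction ps') (simp_all add: poly_pcompose X)
      then have "poly p' (Suc n) \<le> poly B n"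
        using member_le_sum_list[of "poly p' (Suc n)" "map (\<lambda>r. poly (snd r) (Suc n)) pols"] p'(1)
        by (force simp: B_def)
      ultimately show ?thesis by (simp add: p'(2) horner_value_poly)
    qed
    have "\<exists>\<sigma>. ex x (poly B n) (program pols') (\<lambda>_. 0, []) (\<sigma>, encode ps)"
    proof (rule ex_program[OF B1])
      show "map fst pols' = [3..<10]" unfolding pols'_def pols_def by simp
    qed (use pol in simp_all)
    moreover have "(\<exists>M. dominant (graph_of ps) M) \<longleftrightarrow> (\<exists>\<tau>. tiling ks W \<tau>)"
    proof
      assume "\<exists>M. dominant (graph_of ps) M"
      then obtain \<tau> where \<tau>: "\<And>i. i < N \<Longrightarrow> \<tau> i < K \<and> ?kind (ks ! i) (\<tau> i)"
          "\<And>i. i + 1 < N \<Longrightarrow> ?right (\<tau> i) (\<tau> (i + 1))" "\<And>i. i + W < N \<Longrightarrow> ?up (\<tau> i) (\<tau> (i + W))"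
        unfolding dominant_ps_iff by blast
      have "al ! \<tau> i \<in> insert None (Some ` cells)" if "i < N" for i
        using \<tau>(1)[OF that] nth_mem[of "\<tau> i" al] unfolding al K_def by blast
      then have "tiling ks W (\<lambda>i. al ! \<tau> i)" using \<tau> unfolding tiling_def by blast
      then show "\<exists>\<tau>. tiling ks W \<tau>" by (intro exI)
    next
      assume "\<exists>\<tau>. tiling ks W \<tau>"
      then obtain \<tau> where \<tau>: "tiling ks W \<tau>" ..
      \<comment> \<open>Outside of the grid \<open>\<tau>\<close> may take values that are no
        labels; the index is meaningful only at positions below \<open>N\<close>, where all
        conditions live.\<close>
      define \<tau>' where "\<tau>' = (\<lambda>i. idx al (\<tau> i))"
      have *: "\<tau>' i < K \<and> al ! \<tau>' i = \<tau> i" if "i < N" for i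
        using \<tau> that al unfolding tiling_def \<tau>'_def K_def by (metis idx_less_length nth_idx)
      have "i < N" if "i + k < N" for i k using that by simp
      with * have "(\<forall>i < N. \<tau>' i < K \<and> ?kind (ks ! i) (\<tau>' i)) \<and>
          (\<forall>i. i + 1 < N \<longrightarrow> ?right (\<tau>' i) (\<tau>' (i + 1))) \<and> (\<forall>i. i + W < N \<longrightarrow> ?up (\<tau>' i) (\<tau>' (i + W)))"
        using \<tau> unfolding tiling_def by metis
      then show "\<exists>M. dominant (graph_of ps) M" unfolding dominant_ps_iff by blast
    qed
    moreover have "(\<exists>\<tau>. tiling ks W \<tau>) \<longleftrightarrow> x \<in> A"
    proof -
      have "fst (run M T (bits x @ [3] @ bits w)) = 1 \<longleftrightarrow> (x, w) \<in> R" if "length w \<le> P" for w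
      proof -
        let ?t = "poly q (length x + length w)"
        \<comment> \<open>The verifier halts earlier on shorter witnesses; its verdict remains
          unchanged up to \<open>T\<close> because halting configurations are fixed points.\<close>
        have "?t \<le> poly q (n + P)" using that by (intro poly_nat_mono) simp
        then have "?t \<le> T" by (simp add: T_eq)
        then show ?thesis using run[of x w] run_halted[of M ?t "bits x @ [3] @ bits w" T] by (auto split: if_splits)
      qed
      then show ?thesis unfolding tiling_iff A P_def[symmetric] by blast
    qed
    ultimately show ?thesis using ps_in stable_ps by blast
  qed
  then obtain g where g: "\<And>x. g x \<in> pref_lists" "\<And>x. \<exists>S. stable_matching (graph_of (g x)) S"
      "\<And>x. x \<in> A \<longleftrightarrow> (\<exists>M. dominant (graph_of (g x)) M)"
      "\<And>x. \<exists>\<sigma>. ex x (poly B (length x)) (program pols') (\<lambda>_. 0, []) (\<sigma>, encode (g x))"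
    by metis
  have "com_ok 18 (program pols')"
    by (rule com_ok_program) (auto simp: pols'_def pols_def)
  then have "polytime_computable (\<lambda>x. encode (g x))"
    by (rule polytime_computable_program[OF _ _ g(4)]) simp
  then show ?thesis using g(1-3) by blast
qed

theorem theorem15:
  shows "NP_hard encode pref_lists (\<lambda>ps. \<exists>M. dominant (graph_of ps) M) \<and>
         NP_hard encode {ps \<in> pref_lists. \<exists>S. stable_matching (graph_of ps) S}
           (\<lambda>ps. \<exists>M. dominant (graph_of ps) M)"
proof -
  have "NP_hard encode {ps \<in> pref_lists. \<exists>S. stable_matching (graph_of ps) S}
      (\<lambda>ps. \<exists>M. dominant (graph_of ps) M)"
    unfolding NP_hard_def using NP_reduction by fast
  \<comment> \<open>A reduction that only produces instances with a stable matching is in particular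
    a reduction into all preference lists.\<close>
  moreover from this have "NP_hard encode pref_lists (\<lambda>ps. \<exists>M. dominant (graph_of ps) M)"
    unfolding NP_hard_def by fast
  ultimately show ?thesis by blast
qed

end
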